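(* Consider the interconnected system described in the context, with a partition $\{1,\dots,n\}=I_\Sigma\cup I_{\max}$, and assume each subsystem $i$ has an ISS Lyapunov function $V_i$ (in the mixed sense defined in the context) with gains $\gamma_{ij}\in\mathcal{K}_\infty\cup\{0\}$, $\gamma_i\in\mathcal{K}$. Let $\Gamma$ and $\overline\Gamma$ be the associated operators. If there exists $\alpha\in\mathcal{K}_\infty$ such that $\Gamma\circ D_\alpha(s)\not\ge s$ for all $s\in\mathbb{R}^n_+\setminus\{0\}$, then the whole system $\dot x=f(x,u)$ is ISS; moreover there exist an $\Omega$-path $\sigma$ and $\phi\in\mathcal{K}_\infty$ such that $\overline\Gamma(\sigma(r),\phi(r))<\sigma(r)$ for all $r>0$, and $V(x)=\max_{i=1,\dots,n}\sigma_i^{-1}(V_i(x_i))$ is an ISS Lyapunov function for the whole system.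
   Context: The interconnection is $\dot x_i=f_i(x_1,\dots,x_n,u_i)$, $i=1,\dots,n$, $x_i\in\mathbb{R}^{N_i}$, $u_i\in\mathbb{R}^{m_i}$, each $f_i$ continuous and, for every $r$, locally Lipschitz in $x=(x_1^T,\dots,x_n^T)^T$ uniformly in $|u_i|\le r$; written as $\dot x=f(x,u)$. $\mathcal{K}$: continuous strictly increasing functions $\mathbb{R}_+\to\mathbb{R}_+$ vanishing at $0$; $\mathcal{K}_\infty$: unbounded ones. A continuous $\rho:\mathbb{R}_+\to\mathbb{R}_+$ is positive definite if $\rho(r)=0\iff r=0$. $V:\mathbb{R}^N\to\mathbb{R}_+$ is proper and positive definite if $\psi_1(\|x\|)\le V(x)\le\psi_2(\|x\|)$ for some $\psi_1,\psi_2\in\mathcal{K}_\infty$. An ISS Lyapunov function for $\dot x=f(x,u)$ is a continuous $V$, proper, positive definite, locally Lipschitz on $\mathbb{R}^N\setminus\{0\}$, such that for some $\gamma\in\mathcal{K}$ and positive definite $\alpha$, at all points of differentiability, $V(x)\ge\gamma(\|u\|)\Rightarrow\nabla V(x)f(x,u)\le-\alpha(\|x\|)$. $V_i:\mathbb{R}^{N_i}\to\mathbb{R}_+$ is an ISS Lyapunov function for subsystem $i$ if it is continuous, proper, positive definite, locally Lipschitz on $\mathbb{R}^{N_i}\setminus\{0\}$, and there are $\gamma_{ij}\in\mathcal{K}_\infty\cup\{0\}$ ($\gamma_{ii}\equiv0$), $\gamma_i\in\mathcal{K}$ and positive definite $\alpha_i$ such that at all points of differentiability of $V_i$: for $i\in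 I_\Sigma$, $V_i(x_i)\ge\sum_j\gamma_{ij}(V_j(x_j))+\gamma_i(\|u\|)\Rightarrow\nabla V_i(x_i)f_i(x,u)\le-\alpha_i(\|x_i\|)$; for $i\in I_{\max}$, $V_i(x_i)\ge\max\{\max_j\gamma_{ij}(V_j(x_j)),\gamma_i(\|u\|)\}\Rightarrow\nabla V_i(x_i)f_i(x,u)\le-\alpha_i(\|x_i\|)$. $\Gamma(s)=(\Gamma_i(s))_i$ with $\Gamma_i(s)=\sum_j\gamma_{ij}(s_j)$ ($i\in I_\Sigma$), $\Gamma_i(s)=\max_j\gamma_{ij}(s_j)$ ($i\in I_{\max}$). $\overline\Gamma:\mathbb{R}^n_+\times\mathbb{R}_+\to\mathbb{R}^n_+$ is $\overline\Gamma_i(s,r)=\sum_j\gamma_{ij}(s_j)+\gamma_i(r)$ for $i\in I_\Sigma$ and $\overline\Gamma_i(s,r)=\max\{\max_j\gamma_{ij}(s_j),\gamma_i(r)\}$ for $i\in I_{\max}$. $D_\alpha(s)=(D_i(s_i))_i$ with $D_i=\mathrm{id}+\alpha$ for $i\in I_\Sigma$, $D_i=\mathrm{id}$ for $i\in I_{\max}$. For $x,y\in\mathbb{R}^n$: $x<y$ iff $x_i<y_i$ for all $i$; $x\not\ge y$ iff $x_i<y_i$ for some $i$. A continuous $\sigma=(\sigma_1,\dots,\sigma_n)$ with $\sigma_i\in\mathcal{K}_\infty$ is an $\Omega$-path (with respect to $\Gamma$) if (i) each $\sigma_i^{-1}$ is locally Lipschitz on $(0,\infty)$; (ii) for every compact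 $P\subset(0,\infty)$ there are constants $0<c\le C$ with $c\le(\sigma_i^{-1})'(r)\le C$ for all $r\in P$ at which $\sigma_i^{-1}$ is differentiable; (iii) $\Gamma(\sigma(r))<\sigma(r)$ for all $r>0$. *)

theory Defs
  imports "HOL-Analysis.Analysis"
begin

text \<open>Class K: continuous, strictly increasing on [0,oo), vanishing at 0
  (values at negative arguments are irrelevant).\<close>
definition classK :: "(real \<Rightarrow> real) \<Rightarrow> bool" where
  "classK g \<longleftrightarrow> g 0 = 0 \<and> continuous_on {0..} g \<and> strict_mono_on {0..} g"

definition classKinf :: "(real \<Rightarrow> real) \<Rightarrow> bool" where
  "classKinf g \<longleftrightarrow> classK g \<and> filterlim g at_top at_top"

definition posdef :: "(real \<Rightarrow> real) \<Rightarrow> bool" where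
  "posdef \<rho> \<longleftrightarrow> continuous_on {0..} \<rho> \<and> (\<forall>r\<ge>0. 0 \<le> \<rho> r) \<and> (\<forall>r\<ge>0. \<rho> r = 0 \<longleftrightarrow> r = 0)"

definition classKL :: "(real \<Rightarrow> real \<Rightarrow> real) \<Rightarrow> bool" where
  "classKL \<beta> \<longleftrightarrow> continuous_on ({0..} \<times> {0..}) (\<lambda>(s, t). \<beta> s t)
     \<and> (\<forall>t\<ge>0. classK (\<lambda>s. \<beta> s t))
     \<and> (\<forall>s\<ge>0. (\<forall>t1 t2. 0 \<le> t1 \<longrightarrow> t1 \<le> t2 \<longrightarrow> \<beta> s t2 \<le> \<beta> s t1) \<and> (\<beta> s \<longlongrightarrow> 0) at_top)"

definition loc_lipschitz_on :: "'a::metric_space set \<Rightarrow> ('a \<Rightarrow> 'b::metric_space) \<Rightarrow> bool" where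
  "loc_lipschitz_on S V \<longleftrightarrow> (\<forall>x\<in>S. \<exists>r>0. \<exists>L. L-lipschitz_on (cball x r \<inter> S) V)"

definition proper_posdef :: "'a::real_normed_vector set \<Rightarrow> ('a \<Rightarrow> real) \<Rightarrow> bool" where
  "proper_posdef S V \<longleftrightarrow> (\<exists>\<psi>1 \<psi>2. classKinf \<psi>1 \<and> classKinf \<psi>2 \<and>
       (\<forall>x\<in>S. \<psi>1 (norm x) \<le> V x \<and> V x \<le> \<psi>2 (norm x)))"

definition proj :: "'a::euclidean_space set \<Rightarrow> 'a \<Rightarrow> 'a" where
  "proj B x = (\<Sum>b\<in>B. (x \<bullet> b) *\<^sub>R b)"

definition block_partition :: "nat \<Rightarrow> (nat \<Rightarrow> 'a::euclidean_space set) \<Rightarrow> bool" where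
  "block_partition n B \<longleftrightarrow> (\<forall>i<n. B i \<subseteq> Basis) \<and>
     (\<forall>i<n. \<forall>j<n. i \<noteq> j \<longrightarrow> B i \<inter> B j = {}) \<and> (\<Union>i<n. B i) = Basis"

definition admissible_input :: "(real \<Rightarrow> 'b::euclidean_space) \<Rightarrow> bool" where
  "admissible_input u \<longleftrightarrow> set_borel_measurable lebesgue {0..} u \<and>
     (\<exists>c. AE t in lebesgue. t \<in> {0..} \<longrightarrow> norm (u t) \<le> c)"

definition linf_norm :: "(real \<Rightarrow> 'b::euclidean_space) \<Rightarrow> real" where
  "linf_norm u = Inf {c. AE t in lebesgue. t \<in> {0..} \<longrightarrow> norm (u t) \<le> c}"

definition is_solution ::
  "('a::euclidean_space \<Rightarrow> 'b \<Rightarrow> 'a) \<Rightarrow> 'a \<Rightarrow> (real \<Rightarrow> 'b) \<Rightarrow> real set \<Rightarrow> (real \<Rightarrow> 'a) \<Rightarrow> bool" where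
  "is_solution F x0 u I x \<longleftrightarrow> continuous_on I x \<and> x 0 = x0 \<and>
     (\<forall>t\<in>I. (\<lambda>s. F (x s) (u s)) absolutely_integrable_on {0..t} \<and>
             x t = x0 + integral {0..t} (\<lambda>s. F (x s) (u s)))"

definition ISS :: "('a::euclidean_space \<Rightarrow> 'b::euclidean_space \<Rightarrow> 'a) \<Rightarrow> bool" where
  "ISS F \<longleftrightarrow> (\<exists>\<beta> \<gamma>. classKL \<beta> \<and> classK \<gamma> \<and>
     (\<forall>x0 u. admissible_input u \<longrightarrow>
        (\<exists>x. is_solution F x0 u {0..} x) \<and>
        (\<forall>x T. is_solution F x0 u {0..T} x \<longrightarrow>
           (\<forall>t\<in>{0..T}. norm (x t) \<le> \<beta> (norm x0) t + \<gamma> (linf_norm u)))))"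

definition ISS_lyapunov :: "('a::euclidean_space \<Rightarrow> 'b::euclidean_space \<Rightarrow> 'a) \<Rightarrow> ('a \<Rightarrow> real) \<Rightarrow> bool" where
  "ISS_lyapunov F V \<longleftrightarrow> continuous_on UNIV V \<and> proper_posdef UNIV V \<and>
     loc_lipschitz_on (UNIV - {0}) V \<and>
     (\<exists>\<gamma> \<alpha>. classK \<gamma> \<and> posdef \<alpha> \<and>
        (\<forall>x u D. (V has_derivative D) (at x) \<longrightarrow> \<gamma> (norm u) \<le> V x \<longrightarrow> D (F x u) \<le> - \<alpha> (norm x)))"

definition Gam :: "nat \<Rightarrow> nat set \<Rightarrow> (nat \<Rightarrow> nat \<Rightarrow> real \<Rightarrow> real) \<Rightarrow> (nat \<Rightarrow> real) \<Rightarrow> nat \<Rightarrow> real" where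
  "Gam n Isum \<gamma> s = (\<lambda>i. if i \<in> Isum then (\<Sum>j<n. \<gamma> i j (s j))
                         else Max ((\<lambda>j. \<gamma> i j (s j)) ` {..<n}))"

definition Gambar :: "nat \<Rightarrow> nat set \<Rightarrow> (nat \<Rightarrow> nat \<Rightarrow> real \<Rightarrow> real) \<Rightarrow> (nat \<Rightarrow> real \<Rightarrow> real)
      \<Rightarrow> (nat \<Rightarrow> real) \<Rightarrow> real \<Rightarrow> nat \<Rightarrow> real" where
  "Gambar n Isum \<gamma> \<gamma>u s r = (\<lambda>i. if i \<in> Isum then (\<Sum>j<n. \<gamma> i j (s j)) + \<gamma>u i r
                         else max (Max ((\<lambda>j. \<gamma> i j (s j)) ` {..<n})) (\<gamma>u i r))"

definition Dalpha :: "nat set \<Rightarrow> (real \<Rightarrow> real) \<Rightarrow> (nat \<Rightarrow> real) \<Rightarrow> nat \<Rightarrow> real" where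
  "Dalpha Isum \<alpha> s = (\<lambda>i. if i \<in> Isum then s i + \<alpha> (s i) else s i)"

definition sinv :: "(real \<Rightarrow> real) \<Rightarrow> real \<Rightarrow> real" where
  "sinv g = inv_into {0..} g"

definition omega_path :: "nat \<Rightarrow> nat set \<Rightarrow> (nat \<Rightarrow> nat \<Rightarrow> real \<Rightarrow> real) \<Rightarrow> (nat \<Rightarrow> real \<Rightarrow> real) \<Rightarrow> bool" where
  "omega_path n Isum \<gamma> \<sigma> \<longleftrightarrow>
     (\<forall>i<n. classKinf (\<sigma> i)) \<and>
     (\<forall>i<n. loc_lipschitz_on {0<..} (sinv (\<sigma> i))) \<and>
     (\<forall>P. compact P \<and> P \<subseteq> {0<..} \<longrightarrow>
        (\<exists>c C. 0 < c \<and> c \<le> C \<and>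
          (\<forall>i<n. \<forall>r\<in>P. \<forall>d. (sinv (\<sigma> i) has_real_derivative d) (at r) \<longrightarrow> c \<le> d \<and> d \<le> C))) \<and>
     (\<forall>r>0. \<forall>i<n. Gam n Isum \<gamma> (\<lambda>j. \<sigma> j r) i < \<sigma> i r)"

text \<open>Subsystem i has state x_i = proj (B i) x in span (B i) (= R^{N_i}) and input
  u_i = proj (C i) u in span (C i) (= R^{m_i}); V i is only relevant on span (B i).\<close>
definition sub_ISS_lyapunov ::
  "nat \<Rightarrow> nat set \<Rightarrow> (nat \<Rightarrow> 'a::euclidean_space set) \<Rightarrow> (nat \<Rightarrow> 'b::euclidean_space set)
   \<Rightarrow> (nat \<Rightarrow> 'a \<Rightarrow> 'b \<Rightarrow> 'a) \<Rightarrow> (nat \<Rightarrow> 'a \<Rightarrow> real)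
   \<Rightarrow> (nat \<Rightarrow> nat \<Rightarrow> real \<Rightarrow> real) \<Rightarrow> (nat \<Rightarrow> real \<Rightarrow> real) \<Rightarrow> (nat \<Rightarrow> real \<Rightarrow> real) \<Rightarrow> nat \<Rightarrow> bool" where
  "sub_ISS_lyapunov n Isum B C f V \<gamma> \<gamma>u \<alpha> i \<longleftrightarrow>
     continuous_on (span (B i)) (V i) \<and> proper_posdef (span (B i)) (V i) \<and>
     loc_lipschitz_on (span (B i) - {0}) (V i) \<and>
     (\<forall>j<n. classKinf (\<gamma> i j) \<or> (\<forall>s\<ge>0. \<gamma> i j s = 0)) \<and> (\<forall>s\<ge>0. \<gamma> i i s = 0) \<and>
     classK (\<gamma>u i) \<and> posdef (\<alpha> i) \<and>
     (\<forall>x u D. (V i has_derivative D) (at (proj (B i) x) within span (B i)) \<longrightarrow>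
        Gambar n Isum \<gamma> \<gamma>u (\<lambda>j. V j (proj (B j) x)) (norm u) i \<le> V i (proj (B i) x) \<longrightarrow>
        D (f i x (proj (C i) u)) \<le> - \<alpha> i (norm (proj (B i) x)))"

end

theory Submission
  imports Defs "HOL-Complex_Analysis.Great_Picard"
begin

text \<open>Let \<open>\<Gamma>\<close> be the gain operator and \<open>G s c\<close> the same operator with an additional gain \<open>c\<close> in every row.
  The small gain condition forces the set of all \<open>s \<ge> 0\<close> with \<open>s \<le> G s c\<close> to be bounded, and to shrink
  to \<open>0\<close> with \<open>c\<close>, which gives \<open>\<kappa> \<in> K\<^sub>\<infinity>\<close> such that the monotone operator \<open>A s = G s (\<kappa> (\<Sum>s))\<close> satisfies
  \<open>s \<le> A s\<close> only for \<open>s = 0\<close>. Limits of orbits of \<open>(A + id) / 2\<close> that start at ever larger \<open>s\<close> with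
  \<open>A s \<le> s\<close> form a two-sided chain \<open>A z\<^bsub>k+1\<^esub> < z\<^sub>k < z\<^bsub>k+1\<^esub>\<close> which tends to \<open>0\<close> and to infinity. Its
  piecewise linear interpolation is an \<open>\<Omega>\<close>-path, since \<open>A\<close> is monotone.

  The Lyapunov functions are only Lipschitz and decrease only where they are differentiable. By
  Rademacher's theorem this controls their increments in a fixed direction. At a differentiability
  point of the maximum, an active component touches the maximum from below, and its growth in the
  direction \<open>- F x u\<close> yields the decrease of the maximum. Along a solution the same increments bound a
  Dini derivative of \<open>V\<close>, and a solution \<open>h\<close> of \<open>h' = h / a\<close> turns the decay \<open>w' \<le> - a w\<close> of \<open>w = V \<circ> x\<close>
  into an exponential one. The resulting a priori bound makes the solutions of a truncated system,
  obtained by Picard iteration, solutions of the system itself.\<close>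

section \<open>Comparison functions\<close>

text \<open>The surplus \<alpha> is present only in the summation rows: a constant added to a sum
  must be absorbed by \<alpha>, while in a maximum row any entry larger than the constant hides it.
  The small gain condition applies the surplus before \<Gamma>, whereas the estimates produce it
  after \<Gamma>; \<open>no_excess\<close> exchanges the two by testing the condition at
  \<open>\<Gamma> s\<close>. Feeding \<open>\<kappa>\<close> of the component sum into every row
  does two jobs: it reserves room for the external input along the path, and it keeps every
  component of the chain positive and unbounded even when the gain graph is not strongly connected.
  The analytic obstacle is that decrease is assumed only where \<open>V i\<close> is differentiable,
  and a line or a trajectory may lie entirely inside the exceptional null set, so no chain rule is
  available along it. For this reason increments over short segments, obtained by averaging over
  neighbouring segments, take the place of derivatives at points, both for the maximum and along
  solutions.\<close>

lemma classK_nonneg: "classK g \<Longrightarrow> 0 \<le> x \<Longrightarrow> 0 \<le> g x"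
  unfolding classK_def strict_mono_on_def
  by (metis atLeast_iff less_eq_real_def order_refl)

lemma classK_less: "classK g \<Longrightarrow> 0 \<le> x \<Longrightarrow> x < y \<Longrightarrow> g x < g y"
  unfolding classK_def strict_mono_on_def by auto

lemma classK_mono: "classK g \<Longrightarrow> 0 \<le> x \<Longrightarrow> x \<le> y \<Longrightarrow> g x \<le> g y"
  using classK_less[of g x y] by (cases "x = y") auto

lemma classK_pos: "classK g \<Longrightarrow> 0 < x \<Longrightarrow> 0 < g x"
  using classK_less[of g 0 x] by (auto simp: classK_def)

lemma classK_0: "classK g \<Longrightarrow> g 0 = 0"
  by (simp add: classK_def)

lemma classK_cont: "classK g \<Longrightarrow> continuous_on {0..} g"
  by (simp add: classK_def)

lemma classK_le_iff:
  assumes "classK g" "0 \<le> x" "0 \<le> y" shows "g x \<le> g y \<longleftrightarrow> x \<le> y"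
proof
  show "x \<le> y" if "g x \<le> g y"
  proof (rule ccontr)
    assume "\<not> x \<le> y"
    then have "g y < g x" using classK_less[OF assms(1,3)] by simp
    then show False using that by simp
  qed
qed (rule classK_mono[OF assms(1,2)])

lemma classK_less_iff:
  assumes "classK g" "0 \<le> x" "0 \<le> y" shows "g x < g y \<longleftrightarrow> x < y"
  using classK_le_iff[OF assms(1,3,2)] by linarith

lemma classK_tendsto:
  assumes "classK g" "(f \<longlongrightarrow> l) F" "0 \<le> l" "eventually (\<lambda>x. 0 \<le> f x) F"
  shows "((\<lambda>x. g (f x)) \<longlongrightarrow> g l) F"
  using continuous_on_tendsto_compose[OF classK_cont[OF assms(1)] assms(2)] assms(3,4) by simp

lemma classKI:
  assumes "g 0 = 0" "continuous_on {0..} g" "\<And>x y. 0 \<le> x \<Longrightarrow> x < y \<Longrightarrow> g x < g y"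
  shows "classK g"
  using assms unfolding classK_def strict_mono_on_def by auto

lemma classKinfD: "classKinf g \<Longrightarrow> classK g"
  by (simp add: classKinf_def)

lemma classKinf_unbounded: "classKinf g \<Longrightarrow> filterlim g at_top at_top"
  by (simp add: classKinf_def)

lemma classKinf_exceeds:
  assumes "classKinf g" obtains R where "0 < R" "\<And>x. R \<le> x \<Longrightarrow> M < g x"
proof -
  have "eventually (\<lambda>x. M < g x) at_top"
    using classKinf_unbounded[OF assms] by (simp add: filterlim_at_top_dense)
  then obtain R where "\<And>x. R \<le> x \<Longrightarrow> M < g x" by (auto simp: eventually_at_top_linorder)
  then show ?thesis by (intro that[of "max R 1"]) auto
qed

lemma classKinfI:
  assumes "classK g" "\<And>M. \<exists>x\<ge>0. M \<le> g x"
  shows "classKinf g"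
  unfolding classKinf_def filterlim_at_top eventually_at_top_linorder
proof (intro conjI assms(1) allI)
  fix M
  obtain x where "0 \<le> x" "M \<le> g x" using assms(2) by blast
  then show "\<exists>N. \<forall>y\<ge>N. M \<le> g y"
    using classK_mono[OF assms(1), of x] by (intro exI[of _ x]) (auto intro: order_trans)
qed

lemma classK_add:
  assumes "classK g" "classK h" shows "classK (\<lambda>x. g x + h x)"
  using assms by (intro classKI continuous_intros)
    (auto simp: classK_0 classK_cont intro: add_strict_mono classK_less)

lemma classKinf_add:
  assumes "classKinf g" "classK h" shows "classKinf (\<lambda>x. g x + h x)"
proof (rule classKinfI)
  show "classK (\<lambda>x. g x + h x)" using assms by (intro classK_add) (auto simp: classKinf_def)
  fix M
  obtain R where R: "0 < R" "\<And>x. R \<le> x \<Longrightarrow> M < g x" using classKinf_exceeds[OF assms(1)] by blast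
  then show "\<exists>x\<ge>0. M \<le> g x + h x"
    using classK_nonneg[OF assms(2), of R] by (intro exI[of _ R]) (auto intro: add_increasing2 less_imp_le)
qed

lemma classK_compose:
  assumes "classK g" "classK h" shows "classK (\<lambda>x. g (h x))"
proof (rule classKI)
  show "continuous_on {0..} (\<lambda>x. g (h x))"
    using assms by (intro continuous_on_compose2[OF classK_cont classK_cont]) (auto simp: classK_nonneg)
qed (use assms in \<open>auto simp: classK_0 classK_nonneg classK_less\<close>)

lemma classKinf_compose:
  assumes "classKinf g" "classKinf h" shows "classKinf (\<lambda>x. g (h x))"
  unfolding classKinf_def
  using classK_compose[of g h] filterlim_compose[OF classKinf_unbounded classKinf_unbounded] assms
  by (auto simp: classKinf_def)

lemma classKinf_id: "classKinf (\<lambda>x. x)"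
proof (intro classKinfI classKI)
  show "\<exists>x\<ge>0. M \<le> x" for M :: real by (intro exI[of _ "max 0 M"]) auto
qed auto

lemma classK_sum:
  assumes "finite A" "\<And>i. i \<in> A \<Longrightarrow> classK (g i)" "A \<noteq> {}"
  shows "classK (\<lambda>x. \<Sum>i\<in>A. g i x)"
  using assms by (intro classKI continuous_intros sum_strict_mono) (auto simp: classK_0 classK_cont classK_less)

lemma classKinf_sum:
  assumes "finite A" "\<And>i. i \<in> A \<Longrightarrow> classKinf (g i)" "A \<noteq> {}"
  shows "classKinf (\<lambda>x. \<Sum>i\<in>A. g i x)"
proof (rule classKinfI)
  show "classK (\<lambda>x. \<Sum>i\<in>A. g i x)" using assms by (intro classK_sum) (auto simp: classKinf_def)
  fix M
  obtain i where i: "i \<in> A" using assms by auto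
  obtain R where R: "0 < R" "\<And>x. R \<le> x \<Longrightarrow> M < g i x" using classKinf_exceeds[OF assms(2)[OF i]] by blast
  have "g i R \<le> (\<Sum>i\<in>A. g i R)"
    using assms R i by (intro member_le_sum) (auto simp: classKinf_def intro: classK_nonneg)
  then show "\<exists>x\<ge>0. M \<le> (\<Sum>i\<in>A. g i x)" using R by (intro exI[of _ R]) (auto intro: order_trans less_imp_le)
qed

lemma classKinf_surj:
  assumes "classKinf g" "0 \<le> y" obtains x where "0 \<le> x" "g x = y"
proof -
  obtain R where R: "0 < R" "\<And>x. R \<le> x \<Longrightarrow> y < g x" using classKinf_exceeds[OF assms(1)] by blast
  have "\<exists>x\<ge>0. x \<le> R \<and> g x = y"
    using assms R classKinfD[OF assms(1)]
    by (intro IVT') (auto simp: classK_0 less_imp_le intro: continuous_on_subset[OF classK_cont])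
  then show ?thesis using that by auto
qed

section \<open>Inverses of unbounded comparison functions\<close>

lemma sinv_apply: "classK g \<Longrightarrow> 0 \<le> x \<Longrightarrow> sinv g (g x) = x"
  unfolding sinv_def classK_def by (intro inv_into_f_f strict_mono_on_imp_inj_on) auto

lemma sinv_image: "classKinf g \<Longrightarrow> g ` {0..} = {0..}"
proof (intro equalityI subsetI)
  assume g: "classKinf g"
  show "y \<in> {0..}" if "y \<in> g ` {0..}" for y using that classK_nonneg[OF classKinfD[OF g]] by auto
  show "y \<in> g ` {0..}" if "y \<in> {0..}" for y
    using that classKinf_surj[OF g, of y] by (metis atLeast_iff image_eqI)
qed

lemma apply_sinv: "classKinf g \<Longrightarrow> 0 \<le> y \<Longrightarrow> g (sinv g y) = y"
  unfolding sinv_def by (intro f_inv_into_f) (simp add: sinv_image)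

lemma sinv_nonneg: "classKinf g \<Longrightarrow> 0 \<le> y \<Longrightarrow> 0 \<le> sinv g y"
  unfolding sinv_def using inv_into_into[of y g "{0..}"] by (simp add: sinv_image)

lemma classKinf_sinv:
  assumes "classKinf g" shows "classKinf (sinv g)"
proof (rule classKinfI, rule classKI)
  have g: "classK g" using assms by (rule classKinfD)
  show "sinv g 0 = 0" using sinv_apply[OF g, of 0] by (simp add: classK_0[OF g])
  show less: "sinv g x < sinv g y" if "0 \<le> x" "x < y" for x y
  proof -
    have "g (sinv g x) < g (sinv g y)" using that assms by (simp add: apply_sinv)
    then show ?thesis using that sinv_nonneg[OF assms] by (simp add: classK_less_iff[OF g])
  qed
  \<comment> \<open>Extended by the identity to negative arguments, the inverse is a monotone
    surjection of the real line, and such a map is continuous.\<close>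
  define e where "e y = (if 0 \<le> y then sinv g y else y)" for y
  have "range e = UNIV"
  proof (intro equalityI subsetI)
    fix x :: real
    have "x = e (if 0 \<le> x then g x else x)"
      by (auto simp: e_def sinv_apply[OF g] classK_nonneg[OF g])
    then show "x \<in> range e" by blast
  qed auto
  moreover have "e x \<le> e y" if "x \<le> y" for x y
    using less[of x y] that sinv_nonneg[OF assms, of y] by (cases "x = y") (auto simp: e_def)
  ultimately have "continuous_on UNIV e" by (intro continuous_onI_mono) auto
  then have "continuous_on {0..} e" by (rule continuous_on_subset) simp
  then show "continuous_on {0..} (sinv g)"
    by (rule continuous_on_eq) (simp add: e_def)
  show "\<exists>x\<ge>0. M \<le> sinv g x" for M
    using sinv_apply[OF g, of "max 0 M"] classK_nonneg[OF g, of "max 0 M"]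
    by (intro exI[of _ "g (max 0 M)"]) auto
qed

lemma sinv_less_iff:
  assumes "classKinf g" "0 \<le> x" "0 \<le> y" shows "sinv g x < y \<longleftrightarrow> x < g y"
  using classK_less_iff[OF classKinfD[OF assms(1)] sinv_nonneg[OF assms(1,2)] assms(3)]
  by (simp add: apply_sinv[OF assms(1,2)])

lemma sinv_le_iff:
  assumes "classKinf g" "0 \<le> x" "0 \<le> y" shows "sinv g x \<le> y \<longleftrightarrow> x \<le> g y"
  using classK_le_iff[OF classKinfD[OF assms(1)] sinv_nonneg[OF assms(1,2)] assms(3)]
  by (simp add: apply_sinv[OF assms(1,2)])

text \<open>Infimal convolution with the absolute value: for nonnegative \<open>q\<close>, the
  largest 1-Lipschitz minorant of \<open>q\<close> on the half-line. It turns a discontinuous choice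
  of constants into a continuous one.\<close>

definition inf_conv :: "(real \<Rightarrow> real) \<Rightarrow> real \<Rightarrow> real" where
  "inf_conv q r = (INF t\<in>{0..}. q t + \<bar>r - t\<bar>)"

lemma inf_conv_bdd:
  fixes q :: "real \<Rightarrow> real"
  assumes "\<And>t. 0 \<le> t \<Longrightarrow> 0 \<le> q t" shows "bdd_below ((\<lambda>t. q t + \<bar>r - t\<bar>) ` {0..})"
proof (rule bdd_belowI)
  fix y assume "y \<in> (\<lambda>t. q t + \<bar>r - t\<bar>) ` {0..}"
  then obtain t where "0 \<le> t" "y = q t + \<bar>r - t\<bar>" by auto
  then show "0 \<le> y" using assms[of t] by simp
qed

lemma inf_conv_le:
  assumes "\<And>t. 0 \<le> t \<Longrightarrow> 0 \<le> q t" "0 \<le> t" shows "inf_conv q r \<le> q t + \<bar>r - t\<bar>"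
  unfolding inf_conv_def by (rule cINF_lower[OF inf_conv_bdd[OF assms(1)]]) (use assms(2) in auto)

lemma inf_conv_ge:
  assumes "\<And>t. 0 \<le> t \<Longrightarrow> m \<le> q t + \<bar>r - t\<bar>" shows "m \<le> inf_conv q r"
  unfolding inf_conv_def by (rule cINF_greatest) (use assms in auto)

lemma inf_conv_continuous:
  assumes "\<And>t. 0 \<le> t \<Longrightarrow> 0 \<le> q t" shows "continuous_on S (inf_conv q)"
proof -
  have *: "inf_conv q x \<le> inf_conv q y + \<bar>x - y\<bar>" for x y
  proof -
    have "inf_conv q x - \<bar>x - y\<bar> \<le> inf_conv q y"
    proof (rule inf_conv_ge)
      show "inf_conv q x - \<bar>x - y\<bar> \<le> q t + \<bar>y - t\<bar>" if "0 \<le> t" for t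
        using inf_conv_le[of q t x, OF assms that] by linarith
    qed
    then show ?thesis by linarith
  qed
  have "1-lipschitz_on S (inf_conv q)"
  proof (rule lipschitz_onI)
    show "dist (inf_conv q x) (inf_conv q y) \<le> 1 * dist x y" for x y
      using *[of x y] *[of y x] by (auto simp: dist_real_def abs_le_iff abs_minus_commute)
  qed simp
  then show ?thesis by (rule lipschitz_on_continuous_on)
qed

text \<open>Read \<open>P r c\<close> as: the constant \<open>c\<close> is admissible at
  \<open>r\<close>. The best admissible constant may jump with \<open>r\<close>, so it is replaced
  by a Lipschitz minorant; this stays positive because on each compact interval one positive
  constant is admissible throughout.\<close>

lemma posdef_below:
  fixes P :: "real \<Rightarrow> real \<Rightarrow> bool"
  assumes down: "\<And>r c d. 0 < r \<Longrightarrow> P r c \<Longrightarrow> 0 < d \<Longrightarrow> d \<le> c \<Longrightarrow> P r d"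
    and loc: "\<And>a b. 0 < a \<Longrightarrow> a \<le> b \<Longrightarrow> \<exists>c>0. \<forall>r\<in>{a..b}. P r c"
  obtains \<rho> where "posdef \<rho>" "\<And>r. 0 < r \<Longrightarrow> P r (\<rho> r)" "\<And>r. 0 \<le> r \<Longrightarrow> \<rho> r \<le> r"
proof -
  \<comment> \<open>Half of the supremum, since the supremum itself need not be admissible; the cap
    \<open>1\<close> keeps it finite.\<close>
  define q where "q r = (SUP c\<in>{c. 0 < c \<and> c \<le> 1 \<and> P r c}. c) / 2" for r
  have bdd: "bdd_above ((\<lambda>c. c) ` {c. 0 < c \<and> c \<le> 1 \<and> P r c})" for r
    by (intro bdd_aboveI[of _ 1]) auto
  have ne: "\<exists>c. 0 < c \<and> c \<le> 1 \<and> P r c" if r: "0 < r" for r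
  proof -
    obtain c where "c > 0" "P r c" using loc[OF r order_refl] by auto
    then show ?thesis using down[OF r, of c "min c 1"] by (intro exI[of _ "min c 1"]) auto
  qed
  have q_ge: "min c 1 / 2 \<le> q r" if "0 < r" "0 < c" "P r c" for r c
    unfolding q_def using down[OF that(1,3), of "min c 1"] that
    by (intro divide_right_mono cSUP_upper bdd) auto
  have q_pos: "0 < q r" if "0 < r" for r
    using ne[OF that] q_ge[OF that] by (smt (verit) half_gt_zero)
  have q_P: "P r d" if r: "0 < r" and d: "0 < d" "d \<le> q r" for r d
  proof -
    have "d < (SUP c\<in>{c. 0 < c \<and> c \<le> 1 \<and> P r c}. c)" using d by (simp add: q_def)
    then obtain c where "P r c" "d < c"
      using less_cSUP_iff[OF _ bdd, of r d] ne[OF r] by auto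
    then show ?thesis using down[OF r] d by simp
  qed
  \<comment> \<open>The value \<open>0\<close> at \<open>0\<close> forces
    \<open>inf_conv p r \<le> r\<close>, which supplies the last claim and the zero at the
    origin.\<close>
  define p where "p r = (if 0 < r then q r else 0)" for r
  have p0: "0 \<le> p r" for r using q_pos[of r] by (auto simp: p_def)
  show ?thesis
  proof
    have pos: "0 < inf_conv p r" if r: "0 < r" for r
    proof -
      obtain c where c: "c > 0" "\<forall>t\<in>{r/2..2*r}. P t c" using loc[of "r/2" "2*r"] r by auto
      have "min (min c 1 / 2) (r/2) \<le> inf_conv p r"
      proof (rule inf_conv_ge)
        fix t :: real assume t: "0 \<le> t"
        show "min (min c 1 / 2) (r/2) \<le> p t + \<bar>r - t\<bar>"
        proof (cases "t \<in> {r/2..2*r}")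
          case True
          then have "min c 1 / 2 \<le> p t" using q_ge[of t c] c r by (simp add: p_def)
          then show ?thesis by linarith
        next
          case False
          then have "r/2 \<le> \<bar>r - t\<bar>" using r by auto
          then show ?thesis using p0[of t] by linarith
        qed
      qed
      then show ?thesis using c r by (smt (verit) half_gt_zero)
    qed
    have le: "inf_conv p r \<le> \<bar>r\<bar>" "inf_conv p r \<le> p r" if "0 \<le> r" for r
      using inf_conv_le[of p 0 r] inf_conv_le[of p r r] p0 that by (auto simp: p_def)
    have "inf_conv p 0 = 0"
      using le(1)[of 0] inf_conv_ge[of 0 p 0] p0 by (auto intro!: antisym)
    with pos show "posdef (inf_conv p)"
      unfolding posdef_def using inf_conv_continuous[of p "{0..}"] p0
      by (metis less_eq_real_def less_irrefl)
    show "P r (inf_conv p r)" if "0 < r" for r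
      using q_P[OF that pos[OF that]] le(2)[of r] that by (simp add: p_def)
    show "inf_conv p r \<le> r" if "0 \<le> r" for r using le(1)[OF that] that by simp
  qed
qed

text \<open>As in \<open>posdef_below\<close>, but only constants admissible on the whole ray above
  \<open>r\<close> compete, which makes the choice monotone in \<open>r\<close>. The factor
  \<open>r / (1 + r)\<close> turns the Lipschitz minorant into a strictly increasing function, and
  \<open>large\<close> makes it unbounded.\<close>

lemma classKinf_below:
  fixes P :: "real \<Rightarrow> real \<Rightarrow> bool"
  assumes down: "\<And>r c d. 0 < r \<Longrightarrow> P r c \<Longrightarrow> 0 < d \<Longrightarrow> d \<le> c \<Longrightarrow> P r d"
    and small: "\<And>a. 0 < a \<Longrightarrow> \<exists>c>0. \<forall>r\<ge>a. P r c"
    and large: "\<And>c. \<exists>a. \<forall>r\<ge>a. P r c"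
  obtains \<kappa> where "classKinf \<kappa>" "\<And>r. 0 < r \<Longrightarrow> P r (\<kappa> r)"
proof -
  define Q where "Q r = {c. 0 < c \<and> c \<le> r \<and> (\<forall>t\<ge>r. P t c)}" for r
  define q where "q r = (if 0 < r then Sup (Q r) / 2 else 0)" for r
  have bdd: "bdd_above (Q r)" for r by (intro bdd_aboveI[of _ r]) (auto simp: Q_def)
  have ne: "Q r \<noteq> {}" if r: "0 < r" for r
  proof -
    obtain c where c: "c > 0" "\<forall>t\<ge>r. P t c" using small[OF r] by auto
    then have "min c r \<in> Q r" using r down[of _ c "min c r"] by (auto simp: Q_def)
    then show ?thesis by blast
  qed
  have q_pos: "0 < q r" if r: "0 < r" for r
  proof -
    obtain c where "c \<in> Q r" using ne[OF r] by auto
    then have "c \<le> Sup (Q r)" "0 < c" using bdd by (auto intro: cSup_upper simp: Q_def)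
    then show ?thesis using r by (simp add: q_def)
  qed
  have q0: "0 \<le> q r" for r using q_pos[of r] by (auto simp: q_def)
  have q_P: "P r d" if r: "0 < r" and d: "0 < d" "d \<le> q r" for r d
  proof -
    have "d < Sup (Q r)" using d r by (simp add: q_def)
    then obtain c where "c \<in> Q r" "d < c"
      using less_cSup_iff[OF ne[OF r] bdd] by auto
    then show ?thesis using down[OF r, of c d] d by (auto simp: Q_def)
  qed
  have q_mono: "q r \<le> q s" if "r \<le> s" for r s
  proof (cases "0 < r")
    case True
    have "Q r \<subseteq> Q s" using that by (auto simp: Q_def)
    then have "Sup (Q r) \<le> Sup (Q s)" using ne[OF True] bdd by (intro cSup_subset_mono) auto
    then show ?thesis using True that by (simp add: q_def)
  qed (use q0 in \<open>auto simp: q_def\<close>)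
  have q_large: "\<exists>a>0. \<forall>r\<ge>a. M \<le> q r" for M
  proof -
    obtain a where a: "\<forall>r\<ge>a. P r (max 1 (2*M))" using large by blast
    \<comment> \<open>Members of \<open>Q b\<close> are capped by \<open>b\<close>, so
      \<open>b\<close> is also raised above the constant; the factor \<open>2\<close> undoes the
      halving in \<open>q\<close>.\<close>
    define b where "b = max a (max 1 (2*M))"
    have "max 1 (2*M) \<in> Q b" using a by (auto simp: Q_def b_def)
    then have "max 1 (2*M) \<le> Sup (Q b)" by (intro cSup_upper bdd)
    moreover have "0 < b" by (simp add: b_def)
    ultimately have "M \<le> q b" by (simp add: q_def)
    then show ?thesis using q_mono \<open>0 < b\<close> by (intro exI[of _ b]) (auto intro: order_trans)
  qed
  let ?h = "inf_conv q"
  define \<kappa> where "\<kappa> r = ?h r * (r / (1 + r))" for r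
  have h_lower: "min (q (r/2)) (r/2) \<le> ?h r" if "0 \<le> r" for r
  proof (rule inf_conv_ge)
    show "min (q (r/2)) (r/2) \<le> q t + \<bar>r - t\<bar>" if t: "0 \<le> t" for t
    proof (cases "r/2 \<le> t")
      case True
      then show ?thesis using q_mono[OF True] by linarith
    next
      case False
      then show ?thesis using q0[of t] by linarith
    qed
  qed
  have h_le: "?h r \<le> q r" if "0 \<le> r" for r using inf_conv_le[of q r r] q0 that by simp
  have h0: "0 \<le> ?h r" for r using q0 by (intro inf_conv_ge) auto
  have h_pos: "0 < ?h r" if "0 < r" for r using h_lower[of r] q_pos[of "r/2"] that by auto
  have h_mono: "?h r \<le> ?h s" if "0 \<le> r" "r \<le> s" for r s
  proof (rule inf_conv_ge)
    show "?h r \<le> q t + \<bar>s - t\<bar>" if t: "0 \<le> t" for t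
    proof (cases "t \<le> r")
      case True
      then show ?thesis using inf_conv_le[of q t r] q0 t \<open>r \<le> s\<close> by auto
    next
      case False
      then show ?thesis using h_le[OF \<open>0 \<le> r\<close>] q_mono[of r t] by auto
    qed
  qed
  show ?thesis
  proof
    have "classK \<kappa>"
    proof (rule classKI)
      show "\<kappa> 0 = 0" by (simp add: \<kappa>_def)
      show "continuous_on {0..} \<kappa>" unfolding \<kappa>_def using q0
        by (intro continuous_intros inf_conv_continuous) auto
      fix x y :: real assume xy: "0 \<le> x" "x < y"
      have "x / (1 + x) < y / (1 + y)" using xy by (simp add: field_simps)
      then have "?h y * (x / (1 + x)) < ?h y * (y / (1 + y))"
        using h_pos[of y] xy by (intro mult_strict_left_mono) auto
      moreover have "?h x * (x / (1 + x)) \<le> ?h y * (x / (1 + x))"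
        using xy h_mono[of x y] by (intro mult_right_mono) auto
      ultimately show "\<kappa> x < \<kappa> y" by (simp add: \<kappa>_def)
    qed
    then show "classKinf \<kappa>"
    proof (rule classKinfI)
      fix M :: real
      obtain a where a: "a > 0" "\<forall>r\<ge>a. 2 * \<bar>M\<bar> \<le> q r" using q_large by blast
      define r where "r = max (2 * a) (max 1 (4 * \<bar>M\<bar>))"
      have r: "a \<le> r/2" "1 \<le> r" "2 * \<bar>M\<bar> \<le> r / 2" by (auto simp: r_def)
      have "2 * \<bar>M\<bar> \<le> ?h r" using h_lower[of r] a r by fastforce
      moreover have "1/2 \<le> r / (1 + r)" using r by (simp add: field_simps)
      ultimately have "2 * \<bar>M\<bar> * (1/2) \<le> \<kappa> r" unfolding \<kappa>_def by (intro mult_mono) (use h0 in auto)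
      then show "\<exists>x\<ge>0. M \<le> \<kappa> x" using r by (intro exI[of _ r]) auto
    qed
    show "P r (\<kappa> r)" if r: "0 < r" for r
    proof (rule q_P[OF r])
      show "0 < \<kappa> r" using h_pos[OF r] r by (simp add: \<kappa>_def)
      have "\<kappa> r \<le> ?h r * 1" unfolding \<kappa>_def using h0[of r] r by (intro mult_left_mono) auto
      then show "\<kappa> r \<le> q r" using h_le[of r] r by simp
    qed
  qed
qed

section \<open>Chains below the gain operator\<close>

lemma tendsto_Max_image:
  fixes f :: "'i \<Rightarrow> 'a \<Rightarrow> real"
  assumes "finite A" "A \<noteq> {}" "\<And>j. j \<in> A \<Longrightarrow> (f j \<longlongrightarrow> l j) F"
  shows "((\<lambda>x. Max ((\<lambda>j. f j x) ` A)) \<longlongrightarrow> Max (l ` A)) F"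
  using assms
proof (induction A rule: finite_ne_induct)
  case (insert a A)
  then have "((\<lambda>x. max (f a x) (Max ((\<lambda>j. f j x) ` A))) \<longlongrightarrow> max (l a) (Max (l ` A))) F"
    by (intro tendsto_max) auto
  then show ?case using insert.hyps by simp
qed simp

section \<open>Monotonicity and continuity of the gain operator\<close>

locale gain_operator =
  fixes n :: nat and Isum :: "nat set" and \<gamma> :: "nat \<Rightarrow> nat \<Rightarrow> real \<Rightarrow> real"
  assumes n_pos: "0 < n"
    and gains: "\<And>i j. i < n \<Longrightarrow> j < n \<Longrightarrow> classKinf (\<gamma> i j) \<or> (\<forall>s\<ge>0. \<gamma> i j s = 0)"
begin

lemma gain_mono: "i < n \<Longrightarrow> j < n \<Longrightarrow> 0 \<le> s \<Longrightarrow> s \<le> t \<Longrightarrow> \<gamma> i j s \<le> \<gamma> i j t"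
  using gains[of i j] classK_mono[of "\<gamma> i j" s t] by (auto simp: classKinf_def)

lemma gain_0: "i < n \<Longrightarrow> j < n \<Longrightarrow> \<gamma> i j 0 = 0"
  using gains[of i j] by (auto simp: classKinf_def classK_def)

lemma gain_nonneg: "i < n \<Longrightarrow> j < n \<Longrightarrow> 0 \<le> s \<Longrightarrow> 0 \<le> \<gamma> i j s"
  using gain_mono[of i j 0 s] gain_0[of i j] by simp

lemma gain_tendsto:
  assumes "i < n" "j < n" "(f \<longlongrightarrow> l) F" "0 \<le> l" "eventually (\<lambda>x. 0 \<le> f x) F"
  shows "((\<lambda>x. \<gamma> i j (f x)) \<longlongrightarrow> \<gamma> i j l) F"
proof (cases "classKinf (\<gamma> i j)")
  case True
  show ?thesis by (rule classK_tendsto[OF classKinfD[OF True] assms(3-5)])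
next
  case False
  then have 0: "\<forall>s\<ge>0. \<gamma> i j s = 0" using gains assms by blast
  then have "eventually (\<lambda>x. \<gamma> i j (f x) = \<gamma> i j l) F"
    using assms(4,5) by (auto elim: eventually_mono)
  then show ?thesis by (rule tendsto_eventually)
qed

abbreviation G :: "(nat \<Rightarrow> real) \<Rightarrow> real \<Rightarrow> nat \<Rightarrow> real" where
  "G \<equiv> Gambar n Isum \<gamma> (\<lambda>i r. r)"

abbreviation \<Gamma> :: "(nat \<Rightarrow> real) \<Rightarrow> nat \<Rightarrow> real" where
  "\<Gamma> \<equiv> Gam n Isum \<gamma>"

lemma Max_le_Max:
  assumes "\<And>j. j < n \<Longrightarrow> f j \<le> (g j :: real)"
  shows "Max (f ` {..<n}) \<le> Max (g ` {..<n})"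
proof (rule Max.boundedI)
  fix a assume "a \<in> f ` {..<n}"
  then obtain j where j: "j < n" "a = f j" by auto
  have "g j \<le> Max (g ` {..<n})" using j by (intro Max_ge) auto
  then show "a \<le> Max (g ` {..<n})" using assms[OF j(1)] j(2) by simp
qed (use n_pos in auto)

text \<open>The two sides may carry different input gains, so that the operator with the gains
  \<open>\<gamma>u\<close> can later be compared with \<open>G\<close>, whose input gain is the
  identity.\<close>

lemma Gambar_mono:
  assumes "i < n" "\<And>j. j < n \<Longrightarrow> 0 \<le> s j" "\<And>j. j < n \<Longrightarrow> s j \<le> t j" "\<gamma>u i c \<le> \<gamma>u' i d"
  shows "Gambar n Isum \<gamma> \<gamma>u s c i \<le> Gambar n Isum \<gamma> \<gamma>u' t d i"
proof -
  have m: "\<gamma> i j (s j) \<le> \<gamma> i j (t j)" if "j < n" for j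
    using gain_mono[OF assms(1) that assms(2,3)] that by simp
  have "(\<Sum>j<n. \<gamma> i j (s j)) \<le> (\<Sum>j<n. \<gamma> i j (t j))"
    by (intro sum_mono) (use m in auto)
  moreover have "Max ((\<lambda>j. \<gamma> i j (s j)) ` {..<n}) \<le> Max ((\<lambda>j. \<gamma> i j (t j)) ` {..<n})"
    using m by (rule Max_le_Max)
  ultimately show ?thesis using assms(4) unfolding Gambar_def by (auto intro: max.mono)
qed

lemma Max_gain_nonneg:
  assumes "i < n" "\<And>j. j < n \<Longrightarrow> 0 \<le> s j"
  shows "0 \<le> Max ((\<lambda>j. \<gamma> i j (s j)) ` {..<n})"
proof -
  have "0 \<le> \<gamma> i 0 (s 0)" using gain_nonneg[OF assms(1) n_pos] assms(2) n_pos by simp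
  also have "\<dots> \<le> Max ((\<lambda>j. \<gamma> i j (s j)) ` {..<n})" using n_pos by (intro Max_ge) auto
  finally show ?thesis .
qed

lemma Gam_eq_Gambar:
  assumes "i < n" "\<And>j. j < n \<Longrightarrow> 0 \<le> s j" "\<gamma>u i c = 0"
  shows "\<Gamma> s i = Gambar n Isum \<gamma> \<gamma>u s c i"
  using Max_gain_nonneg[OF assms(1,2)] assms(3) by (simp add: Gam_def Gambar_def)

lemma G_ge:
  assumes "i < n" "\<And>j. j < n \<Longrightarrow> 0 \<le> s j"
  shows "c \<le> G s c i"
proof -
  have "0 \<le> (\<Sum>j<n. \<gamma> i j (s j))" by (intro sum_nonneg) (use gain_nonneg assms in auto)
  then show ?thesis by (auto simp: Gambar_def)
qed

lemma Gam_nonneg: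
  assumes "i < n" "\<And>j. j < n \<Longrightarrow> 0 \<le> s j"
  shows "0 \<le> \<Gamma> s i"
  using G_ge[OF assms, where c=0] by (simp add: Gam_eq_Gambar[OF assms, where \<gamma>u="\<lambda>i r. r" and c=0])

lemma Gam_mono:
  assumes "i < n" "\<And>j. j < n \<Longrightarrow> 0 \<le> s j" "\<And>j. j < n \<Longrightarrow> s j \<le> t j"
  shows "\<Gamma> s i \<le> \<Gamma> t i"
proof -
  have t: "0 \<le> t j" if "j < n" for j using assms(2,3)[OF that] by simp
  show ?thesis using Gambar_mono[OF assms, where \<gamma>u="\<lambda>i r. r" and c=0 and \<gamma>u'="\<lambda>i r. r" and d=0]
    Gam_eq_Gambar[OF assms(1,2), where \<gamma>u="\<lambda>i r. r" and c=0] Gam_eq_Gambar[OF assms(1) t, where \<gamma>u="\<lambda>i r. r" and c=0] by simp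
qed

lemma G_tendsto:
  assumes i: "i < n" and s: "\<And>j. j < n \<Longrightarrow> ((\<lambda>x. s x j) \<longlongrightarrow> t j) F"
    and nn: "\<And>x j. j < n \<Longrightarrow> 0 \<le> s x j" and c: "(c \<longlongrightarrow> d) F" and F: "F \<noteq> bot"
  shows "((\<lambda>x. G (s x) (c x) i) \<longlongrightarrow> G t d i) F"
proof -
  have t: "0 \<le> t j" if "j < n" for j
    using tendsto_lowerbound[OF s[OF that] _ F] nn[OF that] by simp
  have g: "((\<lambda>x. \<gamma> i j (s x j)) \<longlongrightarrow> \<gamma> i j (t j)) F" if "j < n" for j
    using gain_tendsto[OF i that s[OF that] t[OF that]] nn[OF that] by simp
  have "((\<lambda>x. \<Sum>j<n. \<gamma> i j (s x j)) \<longlongrightarrow> (\<Sum>j<n. \<gamma> i j (t j))) F"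
    by (intro tendsto_sum) (use g in auto)
  moreover have "((\<lambda>x. Max ((\<lambda>j. \<gamma> i j (s x j)) ` {..<n})) \<longlongrightarrow> Max ((\<lambda>j. \<gamma> i j (t j)) ` {..<n})) F"
    using n_pos g by (intro tendsto_Max_image) auto
  ultimately show ?thesis unfolding Gambar_def using c
    by (cases "i \<in> Isum") (auto intro: tendsto_add tendsto_max)
qed

end

section \<open>Consequences of the small gain condition\<close>

locale small_gain = gain_operator +
  fixes \<alpha> :: "real \<Rightarrow> real"
  assumes \<alpha>: "classKinf \<alpha>"
    and small_gain: "\<And>s. (\<forall>i<n. 0 \<le> s i) \<and> (\<exists>i<n. s i \<noteq> 0) \<Longrightarrow>
            (\<exists>i<n. Gam n Isum \<gamma> (Dalpha Isum \<alpha> s) i < s i)"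
begin

lemmas \<alpha>_nonneg = classK_nonneg[OF classKinfD[OF \<alpha>]]
lemmas \<alpha>_0 = classK_0[OF classKinfD[OF \<alpha>]]

text \<open>The hypothesis says that \<open>s\<close> lies below the surplus applied to
  \<open>\<Gamma> s\<close>. Applying the monotone \<Gamma> shows that \<open>\<Gamma> s\<close>
  violates the small gain condition unless it vanishes, and then \<open>s\<close> vanishes
  too.\<close>

lemma no_excess:
  assumes nn: "\<And>j. j < n \<Longrightarrow> 0 \<le> s j"
    and le: "\<And>i. i < n \<Longrightarrow> s i \<le> \<Gamma> s i + (if i \<in> Isum then \<alpha> (\<Gamma> s i) else 0)"
    and i: "i < n"
  shows "s i = 0"
proof (rule ccontr)
  assume nz: "s i \<noteq> 0"
  have t: "0 \<le> \<Gamma> s j" if "j < n" for j using Gam_nonneg[OF that nn] .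
  have "\<Gamma> s i \<noteq> 0" using le[OF i] nn[OF i] nz \<alpha>_0 by (auto split: if_splits)
  then have "\<exists>k<n. \<Gamma> (Dalpha Isum \<alpha> (\<Gamma> s)) k < \<Gamma> s k"
    using small_gain[of "\<Gamma> s"] t i by blast
  then obtain k where k: "k < n" "\<Gamma> (Dalpha Isum \<alpha> (\<Gamma> s)) k < \<Gamma> s k" by blast
  have "s j \<le> Dalpha Isum \<alpha> (\<Gamma> s) j" if "j < n" for j
    using le[OF that] by (auto simp: Dalpha_def)
  then have "\<Gamma> s k \<le> \<Gamma> (Dalpha Isum \<alpha> (\<Gamma> s)) k"
    by (intro Gam_mono k(1) nn) auto
  then show False using k(2) by simp
qed

definition below :: "real \<Rightarrow> (nat \<Rightarrow> real) set" where
  "below c = {s. \<forall>i<n. 0 \<le> s i \<and> s i \<le> G s c i}"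

lemma below_mono: "c \<le> d \<Longrightarrow> below c \<subseteq> below d"
proof
  fix s assume cd: "c \<le> d" and "s \<in> below c"
  then have s: "\<And>i. i < n \<Longrightarrow> 0 \<le> s i" "\<And>i. i < n \<Longrightarrow> s i \<le> G s c i" by (auto simp: below_def)
  have "s i \<le> G s d i" if "i < n" for i
    using s(2)[OF that] Gambar_mono[OF that s(1), where t=s and \<gamma>u="\<lambda>i r. r" and c=c and \<gamma>u'="\<lambda>i r. r" and d=d] cd by force
  then show "s \<in> below d" using s(1) by (auto simp: below_def)
qed

text \<open>Along an unbounded sequence in \<open>below c\<close>, cut off the components that stay bounded. The
  surplus \<open>\<alpha>\<close> eventually absorbs their contribution, so the remaining components violate the small
  gain condition.\<close>
lemma below_bounded:
  assumes c: "0 \<le> c"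
  shows "\<exists>R\<ge>0. \<forall>s\<in>below c. \<forall>i<n. s i \<le> R"
proof (rule ccontr)
  assume unb: "\<not> ?thesis"
  \<comment> \<open>\<open>dv J\<close> says that some sequence in \<open>below c\<close> with
    unbounded sum diverges in every component of \<open>J\<close>. For \<open>J\<close> of maximal
    size the other components are eventually bounded, as otherwise a subsequence would enlarge
    \<open>J\<close>.\<close>
  define dv where "dv J \<longleftrightarrow> (\<exists>s::nat \<Rightarrow> nat \<Rightarrow> real. (\<forall>k. s k \<in> below c) \<and>
      filterlim (\<lambda>k. \<Sum>i<n. s k i) at_top sequentially \<and>
      (\<forall>j\<in>J. filterlim (\<lambda>k. s k j) at_top sequentially))" for J
  have "\<exists>s\<in>below c. real k \<le> (\<Sum>i<n. s i)" for k
  proof -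
    have "\<not> (\<forall>s\<in>below c. \<forall>i<n. s i \<le> real k)" using unb by (metis of_nat_0_le_iff)
    then obtain s i where s: "s \<in> below c" "i < n" "real k < s i" by (auto simp: not_le)
    have "s i \<le> (\<Sum>i<n. s i)" using s by (intro member_le_sum) (auto simp: below_def)
    then show ?thesis using s by (intro bexI[of _ s]) auto
  qed
  then obtain s where s: "\<And>k. s k \<in> below c" "\<And>k. real k \<le> (\<Sum>i<n. s k i)" by metis
  have "dv {}" unfolding dv_def
    using s by (intro exI[of _ s]) (auto intro: filterlim_at_top_mono[OF filterlim_real_sequentially])
  have "finite {J. J \<subseteq> {..<n} \<and> dv J}" by (rule finite_subset[of _ "Pow {..<n}"]) auto
  then obtain J where J: "J \<subseteq> {..<n}" "dv J" and maxJ: "\<And>K. K \<subseteq> {..<n} \<Longrightarrow> dv K \<Longrightarrow> card K \<le> card J"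
    using \<open>dv {}\<close> finite_imageI Max_in[of "card ` {J. J \<subseteq> {..<n} \<and> dv J}"]
      Max_ge[of "card ` {J. J \<subseteq> {..<n} \<and> dv J}"]
    by (smt (verit, ccfv_threshold) empty_iff empty_subsetI image_iff mem_Collect_eq)
  from J(2) obtain s where s: "\<And>k. s k \<in> below c"
    and sum_inf: "filterlim (\<lambda>k. \<Sum>i<n. s k i) at_top sequentially"
    and J_inf: "\<And>j. j \<in> J \<Longrightarrow> filterlim (\<lambda>k. s k j) at_top sequentially"
    unfolding dv_def by blast
  have snn: "0 \<le> s k j" if "j < n" for k j using s[of k] that by (auto simp: below_def)
  \<comment> \<open>One number serves as threshold for \<open>k\<close> and as bound. Its failure
    for all \<open>R\<close> yields indices \<open>p R \<ge> R\<close>, which tend to infinity as a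
    subsequence should.\<close>
  have "\<exists>R. \<forall>k\<ge>R. s k i \<le> real R" if i: "i < n" "i \<notin> J" for i
  proof (rule ccontr)
    assume "\<not> ?thesis"
    then have "\<forall>R. \<exists>k\<ge>R. real R < s k i" by (auto simp: not_le)
    then obtain p where p: "\<And>R. R \<le> p R" "\<And>R. real R < s (p R) i" by metis
    have plim: "filterlim p at_top sequentially"
      using p(1) by (intro filterlim_at_top_mono[OF filterlim_ident]) auto
    have "filterlim (\<lambda>k. s (p k) i) at_top sequentially"
      by (intro filterlim_at_top_mono[OF filterlim_real_sequentially] always_eventually allI less_imp_le p(2))
    then have "dv (insert i J)" unfolding dv_def
      using s filterlim_compose[OF sum_inf plim] filterlim_compose[OF J_inf plim]
      by (intro exI[of _ "\<lambda>k. s (p k)"]) auto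
    moreover have "insert i J \<subseteq> {..<n}" "card (insert i J) = Suc (card J)"
      using i J(1) finite_subset[OF J(1)] by auto
    ultimately show False using maxJ[of "insert i J"] by simp
  qed
  then obtain R where R: "\<And>i k. i < n \<Longrightarrow> i \<notin> J \<Longrightarrow> R i \<le> k \<Longrightarrow> s k i \<le> real (R i)" by metis
  define b where "b = (\<Sum>i<n. real (R i))"
  have b: "0 \<le> b" "real (R i) \<le> b" if "i < n" for i
    unfolding b_def using that by (auto intro: sum_nonneg member_le_sum)
  have b0: "0 \<le> b" unfolding b_def by (auto intro: sum_nonneg)
  have ev_b: "eventually (\<lambda>k. \<forall>i\<in>{..<n}-J. s k i \<le> b) sequentially"
  proof (rule eventually_ball_finite)
    show "\<forall>i\<in>{..<n} - J. \<forall>\<^sub>F k in sequentially. s k i \<le> b"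
    proof
      fix i assume i: "i \<in> {..<n} - J"
      show "\<forall>\<^sub>F k in sequentially. s k i \<le> b"
        using eventually_ge_at_top[of "R i"]
      proof eventually_elim
        case (elim k)
        then show ?case using R[of i k] b(2)[of i] i by auto
      qed
    qed
  qed auto
  have "J \<noteq> {}"
  proof
    assume "J = {}"
    have "eventually (\<lambda>k. (\<Sum>i<n. s k i) \<le> real n * b) sequentially"
      using ev_b
    proof eventually_elim
      case (elim k)
      then show ?case using sum_bounded_above[of "{..<n}" "s k" b] \<open>J = {}\<close> by simp
    qed
    moreover have "eventually (\<lambda>k. real n * b < (\<Sum>i<n. s k i)) sequentially"
      using sum_inf by (simp add: filterlim_at_top_dense)
    ultimately have "eventually (\<lambda>k. False) sequentially" by eventually_elim simp
    then show False by simp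
  qed
  \<comment> \<open>Bounds what row \<open>i\<close> can receive from outside \<open>J\<close>
    together with \<open>c\<close>.\<close>
  define \<beta> where "\<beta> i = (\<Sum>j\<in>{..<n}-J. \<gamma> i j b) + c" for i
  have "\<exists>y\<ge>0. \<forall>x\<ge>y. \<beta> i < \<alpha> x" for i using classKinf_exceeds[OF \<alpha>, of "\<beta> i"] by (metis less_imp_le)
  then obtain y where y: "\<And>i. 0 \<le> y i" "\<And>i x. y i \<le> x \<Longrightarrow> \<beta> i < \<alpha> x" by metis
  have "eventually (\<lambda>k. \<forall>i\<in>J. \<beta> i + y i < s k i) sequentially"
    using J_inf finite_subset[OF J(1)] by (intro eventually_ball_finite) (auto simp: filterlim_at_top_dense)
  with ev_b have "eventually (\<lambda>k. (\<forall>i\<in>{..<n}-J. s k i \<le> b) \<and> (\<forall>i\<in>J. \<beta> i + y i < s k i)) sequentially"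
    by (rule eventually_conj)
  then obtain k where kb: "\<And>i. i < n \<Longrightarrow> i \<notin> J \<Longrightarrow> s k i \<le> b"
    and kJ: "\<And>i. i \<in> J \<Longrightarrow> \<beta> i + y i < s k i"
    unfolding eventually_sequentially by auto
  define s' where "s' j = (if j \<in> J then s k j else 0)" for j
  have s'nn: "0 \<le> s' j" if "j < n" for j using snn[OF that] by (auto simp: s'_def)
  have gb: "0 \<le> \<gamma> i j b" if "i < n" "j < n" for i j using gain_nonneg[OF that b0] .
  have \<beta>0: "0 \<le> \<beta> i" "c \<le> \<beta> i" if "i < n" for i
    unfolding \<beta>_def using c gb that by (auto intro!: add_nonneg_nonneg sum_nonneg)
  have gj: "\<gamma> i j (s k j) \<le> \<gamma> i j b" if "i < n" "j < n" "j \<notin> J" for i j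
    using gain_mono[OF that(1,2) snn[OF that(2)] kb[OF that(2,3)]] .
  have "s' i \<le> \<Gamma> s' i + (if i \<in> Isum then \<alpha> (\<Gamma> s' i) else 0)" if i: "i < n" for i
  proof (cases "i \<in> J")
    case False
    have "0 \<le> \<Gamma> s' i" by (rule Gam_nonneg[OF i s'nn])
    then show ?thesis using False \<alpha>_nonneg[of "\<Gamma> s' i"] by (auto simp: s'_def)
  next
    case iJ: True
    have sG: "s k i \<le> G (s k) c i" using s[of k] i by (auto simp: below_def)
    show ?thesis
    proof (cases "i \<in> Isum")
      case True
      let ?X = "\<Sum>j\<in>J. \<gamma> i j (s k j)"
      have X: "\<Gamma> s' i = ?X"
      proof -
        have "(\<Sum>j<n. \<gamma> i j (s' j)) = (\<Sum>j\<in>J. \<gamma> i j (s' j))"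
          using J(1) gain_0[OF i] by (intro sum.mono_neutral_right) (auto simp: s'_def)
        also have "\<dots> = ?X" by (intro sum.cong) (auto simp: s'_def)
        finally show ?thesis using True by (simp add: Gam_def)
      qed
      have "s k i \<le> (\<Sum>j<n. \<gamma> i j (s k j)) + c" using sG True by (simp add: Gambar_def)
      also have "(\<Sum>j<n. \<gamma> i j (s k j)) = (\<Sum>j\<in>{..<n}-J. \<gamma> i j (s k j)) + ?X"
        using J(1) by (intro sum.subset_diff) auto
      also have "(\<Sum>j\<in>{..<n}-J. \<gamma> i j (s k j)) \<le> (\<Sum>j\<in>{..<n}-J. \<gamma> i j b)"
        using gj[OF i] by (intro sum_mono) auto
      finally have le: "s k i \<le> ?X + \<beta> i" by (simp add: \<beta>_def)
      \<comment> \<open>\<open>s k i\<close> exceeds \<open>\<beta> i + y i\<close>, so the retained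
        part \<open>?X\<close> is beyond \<open>y i\<close>, where the surplus
        \<open>\<alpha> ?X\<close> outweighs the discarded part.\<close>
      then have "y i \<le> ?X" using kJ[OF iJ] by simp
      then have "\<beta> i < \<alpha> ?X" by (rule y(2))
      then show ?thesis using le True X iJ by (simp add: s'_def)
    next
      case False
      \<comment> \<open>In a maximum row \<open>s k i\<close> exceeds \<open>c\<close> and every
        gain coming from outside \<open>J\<close>, so the maximum is attained inside
        \<open>J\<close> and survives the cut.\<close>
      have "s k i \<le> max (Max ((\<lambda>j. \<gamma> i j (s k j)) ` {..<n})) c" using sG False by (simp add: Gambar_def)
      moreover have "c < s k i" using kJ[OF iJ] \<beta>0[OF i] y(1)[of i] by simp
      ultimately have "s k i \<le> Max ((\<lambda>j. \<gamma> i j (s k j)) ` {..<n})" by auto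
      moreover have "Max ((\<lambda>j. \<gamma> i j (s k j)) ` {..<n}) \<in> (\<lambda>j. \<gamma> i j (s k j)) ` {..<n}"
        using n_pos by (intro Max_in) auto
      ultimately obtain j where j: "j < n" "s k i \<le> \<gamma> i j (s k j)" by auto
      have "j \<in> J"
      proof (rule ccontr)
        assume "j \<notin> J"
        then have "\<gamma> i j b \<le> (\<Sum>j\<in>{..<n}-J. \<gamma> i j b)" using j gb[OF i] by (intro member_le_sum) auto
        then have "\<gamma> i j (s k j) \<le> \<beta> i" using gj[OF i j(1) \<open>j \<notin> J\<close>] c by (simp add: \<beta>_def)
        then show False using j(2) kJ[OF iJ] y(1)[of i] by simp
      qed
      then have "\<gamma> i j (s k j) = \<gamma> i j (s' j)" by (simp add: s'_def)
      also have "\<dots> \<le> Max ((\<lambda>j. \<gamma> i j (s' j)) ` {..<n})" using j by (intro Max_ge) auto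
      finally show ?thesis using j(2) False iJ by (simp add: s'_def Gam_def)
    qed
  qed
  from no_excess[OF s'nn this] have z: "s' i = 0" if "i < n" for i using that by blast
  obtain i where i: "i \<in> J" using \<open>J \<noteq> {}\<close> by auto
  then have "i < n" using J(1) by auto
  then show False using z[of i] kJ[OF i] \<beta>0[of i] y(1)[of i] i by (simp add: s'_def)
qed

lemma below_0:
  assumes "s \<in> below 0" "i < n" shows "s i = 0"
proof -
  have s: "\<And>i. i < n \<Longrightarrow> 0 \<le> s i" "\<And>i. i < n \<Longrightarrow> s i \<le> G s 0 i" using assms by (auto simp: below_def)
  show ?thesis
  proof (rule no_excess[OF s(1) _ assms(2)])
    fix i assume i: "i < n"
    show "s i \<le> \<Gamma> s i + (if i \<in> Isum then \<alpha> (\<Gamma> s i) else 0)"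
    proof -
      have "\<Gamma> s i = G s 0 i" by (rule Gam_eq_Gambar[OF i]) (use s(1) in auto)
      moreover have "0 \<le> \<Gamma> s i" by (rule Gam_nonneg[OF i s(1)])
      ultimately show ?thesis using s(2)[OF i] \<alpha>_nonneg[of "\<Gamma> s i"] by simp
    qed
  qed
qed

text \<open>Compactness: for \<open>c \<le> 1\<close> all points of \<open>below c\<close> lie in
  one box, and a limit point for \<open>c\<close> tending to \<open>0\<close> belongs to
  \<open>below 0\<close>, whose elements vanish by \<open>below_0\<close>.\<close>

lemma below_small:
  assumes a: "0 < a"
  shows "\<exists>c>0. \<forall>s\<in>below c. (\<Sum>i<n. s i) < a"
proof (rule ccontr)
  assume "\<not> ?thesis"
  then have "\<exists>s\<in>below c. a \<le> (\<Sum>i<n. s i)" if "0 < c" for c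
    using that by (auto simp: not_less dest!: spec[of _ c])
  then have "\<exists>s\<in>below (inverse (real (Suc k))). a \<le> (\<Sum>i<n. s i)" for k by simp
  then obtain s where s: "\<And>k. s k \<in> below (inverse (real (Suc k)))" "\<And>k. a \<le> (\<Sum>i<n. s k i)" by metis
  obtain R where R: "\<And>t i. t \<in> below 1 \<Longrightarrow> i < n \<Longrightarrow> t i \<le> R" using below_bounded[of 1] by auto
  have s1: "s k \<in> below 1" for k
    using s(1)[of k] below_mono[of "inverse (real (Suc k))" 1] by (auto simp: field_simps)
  have nn: "0 \<le> s k i" if "i < n" for i k using s1[of k] that by (auto simp: below_def)
  have nb: "norm (s k i) \<le> R" if "i \<in> {..<n}" for k i using R[OF s1, of i k] nn[of i k] that by auto
  have "\<exists>p::nat\<Rightarrow>nat. strict_mono p \<and> (\<forall>i\<in>{..<n}. \<exists>l. (\<lambda>k. s (p k) i) \<longlonglongrightarrow> l)"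
    by (rule function_convergent_subsequence[of "{..<n}" s R, OF countable_finite[OF finite_lessThan]])
      (use nb in blast)+
  then obtain p where p: "strict_mono (p::nat\<Rightarrow>nat)" "\<And>i. i < n \<Longrightarrow> \<exists>l. (\<lambda>k. s (p k) i) \<longlonglongrightarrow> l" by blast
  from p(2) obtain l where l: "\<And>i. i < n \<Longrightarrow> (\<lambda>k. s (p k) i) \<longlonglongrightarrow> l i" by metis
  have "l i \<le> G l 0 i" if i: "i < n" for i
  proof (rule LIMSEQ_le[OF l[OF i]])
    have "(\<lambda>k. inverse (real (Suc (p k)))) \<longlonglongrightarrow> 0"
      using LIMSEQ_subseq_LIMSEQ[OF LIMSEQ_inverse_real_of_nat p(1)] by (simp add: o_def)
    then show "(\<lambda>k. G (s (p k)) (inverse (real (Suc (p k)))) i) \<longlonglongrightarrow> G l 0 i"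
      using l nn i by (intro G_tendsto) auto
    show "\<exists>N. \<forall>k\<ge>N. s (p k) i \<le> G (s (p k)) (inverse (real (Suc (p k)))) i"
      using s(1) i by (auto simp: below_def)
  qed
  moreover have "0 \<le> l i" if i: "i < n" for i using LIMSEQ_le_const[OF l[OF i]] nn[OF i] by blast
  ultimately have "l \<in> below 0" by (simp add: below_def)
  then have "(\<Sum>i<n. l i) = 0" using below_0[of l] by (intro sum.neutral) auto
  moreover have "a \<le> (\<Sum>i<n. l i)"
  proof (rule LIMSEQ_le_const)
    show "(\<lambda>k. \<Sum>i<n. s (p k) i) \<longlonglongrightarrow> (\<Sum>i<n. l i)" by (intro tendsto_sum) (use l in auto)
  qed (use s(2) in auto)
  ultimately show False using a by simp
qed

text \<open>\<open>classKinf_below\<close> is applied to the constants \<open>c\<close> for which no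
  element of \<open>below c\<close> has component sum \<open>r\<close>. By
  \<open>below_small\<close> a small \<open>c\<close> works for all \<open>r \<ge> a\<close>, and by
  \<open>below_bounded\<close> any given \<open>c\<close> works for all large
  \<open>r\<close>.\<close>

lemma ex_margin:
  obtains \<kappa> where "classKinf \<kappa>"
    "\<And>s. s \<in> below (\<kappa> (\<Sum>i<n. s i)) \<Longrightarrow> (\<Sum>i<n. s i) = 0"
proof -
  define P where "P r c \<longleftrightarrow> (\<forall>s\<in>below c. (\<Sum>i<n. s i) \<noteq> r)" for r c
  have "\<exists>\<kappa>. classKinf \<kappa> \<and> (\<forall>r>0. P r (\<kappa> r))"
  proof (rule classKinf_below[of P])
    show "P r d" if "P r c" "d \<le> c" for r c d using below_mono[OF that(2)] that(1) by (auto simp: P_def)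
    show "\<exists>c>0. \<forall>r\<ge>a. P r c" if a: "0 < a" for a
    proof -
      obtain c where "c > 0" "\<forall>s\<in>below c. (\<Sum>i<n. s i) < a" using below_small[OF a] by blast
      then show ?thesis unfolding P_def by (intro exI[of _ c]) auto
    qed
    show "\<exists>a. \<forall>r\<ge>a. P r c" for c
    proof -
      obtain R where R: "\<And>t i. t \<in> below (max c 0) \<Longrightarrow> i < n \<Longrightarrow> t i \<le> R"
        using below_bounded[of "max c 0"] by auto
      have "(\<Sum>i<n. s i) \<le> real n * R" if "s \<in> below c" for s
        using sum_bounded_above[of "{..<n}" s R] R[of s] below_mono[of c "max c 0"] that by auto
      then show ?thesis unfolding P_def by (intro exI[of _ "real n * R + 1"]) force
    qed
  qed blast
  then obtain \<kappa> where \<kappa>: "classKinf \<kappa>" "\<And>r. 0 < r \<Longrightarrow> P r (\<kappa> r)" by blast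
  show ?thesis
  proof (rule that[OF \<kappa>(1)])
    fix s assume s: "s \<in> below (\<kappa> (\<Sum>i<n. s i))"
    have "0 \<le> (\<Sum>i<n. s i)" using s by (intro sum_nonneg) (auto simp: below_def)
    then show "(\<Sum>i<n. s i) = 0"
      using \<kappa>(2)[of "\<Sum>i<n. s i"] s by (cases "(\<Sum>i<n. s i) = 0") (auto simp: P_def)
  qed
qed

text \<open>Averaging \<open>A\<close> with the identity keeps \<open>A s \<le> s\<close> invariant, and at most halves every
  component, so that orbits coming down from ever larger starting points have a limit that is
  indexed by all integers.\<close>
lemma ex_chain:
  assumes \<kappa>: "classKinf \<kappa>" and margin: "\<And>s. s \<in> below (\<kappa> (\<Sum>i<n. s i)) \<Longrightarrow> (\<Sum>i<n. s i) = 0"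
  obtains z :: "int \<Rightarrow> nat \<Rightarrow> real" where
    "\<And>k i. i < n \<Longrightarrow> 0 < z k i" "\<And>k i. i < n \<Longrightarrow> z k i < z (k + 1) i"
    "\<And>k i. i < n \<Longrightarrow> G (z (k + 1)) (\<kappa> (\<Sum>j<n. z (k + 1) j)) i < z k i"
    "\<And>i. i < n \<Longrightarrow> filterlim (\<lambda>k. z (int k) i) at_top sequentially"
    "\<And>i. i < n \<Longrightarrow> (\<lambda>k. z (- int k) i) \<longlonglongrightarrow> 0"
proof -
  note \<kappa>K = classKinfD[OF \<kappa>]
  define A where "A s = G s (\<kappa> (\<Sum>j<n. s j))" for s
  define M where "M s i = (A s i + s i) / 2" for s :: "nat \<Rightarrow> real" and i :: nat
  define nn where "nn s \<longleftrightarrow> (\<forall>i<n. 0 \<le> s i)" for s :: "nat \<Rightarrow> real"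
  have sum0: "0 \<le> (\<Sum>j<n. s j)" if "nn s" for s using that by (intro sum_nonneg) (auto simp: nn_def)
  have A_mono: "A s i \<le> A t i" if "nn s" "\<And>j. j < n \<Longrightarrow> s j \<le> t j" "i < n" for s t i
  proof -
    have "(\<Sum>j<n. s j) \<le> (\<Sum>j<n. t j)" using that(2) by (intro sum_mono) auto
    then have "\<kappa> (\<Sum>j<n. s j) \<le> \<kappa> (\<Sum>j<n. t j)" by (rule classK_mono[OF \<kappa>K sum0[OF that(1)]])
    then show ?thesis unfolding A_def using that by (intro Gambar_mono) (auto simp: nn_def)
  qed
  have A_ge: "\<kappa> (\<Sum>j<n. s j) \<le> A s i" if "nn s" "i < n" for s i
    unfolding A_def using that by (intro G_ge) (auto simp: nn_def)
  have A_nn: "nn (A s)" if "nn s" for s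
    unfolding nn_def
  proof (intro allI impI)
    fix i assume "i < n"
    then show "0 \<le> A s i" using A_ge[OF that, of i] classK_nonneg[OF \<kappa>K sum0[OF that]] by linarith
  qed
  have A_lim: "(\<lambda>x. A (s x) i) \<longlonglongrightarrow> A t i"
    if i: "i < n" and l: "\<And>j. j < n \<Longrightarrow> (\<lambda>x. s x j) \<longlonglongrightarrow> t j" and s: "\<And>x. nn (s x)" for s t i
  proof -
    have sl: "(\<lambda>x. \<Sum>j<n. s x j) \<longlonglongrightarrow> (\<Sum>j<n. t j)" by (intro tendsto_sum) (use l in auto)
    have "0 \<le> (\<Sum>j<n. t j)" using LIMSEQ_le_const[OF sl] sum0[OF s] by blast
    then have "(\<lambda>x. \<kappa> (\<Sum>j<n. s x j)) \<longlonglongrightarrow> \<kappa> (\<Sum>j<n. t j)"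
      using classK_tendsto[OF \<kappa>K sl] sum0[OF s] by simp
    then show ?thesis unfolding A_def using i l s by (intro G_tendsto) (auto simp: nn_def)
  qed
  have margin': "s i = 0" if s: "nn s" "\<And>i. i < n \<Longrightarrow> s i \<le> A s i" and i: "i < n" for s i
  proof -
    have "s \<in> below (\<kappa> (\<Sum>i<n. s i))" using s by (auto simp: below_def A_def nn_def)
    then have "(\<Sum>i<n. s i) = 0" by (rule margin)
    then show ?thesis using s(1) i sum_nonneg_eq_0_iff[of "{..<n}" s] by (auto simp: nn_def)
  qed
  have M_nn: "nn (M s)" if "nn s" for s using A_nn[OF that] that by (simp add: M_def nn_def)
  have M_inv: "M s i \<le> s i" "A (M s) i \<le> M s i" "s i \<le> 2 * M s i" "A s i \<le> M s i"
    if s: "nn s" "\<And>i. i < n \<Longrightarrow> A s i \<le> s i" and i: "i < n" for s i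
  proof -
    have le: "M s j \<le> s j" if "j < n" for j using s(2)[OF that] by (simp add: M_def)
    show "M s i \<le> s i" using le[OF i] .
    have "A (M s) i \<le> A s i" using le by (intro A_mono M_nn s i) auto
    moreover show "A s i \<le> M s i" using s(2)[OF i] by (simp add: M_def)
    ultimately show "A (M s) i \<le> M s i" by simp
    show "s i \<le> 2 * M s i" using A_nn[OF s(1)] i by (simp add: M_def nn_def)
  qed
  \<comment> \<open>Iteration upwards from \<open>0\<close>, with the extra gain held at
    \<open>N\<close> or more, is increasing. If \<open>\<kappa>\<close> of the sum ever exceeded
    \<open>N\<close>, the margin would force that sum to be \<open>0\<close>; so the iterates stay
    in the bounded set \<open>below N\<close>, and their limit is a fixed point above
    \<open>N\<close>.\<close>
  have start: "\<exists>b. nn b \<and> (\<forall>i<n. N \<le> b i \<and> A b i \<le> b i)" if N: "0 \<le> N" for N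
  proof -
    define t where "t k = ((\<lambda>s. G s (max N (\<kappa> (\<Sum>j<n. s j)))) ^^ k) (\<lambda>_. 0)" for k
    have tS: "t (Suc k) i = G (t k) (max N (\<kappa> (\<Sum>j<n. t k j))) i" for k i by (simp add: t_def)
    have tn: "nn (t k)" for k
    proof (induction k)
      case 0 show ?case by (simp add: t_def nn_def)
    next
      case (Suc k)
      show ?case unfolding nn_def
      proof (intro allI impI)
        fix i assume i: "i < n"
        have "max N (\<kappa> (\<Sum>j<n. t k j)) \<le> t (Suc k) i"
          unfolding tS using Suc i by (intro G_ge) (auto simp: nn_def)
        then show "0 \<le> t (Suc k) i" using N by linarith
      qed
    qed
    have inc: "t k i \<le> t (Suc k) i" if "i < n" for k i
      using that
    proof (induction k arbitrary: i)
      case 0 then show ?case using tn[of 1] by (simp add: t_def nn_def)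
    next
      case (Suc k)
      have "(\<Sum>j<n. t k j) \<le> (\<Sum>j<n. t (Suc k) j)" using Suc.IH by (intro sum_mono) auto
      then have "\<kappa> (\<Sum>j<n. t k j) \<le> \<kappa> (\<Sum>j<n. t (Suc k) j)" by (rule classK_mono[OF \<kappa>K sum0[OF tn]])
      then show ?case unfolding tS[of "Suc k"] tS[of k]
        using Suc tn[of k] by (intro Gambar_mono) (auto simp: nn_def tS[symmetric])
    qed
    obtain R where R: "\<And>t i. t \<in> below N \<Longrightarrow> i < n \<Longrightarrow> t i \<le> R" using below_bounded[OF N] by auto
    have bel: "t k \<in> below N" for k
    proof -
      have bk: "t k \<in> below (max N (\<kappa> (\<Sum>j<n. t k j)))"
        using inc[of _ k] tn[of k] by (auto simp: below_def tS nn_def)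
      have "\<kappa> (\<Sum>j<n. t k j) \<le> N"
      proof (rule ccontr)
        assume a: "\<not> \<kappa> (\<Sum>j<n. t k j) \<le> N"
        then have "t k \<in> below (\<kappa> (\<Sum>j<n. t k j))" using bk by (simp add: max_def)
        then have "(\<Sum>j<n. t k j) = 0" by (rule margin)
        then show False using a N classK_0[OF \<kappa>K] by simp
      qed
      then show ?thesis using bk by (simp add: max_absorb1)
    qed
    have "\<exists>l. (\<lambda>k. t k i) \<longlonglongrightarrow> l" if i: "i < n" for i
    proof -
      have "incseq (\<lambda>k. t k i)" using inc[OF i] by (rule incseq_SucI)
      then show ?thesis using incseq_convergent[of "\<lambda>k. t k i" R] R[OF bel i] by blast
    qed
    then obtain l where l: "\<And>i. i < n \<Longrightarrow> (\<lambda>k. t k i) \<longlonglongrightarrow> l i" by metis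
    have ln: "nn l" unfolding nn_def using LIMSEQ_le_const[OF l] tn by (meson nn_def)
    have eq: "l i = G l (max N (\<kappa> (\<Sum>j<n. l j))) i" if i: "i < n" for i
    proof (rule LIMSEQ_unique)
      show "(\<lambda>k. t (Suc k) i) \<longlonglongrightarrow> l i" using l[OF i] by (rule LIMSEQ_Suc)
      have sl: "(\<lambda>k. \<Sum>j<n. t k j) \<longlonglongrightarrow> (\<Sum>j<n. l j)" by (intro tendsto_sum) (use l in auto)
      have "(\<lambda>k. \<kappa> (\<Sum>j<n. t k j)) \<longlonglongrightarrow> \<kappa> (\<Sum>j<n. l j)"
        using classK_tendsto[OF \<kappa>K sl sum0[OF ln]] sum0[OF tn] by simp
      then have "(\<lambda>k. max N (\<kappa> (\<Sum>j<n. t k j))) \<longlonglongrightarrow> max N (\<kappa> (\<Sum>j<n. l j))"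
        by (intro tendsto_max tendsto_const)
      then show "(\<lambda>k. t (Suc k) i) \<longlonglongrightarrow> G l (max N (\<kappa> (\<Sum>j<n. l j))) i"
        unfolding tS using i l tn by (intro G_tendsto) (auto simp: nn_def)
    qed
    have "N \<le> l i \<and> A l i \<le> l i" if i: "i < n" for i
    proof
      have "max N (\<kappa> (\<Sum>j<n. l j)) \<le> l i"
        by (subst eq[OF i], rule G_ge) (use i ln in \<open>auto simp: nn_def\<close>)
      then show "N \<le> l i" by simp
      show "A l i \<le> l i"
      proof -
        have "G l (\<kappa> (\<Sum>j<n. l j)) i \<le> G l (max N (\<kappa> (\<Sum>j<n. l j))) i"
          by (rule Gambar_mono) (use i ln in \<open>auto simp: nn_def\<close>)
        then show ?thesis using eq[OF i] by (simp add: A_def)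
      qed
    qed
    then show ?thesis using ln by blast
  qed
  define b where "b N = (SOME b. nn b \<and> (\<forall>i<n. real N \<le> b i \<and> A b i \<le> b i))" for N :: nat
  have b: "nn (b N)" "\<And>i. i < n \<Longrightarrow> real N \<le> b N i" "\<And>i. i < n \<Longrightarrow> A (b N) i \<le> b N i" for N
    using someI_ex[OF start[of "real N"]] unfolding b_def[symmetric] by auto
  define y where "y N j = (M ^^ j) (b N)" for N j
  have yS: "y N (Suc j) = M (y N j)" for N j by (simp add: y_def)
  have y_inv: "nn (y N j) \<and> (\<forall>i<n. A (y N j) i \<le> y N j i)" for N j
  proof (induction j)
    case 0 then show ?case using b by (simp add: y_def)
  next
    case (Suc j) then show ?case unfolding yS using M_nn M_inv(2) by blast
  qed
  then have yn: "nn (y N j)" and yA: "i < n \<Longrightarrow> A (y N j) i \<le> y N j i" for N j i by blast+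
  have y_dec: "y N (Suc j) i \<le> y N j i" "y N j i \<le> 2 * y N (Suc j) i" if "i < n" for N j i
    unfolding yS using M_inv(1,3)[OF yn yA that] by auto
  have fix0: "l i = 0" if l: "\<And>i. i < n \<Longrightarrow> l i = M l i" "nn l" and i: "i < n" for l i
  proof (rule margin'[OF l(2) _ i])
    fix j assume "j < n"
    then show "l j \<le> A l j" using l(1)[of j] by (simp add: M_def field_simps)
  qed
  have M_lim: "(\<lambda>x. M (s x) i) \<longlonglongrightarrow> M t i"
    if "i < n" "\<And>j. j < n \<Longrightarrow> (\<lambda>x. s x j) \<longlonglongrightarrow> t j" "\<And>x. nn (s x)" for s t i
    unfolding M_def using that by (intro tendsto_intros A_lim) auto
  \<comment> \<open>Each orbit decreases; its limit is a fixed point of \<open>M\<close>, hence of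
    \<open>A\<close>, and the margin leaves only \<open>0\<close>.\<close>
  have y0: "(\<lambda>j. y N j i) \<longlonglongrightarrow> 0" if i: "i < n" for N i
  proof -
    have "\<exists>l. (\<lambda>j. y N j i) \<longlonglongrightarrow> l" if i: "i < n" for i
    proof -
      have "decseq (\<lambda>j. y N j i)" using y_dec(1)[OF i] by (rule decseq_SucI)
      then show ?thesis using decseq_convergent[of "\<lambda>j. y N j i" 0] yn i by (metis nn_def)
    qed
    then obtain l where l: "\<And>i. i < n \<Longrightarrow> (\<lambda>j. y N j i) \<longlonglongrightarrow> l i" by metis
    have ln: "nn l" unfolding nn_def using LIMSEQ_le_const[OF l] yn by (meson nn_def)
    have "l i = M l i" if i: "i < n" for i
      using LIMSEQ_unique[OF LIMSEQ_Suc[OF l[OF i]]] M_lim[OF i l yn] by (simp add: yS)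
    then have "l i = 0" using fix0[OF _ ln i] by blast
    then show ?thesis using l[OF i] by simp
  qed
  define S where "S N j = (\<Sum>i<n. y N j i)" for N j
  have S0: "(\<lambda>j. S N j) \<longlonglongrightarrow> 0" for N
    unfolding S_def using tendsto_sum[of "{..<n}" "\<lambda>i j. y N j i" "\<lambda>_. 0" sequentially] y0 by simp
  have S_dec: "S N (Suc j) \<le> S N j" "S N j \<le> 2 * S N (Suc j)" for N j
    unfolding S_def sum_distrib_left using y_dec by (auto intro!: sum_mono)
  \<comment> \<open>The orbits are aligned at the first step where the component sum is at most
    \<open>1\<close>. This normalisation keeps the limit from collapsing to \<open>0\<close> or
    escaping to infinity.\<close>
  define p where "p N = (LEAST j. S N j \<le> 1)" for N
  have p1: "S N (p N) \<le> 1" for N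
  proof -
    have "eventually (\<lambda>j. S N j < 1) sequentially" using S0[of N] by (rule order_tendstoD) simp
    then have "\<exists>j. S N j \<le> 1" unfolding eventually_sequentially by (meson less_imp_le order_refl)
    then show ?thesis unfolding p_def by (rule LeastI_ex)
  qed
  have p2: "1 < S N j" if "j < p N" for N j using not_less_Least[of j "\<lambda>j. S N j \<le> 1"] that by (auto simp: p_def)
  have SN: "real N \<le> S N 0" for N
  proof -
    have "real N \<le> b N 0" using b(2)[OF n_pos] .
    also have "\<dots> \<le> (\<Sum>i<n. b N i)" using n_pos b(1)[of N] by (intro member_le_sum) (auto simp: nn_def)
    finally show ?thesis by (simp add: S_def y_def)
  qed
  have S_anti: "S N j \<le> S N k" if "k \<le> j" for N j k
    using decseq_SucI[of "S N", OF S_dec(1)] that by (auto simp: decseq_def)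
  have S_pow: "S N (p N - k) \<le> 2 ^ k" if "k \<le> p N" for N k
    using that
  proof (induction k)
    case 0 then show ?case using p1 by simp
  next
    case (Suc k)
    have "S N (p N - Suc k) \<le> 2 * S N (p N - k)"
      using S_dec(2)[of N "p N - Suc k"] Suc.prems by (simp add: Suc_diff_Suc)
    also have "\<dots> \<le> 2 * 2 ^ k" using Suc by simp
    finally show ?case by simp
  qed
  \<comment> \<open>An orbit starts with sum at least \<open>N\<close> and at most halves it per
    step, so it needs more and more steps to come down to \<open>1\<close>. Every fixed index of the
    limit chain is therefore eventually reached.\<close>
  have p_large: "eventually (\<lambda>N. k \<le> p N) sequentially" for k
    using eventually_gt_at_top[of "2 ^ k"]
  proof eventually_elim
    case (elim N)
    show ?case
    proof (rule ccontr)
      assume "\<not> k \<le> p N"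
      then have "(2::real) ^ p N \<le> 2 ^ k" by simp
      moreover have "real N \<le> 2 ^ p N"
        by (rule order_trans[OF SN[of N]]) (use S_pow[of "p N" N] in simp)
      ultimately have "real N \<le> 2 ^ k" by (rule order_trans[rotated])
      then show False using elim by simp
    qed
  qed
  \<comment> \<open>Time is reversed and shifted: index \<open>0\<close> is step \<open>p N\<close>,
    larger indices are earlier steps. The default \<open>0\<close> beyond the start of the orbit
    disappears at each fixed index for large \<open>N\<close>.\<close>
  define w where "w N k = (if k \<le> int (p N) then y N (nat (int (p N) - k)) else (\<lambda>_. 0))" for N and k :: int
  have wn: "nn (w N k)" for N k using yn by (auto simp: w_def nn_def)
  have w_sum: "(\<Sum>i<n. w N k i) \<le> 2 ^ nat k" for N k
  proof (cases "k \<le> int (p N)")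
    case True
    have "S N (nat (int (p N) - k)) \<le> S N (p N - nat k)" using True by (intro S_anti) auto
    also have "\<dots> \<le> 2 ^ nat k" using True by (intro S_pow) auto
    finally show ?thesis using True by (simp add: w_def S_def)
  qed (simp add: w_def)
  have w_le: "w N k i \<le> 2 ^ nat k" if "i < n" for N k i
    using member_le_sum[of i "{..<n}" "w N k"] wn[of N k] that w_sum[where N=N and k=k]
    by (auto simp: nn_def intro: order_trans)
  \<comment> \<open>Dividing by \<open>2 ^ nat k\<close> makes the bound uniform over all indices,
    as the diagonal choice of a subsequence requires.\<close>
  have nb: "norm ((\<lambda>(k,i). w N k i / 2 ^ nat k) x) \<le> 1" if x: "x \<in> UNIV \<times> {..<n}" for N x
  proof -
    obtain k i where "x = (k, i)" "i < n" using x by auto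
    then show ?thesis using w_le[of i N k] wn[of N k] by (auto simp: nn_def field_simps)
  qed
  have cnt: "countable (UNIV \<times> {..<n} :: (int \<times> nat) set)" by simp
  have "\<exists>q::nat\<Rightarrow>nat. strict_mono q \<and>
      (\<forall>x\<in>UNIV \<times> {..<n}. \<exists>l. (\<lambda>N. (\<lambda>(k,i). w (q N) k i / 2 ^ nat k) x) \<longlonglongrightarrow> l)"
    by (rule function_convergent_subsequence[of "UNIV \<times> {..<n}" "\<lambda>N (k,i). w N k i / 2 ^ nat k" 1, OF cnt])
      (use nb in blast)+
  then obtain q where q: "strict_mono (q::nat\<Rightarrow>nat)"
    and ql: "\<And>x. x \<in> UNIV \<times> {..<n} \<Longrightarrow> \<exists>l. (\<lambda>N. (\<lambda>(k,i). w (q N) k i / 2 ^ nat k) x) \<longlonglongrightarrow> l" by blast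
  have "\<exists>l. (\<lambda>N. w (q N) k i) \<longlonglongrightarrow> l" if "i < n" for k i
  proof -
    obtain l where "(\<lambda>N. w (q N) k i / 2 ^ nat k) \<longlonglongrightarrow> l" using ql[of "(k,i)"] \<open>i < n\<close> by auto
    then have "(\<lambda>N. w (q N) k i / 2 ^ nat k * 2 ^ nat k) \<longlonglongrightarrow> l * 2 ^ nat k" by (intro tendsto_intros)
    then show ?thesis by auto
  qed
  then have cv: "convergent (\<lambda>N. w (q N) k i)" if "i < n" for k i using that by (simp add: convergent_def)
  define z where "z k i = lim (\<lambda>N. w (q N) k i)" for k i
  have z: "(\<lambda>N. w (q N) k i) \<longlonglongrightarrow> z k i" if "i < n" for k i
    using cv[OF that, of k] by (simp add: z_def convergent_LIMSEQ_iff)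
  have q_top: "filterlim q at_top sequentially" using q by (rule filterlim_subseq)
  have zn: "nn (z k)" for k unfolding nn_def using LIMSEQ_le_const[OF z] wn by (meson nn_def)
  have ev: "eventually (\<lambda>N. k \<le> int (p (q N))) sequentially" for k
    using filterlim_iff[THEN iffD1, OF q_top, rule_format, OF p_large[of "nat k"]]
    by eventually_elim auto
  have zM: "z k i = M (z (k + 1)) i" if i: "i < n" for k i
  proof (rule LIMSEQ_unique[OF z[OF i]])
    have "(\<lambda>N. M (w (q N) (k + 1)) i) \<longlonglongrightarrow> M (z (k + 1)) i" by (rule M_lim[OF i z wn])
    moreover have "eventually (\<lambda>N. M (w (q N) (k + 1)) i = w (q N) k i) sequentially"
      using ev[of "k + 1"]
    proof eventually_elim
      case (elim N)
      have "nat (int (p (q N)) - k) = Suc (nat (int (p (q N)) - (k + 1)))" using elim by linarith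
      then show ?case using elim by (simp add: w_def yS)
    qed
    ultimately show "(\<lambda>N. w (q N) k i) \<longlonglongrightarrow> M (z (k + 1)) i" by (rule Lim_transform_eventually)
  qed
  have zA: "A (z k) i \<le> z k i" if i: "i < n" for k i
  proof (rule tendsto_le[OF _ z[OF i] A_lim[OF i z wn]])
    show "eventually (\<lambda>N. A (w (q N) k) i \<le> w (q N) k i) sequentially"
      using ev[of k] by eventually_elim (use yA[OF i] in \<open>simp add: w_def\<close>)
  qed simp_all
  \<comment> \<open>The step before \<open>p N\<close> has sum above \<open>1\<close> and one step
    at most halves it, so the limit chain is not zero.\<close>
  have half: "1/2 \<le> (\<Sum>i<n. z 0 i)"
  proof (rule tendsto_lowerbound)
    show "(\<lambda>N. \<Sum>i<n. w (q N) 0 i) \<longlonglongrightarrow> (\<Sum>i<n. z 0 i)" by (intro tendsto_sum) (use z in auto)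
    show "eventually (\<lambda>N. 1/2 \<le> (\<Sum>i<n. w (q N) 0 i)) sequentially"
      using ev[of 1]
    proof eventually_elim
      case (elim N)
      have "1 < S (q N) (p (q N) - 1)" using elim by (intro p2) auto
      also have "\<dots> \<le> 2 * S (q N) (p (q N))" using S_dec(2)[of "q N" "p (q N) - 1"] elim by simp
      finally show ?case by (simp add: w_def S_def)
    qed
  qed simp
  have z_le: "z k i \<le> z (k + 1) i" "z (k + 1) i \<le> 2 * z k i" if i: "i < n" for k i
  proof -
    have "M (z (k + 1)) i \<le> z (k + 1) i" "z (k + 1) i \<le> 2 * M (z (k + 1)) i"
      using M_inv(1,3)[OF zn[of "k + 1"] zA i] by auto
    then show "z k i \<le> z (k + 1) i" "z (k + 1) i \<le> 2 * z k i" using zM[OF i, of k] by auto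
  qed
  define Z where "Z k = (\<Sum>i<n. z k i)" for k
  have Z_le: "Z k \<le> Z (k + 1)" "Z (k + 1) \<le> 2 * Z k" for k
    unfolding Z_def sum_distrib_left using z_le by (auto intro!: sum_mono)
  have Z_up: "1/2 \<le> Z (int k)" for k
  proof (induction k)
    case 0 then show ?case using half by (simp add: Z_def)
  next
    case (Suc k) then show ?case using Z_le(1)[of "int k"] by (simp add: add.commute)
  qed
  have Z_down: "0 < Z (- int k)" for k
  proof (induction k)
    case 0 then show ?case using half by (simp add: Z_def)
  next
    case (Suc k) then show ?case using Z_le(2)[of "- int (Suc k)"] by simp
  qed
  have Z_pos: "0 < Z k" for k
    using Z_up[of "nat k"] Z_down[of "nat (- k)"] by (cases "0 \<le> k") auto
  have z_\<kappa>: "\<kappa> (Z k) \<le> z k i" if "i < n" for k i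
    using A_ge[OF zn that, of k] zA[OF that, of k] by (simp add: Z_def)
  have z_pos: "0 < z k i" if "i < n" for k i
    using z_\<kappa>[OF that, of k] classK_pos[OF \<kappa>K Z_pos[of k]] by linarith
  have inc: "incseq (\<lambda>k. z (int k) i)" if "i < n" for i
  proof (rule incseq_SucI)
    show "z (int k) i \<le> z (int (Suc k)) i" for k using z_le(1)[OF that, of "int k"] by (simp add: add.commute)
  qed
  \<comment> \<open>A bounded chain would increase to a fixed point of \<open>M\<close>, that is to
    \<open>0\<close>, although its sums stay above \<open>1/2\<close>.\<close>
  have Z_unb: "\<exists>k. B < Z (int k)" for B
  proof (rule ccontr)
    assume "\<not> ?thesis"
    then have Zb: "Z (int k) \<le> B" for k by (auto simp: not_less)
    have "\<exists>l. (\<lambda>k. z (int k) i) \<longlonglongrightarrow> l" if i: "i < n" for i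
    proof -
      have "z (int k) i \<le> B" for k
        using member_le_sum[of i "{..<n}" "z (int k)"] zn[of "int k"] i Zb[of k] by (auto simp: nn_def Z_def)
      then show ?thesis using incseq_convergent[OF inc[OF i], of B] by blast
    qed
    then obtain l where l: "\<And>i. i < n \<Longrightarrow> (\<lambda>k. z (int k) i) \<longlonglongrightarrow> l i" by metis
    have ln: "nn l" unfolding nn_def using LIMSEQ_le_const[OF l] zn by (meson nn_def)
    have "l i = M l i" if i: "i < n" for i
    proof (rule LIMSEQ_unique[OF l[OF i]])
      have "(\<lambda>k. z (int (Suc k)) j) \<longlonglongrightarrow> l j" if "j < n" for j using LIMSEQ_Suc[OF l[OF that]] .
      then have "(\<lambda>k. M (z (int (Suc k))) i) \<longlonglongrightarrow> M l i" using zn by (intro M_lim i) auto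
      moreover have "z (int k) i = M (z (int (Suc k))) i" for k
        using zM[OF i, of "int k"] by (simp add: add.commute)
      ultimately show "(\<lambda>k. z (int k) i) \<longlonglongrightarrow> M l i" by simp
    qed
    then have "l i = 0" if "i < n" for i using fix0[OF _ ln that] by blast
    moreover have "(\<lambda>k. Z (int k)) \<longlonglongrightarrow> (\<Sum>i<n. l i)" unfolding Z_def by (intro tendsto_sum) (use l in auto)
    ultimately have "(\<lambda>k. Z (int k)) \<longlonglongrightarrow> 0" by simp
    then show False using LIMSEQ_le_const[of "\<lambda>k. Z (int k)" 0 "1/2"] Z_up by auto
  qed
  have up: "filterlim (\<lambda>k. z (int k) i) at_top sequentially" if i: "i < n" for i
    unfolding filterlim_at_top
  proof
    fix B
    obtain R where R: "0 < R" "\<And>x. R \<le> x \<Longrightarrow> B < \<kappa> x" using classKinf_exceeds[OF \<kappa>] by blast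
    obtain k where "R < Z (int k)" using Z_unb by blast
    then have "B \<le> z (int k) i" using R(2)[of "Z (int k)"] z_\<kappa>[OF i, of "int k"] by simp
    then show "eventually (\<lambda>k. B \<le> z (int k) i) sequentially"
      using inc[OF i] unfolding eventually_sequentially incseq_def by (meson order_trans)
  qed
  have down: "(\<lambda>k. z (- int k) i) \<longlonglongrightarrow> 0" if i: "i < n" for i
  proof -
    have "\<exists>l. (\<lambda>k. z (- int k) i) \<longlonglongrightarrow> l" if i: "i < n" for i
    proof -
      have "z (- int (Suc k)) i \<le> z (- int k) i" for k using z_le(1)[OF i, of "- int (Suc k)"] by simp
      then have "decseq (\<lambda>k. z (- int k) i)" by (rule decseq_SucI)
      then show ?thesis using decseq_convergent[of "\<lambda>k. z (- int k) i" 0] zn i by (metis nn_def)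
    qed
    then obtain l where l: "\<And>i. i < n \<Longrightarrow> (\<lambda>k. z (- int k) i) \<longlonglongrightarrow> l i" by metis
    have ln: "nn l" unfolding nn_def using LIMSEQ_le_const[OF l] zn by (meson nn_def)
    have "l i = M l i" if i: "i < n" for i
    proof (rule LIMSEQ_unique[OF LIMSEQ_Suc[OF l[OF i]]])
      have "(\<lambda>k. M (z (- int k)) i) \<longlonglongrightarrow> M l i" using zn by (intro M_lim i l) auto
      moreover have "z (- int (Suc k)) i = M (z (- int k)) i" for k using zM[OF i, of "- int (Suc k)"] by simp
      ultimately show "(\<lambda>k. z (- int (Suc k)) i) \<longlonglongrightarrow> M l i" by (simp only:)
    qed
    then have "l i = 0" using fix0[OF _ ln i] by blast
    then show ?thesis using l[OF i] by simp
  qed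
  have strict: "A (z k) i < z k i" if i: "i < n" for k i
  proof (rule ccontr)
    assume "\<not> A (z k) i < z k i"
    then have eq0: "A (z k) i = z k i" using zA[OF i, of k] by simp
    \<comment> \<open>Equality in row \<open>i\<close> at one index propagates to all larger indices
      and freezes that component, which contradicts its divergence.\<close>
    have step: "A (z (l + 1)) i = z (l + 1) i \<and> z (l + 1) i = z l i" if "A (z l) i = z l i" for l
    proof -
      have "A (z l) i \<le> A (z (l + 1)) i" using z_le(1) by (intro A_mono zn i) auto
      then show ?thesis using zA[OF i, of "l + 1"] zM[OF i, of l] that by (simp add: M_def)
    qed
    have const: "A (z (k + int m)) i = z (k + int m) i \<and> z (k + int m) i = z k i" for m
    proof (induction m)
      case 0 then show ?case using eq0 by simp
    next
      case (Suc m) then show ?case using step[of "k + int m"] by (simp add: ac_simps)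
    qed
    have "eventually (\<lambda>m. z k i < z (int m) i) sequentially" using up[OF i] by (simp add: filterlim_at_top_dense)
    then obtain N where N: "\<And>m. N \<le> m \<Longrightarrow> z k i < z (int m) i" unfolding eventually_sequentially by blast
    define m where "m = max N (nat k)"
    have "nat k \<le> m" by (simp add: m_def)
    then have "k + int (nat (int m - k)) = int m" by linarith
    then have "z (int m) i = z k i" using const[of "nat (int m - k)"] by simp
    then show False using N[of m] by (simp add: m_def)
  qed
  show ?thesis
  proof (rule that[of z])
    show "z k i < z (k + 1) i" "G (z (k + 1)) (\<kappa> (\<Sum>j<n. z (k + 1) j)) i < z k i" if i: "i < n" for k i
      using strict[OF i, of "k + 1"] zM[OF i, of k] by (simp_all add: M_def A_def)
  qed (use z_pos up down in auto)
qed

end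

section \<open>Interpolated paths\<close>

text \<open>Bounds on increments instead of derivatives: they pass to the inverse function with
  inverted constants, they remain usable at corners of the path, and for the inverse they imply both
  regularity conditions of an \<Omega>-path.\<close>

definition loc_bilip :: "(real \<Rightarrow> real) \<Rightarrow> bool" where
  "loc_bilip g \<longleftrightarrow> (\<forall>a b. 0 < a \<longrightarrow> a \<le> b \<longrightarrow> (\<exists>m M. 0 < m \<and> 0 < M \<and>
     (\<forall>x y. a \<le> x \<longrightarrow> x \<le> y \<longrightarrow> y \<le> b \<longrightarrow> m * (y - x) \<le> g y - g x \<and> g y - g x \<le> M * (y - x))))"

lemma loc_bilipE:
  assumes "loc_bilip g" "0 < a" "a \<le> b"
  obtains m M where "0 < m" "0 < M"
    "\<And>x y. a \<le> x \<Longrightarrow> x \<le> y \<Longrightarrow> y \<le> b \<Longrightarrow> m * (y - x) \<le> g y - g x \<and> g y - g x \<le> M * (y - x)"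
  using assms(1)[unfolded loc_bilip_def, rule_format, OF assms(2,3)] that by blast

lemma loc_bilip_sinv:
  assumes g: "classKinf g" "loc_bilip g"
  shows "loc_bilip (sinv g)"
  unfolding loc_bilip_def
proof (intro allI impI)
  fix a b :: real assume ab: "0 < a" "a \<le> b"
  note K = classKinfD[OF classKinf_sinv[OF g(1)]]
  have "0 < sinv g a" "sinv g a \<le> sinv g b" using classK_pos[OF K ab(1)] classK_mono[OF K _ ab(2)] ab by auto
  from loc_bilipE[OF g(2) this] obtain m M where m: "0 < m" "0 < M"
    "\<And>x y. sinv g a \<le> x \<Longrightarrow> x \<le> y \<Longrightarrow> y \<le> sinv g b \<Longrightarrow> m * (y - x) \<le> g y - g x \<and> g y - g x \<le> M * (y - x)"
    by blast
  have F: "inverse M * (y - x) \<le> sinv g y - sinv g x \<and> sinv g y - sinv g x \<le> inverse m * (y - x)"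
    if "a \<le> x" "x \<le> y" "y \<le> b" for x y
  proof -
    have "m * (sinv g y - sinv g x) \<le> g (sinv g y) - g (sinv g x) \<and> g (sinv g y) - g (sinv g x) \<le> M * (sinv g y - sinv g x)"
      using that ab by (intro m(3)) (auto simp: classK_le_iff[OF K])
    then have "m * (sinv g y - sinv g x) \<le> y - x" "y - x \<le> M * (sinv g y - sinv g x)"
      using that ab by (auto simp: apply_sinv[OF g(1)])
    then show ?thesis using m(1,2) by (auto simp: divide_inverse[symmetric] field_simps)
  qed
  show "\<exists>m M. 0 < m \<and> 0 < M \<and> (\<forall>x y. a \<le> x \<longrightarrow> x \<le> y \<longrightarrow> y \<le> b \<longrightarrow>
      m * (y - x) \<le> sinv g y - sinv g x \<and> sinv g y - sinv g x \<le> M * (y - x))"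
    by (rule exI[of _ "inverse M"], rule exI[of _ "inverse m"]) (use m(1,2) F in auto)
qed

lemma loc_bilip_imp_loc_lipschitz_on:
  assumes "loc_bilip g" shows "loc_lipschitz_on {0<..} g"
  unfolding loc_lipschitz_on_def
proof
  fix x :: real assume x: "x \<in> {0<..}"
  have "0 < x/2" "x/2 \<le> 2 * x" using x by auto
  from loc_bilipE[OF assms this] obtain m M where m: "0 < m" "0 < M"
    "\<And>u v. x/2 \<le> u \<Longrightarrow> u \<le> v \<Longrightarrow> v \<le> 2*x \<Longrightarrow> m * (v - u) \<le> g v - g u \<and> g v - g u \<le> M * (v - u)"
    by blast
  have "M-lipschitz_on (cball x (x/2) \<inter> {0<..}) g"
  proof (rule lipschitz_onI)
    fix u v assume uv: "u \<in> cball x (x/2) \<inter> {0<..}" "v \<in> cball x (x/2) \<inter> {0<..}"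
    then have b: "x/2 \<le> u" "u \<le> 2*x" "x/2 \<le> v" "v \<le> 2*x"
      unfolding Int_iff mem_cball dist_real_def by linarith+
    have nn: "0 \<le> m * \<bar>v - u\<bar>" using m(1) by simp
    show "dist (g u) (g v) \<le> M * dist u v"
    proof (cases "u \<le> v")
      case True
      then show ?thesis using m(3)[of u v] b nn by (auto simp: dist_real_def)
    next
      case False
      then show ?thesis using m(3)[of v u] b nn by (auto simp: dist_real_def)
    qed
  qed (use m in simp)
  then show "\<exists>r>0. \<exists>L. L-lipschitz_on (cball x r \<inter> {0<..}) g" using x by (intro exI[of _ "x/2"]) auto
qed

lemma loc_bilip_deriv_bounds:
  assumes "finite A" "\<And>i. i \<in> A \<Longrightarrow> loc_bilip (g i)" "compact P" "P \<subseteq> {0<..}"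
  shows "\<exists>c C. 0 < c \<and> c \<le> C \<and>
    (\<forall>i\<in>A. \<forall>r\<in>P. \<forall>d. (g i has_real_derivative d) (at r) \<longrightarrow> c \<le> d \<and> d \<le> C)"
  using assms(1,2)
proof (induction A rule: finite_induct)
  case empty then show ?case by (intro exI[of _ 1]) auto
next
  case (insert i A)
  then obtain c C where IH: "0 < c" "c \<le> C"
    "\<And>j r d. j \<in> A \<Longrightarrow> r \<in> P \<Longrightarrow> (g j has_real_derivative d) (at r) \<Longrightarrow> c \<le> d \<and> d \<le> C" by auto
  have "\<exists>a b. 0 < a \<and> a \<le> b \<and> P \<subseteq> {a..b}"
  proof (cases "P = {}")
    case False
    then obtain p q where "p \<in> P" "q \<in> P" "\<And>x. x \<in> P \<Longrightarrow> p \<le> x \<and> x \<le> q"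
      using compact_attains_inf[OF assms(3)] compact_attains_sup[OF assms(3)] by metis
    then have "0 < p \<and> p \<le> q \<and> P \<subseteq> {p..q}" using assms(4) by auto
    then show ?thesis by blast
  qed (auto intro: exI[of _ 1])
  then obtain a b where ab: "0 < a" "a \<le> b" "P \<subseteq> {a..b}" by blast
  \<comment> \<open>The interval is enlarged so that right difference quotients at all points of
    \<open>P\<close> stay inside it.\<close>
  then have ab': "0 < a/2" "a/2 \<le> b + 1" by auto
  have "loc_bilip (g i)" using insert.prems by simp
  from loc_bilipE[OF this ab'] obtain m M where m: "0 < m" "0 < M"
    "\<And>u v. a/2 \<le> u \<Longrightarrow> u \<le> v \<Longrightarrow> v \<le> b + 1 \<Longrightarrow> m * (v - u) \<le> g i v - g i u \<and> g i v - g i u \<le> M * (v - u)"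
    by blast
  have *: "m \<le> d \<and> d \<le> M" if r: "r \<in> P" and d: "(g i has_real_derivative d) (at r)" for r d
  proof -
    have r': "a \<le> r" "r \<le> b" using r ab by auto
    have lim: "((\<lambda>h. (g i (r + h) - g i r) / h) \<longlongrightarrow> d) (at_right 0)"
      using d unfolding DERIV_def by (rule tendsto_mono[rotated]) (simp add: at_le)
    have ev: "eventually (\<lambda>h. m \<le> (g i (r + h) - g i r) / h \<and> (g i (r + h) - g i r) / h \<le> M) (at_right 0)"
      unfolding eventually_at_right_field
    proof (intro exI[of _ 1] conjI allI impI)
      fix h :: real assume h: "0 < h" "h < 1"
      have "m * h \<le> g i (r + h) - g i r \<and> g i (r + h) - g i r \<le> M * h"
        using m(3)[of r "r + h"] r' h ab by auto
      then show "m \<le> (g i (r + h) - g i r) / h" "(g i (r + h) - g i r) / h \<le> M"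
        using h by (auto simp: field_simps)
    qed simp
    show ?thesis
    proof
      show "m \<le> d" by (rule tendsto_lowerbound[OF lim eventually_mono[OF ev]]) auto
      show "d \<le> M" by (rule tendsto_upperbound[OF lim eventually_mono[OF ev]]) auto
    qed
  qed
  show ?case
  proof (rule exI[of _ "min c m"], rule exI[of _ "max C M"], intro conjI ballI allI impI)
    fix j r d assume j: "j \<in> insert i A" and r: "r \<in> P" and d: "(g j has_real_derivative d) (at r)"
    show "min c m \<le> d" "d \<le> max C M"
      using j *[OF r] IH(3)[OF _ r d] d by (auto simp: min_le_iff_disj le_max_iff_disj)
  qed (use IH m in auto)
qed

section \<open>Interpolation of two-sided sequences\<close>

definition lin_interp :: "(int \<Rightarrow> real) \<Rightarrow> real \<Rightarrow> real" where
  "lin_interp a x = a \<lfloor>x\<rfloor> + (x - \<lfloor>x\<rfloor>) * (a (\<lfloor>x\<rfloor> + 1) - a \<lfloor>x\<rfloor>)"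

lemma lin_interp_eq:
  assumes "of_int k \<le> x" "x \<le> of_int k + 1"
  shows "lin_interp a x = a k + (x - of_int k) * (a (k + 1) - a k)"
proof (cases "x = of_int k + 1")
  case True
  then have "\<lfloor>x\<rfloor> = k + 1" by linarith
  then show ?thesis using True by (simp add: lin_interp_def)
next
  case False
  then have "\<lfloor>x\<rfloor> = k" using assms by (intro floor_unique) auto
  then show ?thesis by (simp add: lin_interp_def)
qed

text \<open>Slope bounds on single cells extend to intervals by splitting an increment at the nodes,
  one new cell per induction step.\<close>

lemma lin_interp_slope:
  assumes "p \<le> q" and slope: "\<And>k. p \<le> k \<Longrightarrow> k < q \<Longrightarrow> m \<le> a (k + 1) - a k \<and> a (k + 1) - a k \<le> M"
    and "of_int p \<le> x" "x \<le> y" "y \<le> of_int q"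
  shows "m * (y - x) \<le> lin_interp a y - lin_interp a x \<and> lin_interp a y - lin_interp a x \<le> M * (y - x)"
  using assms
proof (induction q arbitrary: x y rule: int_ge_induct)
  case base then have "x = y" by simp
  then show ?case by simp
next
  case (step q)
  have IH: "m * (y - x) \<le> lin_interp a y - lin_interp a x \<and> lin_interp a y - lin_interp a x \<le> M * (y - x)"
    if "of_int p \<le> x" "x \<le> y" "y \<le> of_int q" for x y
    using step.IH[OF _ that] step.prems(1) by auto
  have new: "m * (y - x) \<le> lin_interp a y - lin_interp a x \<and> lin_interp a y - lin_interp a x \<le> M * (y - x)"
    if "of_int q \<le> x" "x \<le> y" "y \<le> of_int q + 1" for x y
  proof -
    have e: "lin_interp a y - lin_interp a x = (a (q + 1) - a q) * (y - x)"
      using that by (simp add: lin_interp_eq[of q] algebra_simps)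
    show ?thesis unfolding e using step.prems(1)[of q] step.hyps that by (auto intro!: mult_right_mono)
  qed
  consider "y \<le> of_int q" | "of_int q \<le> x" | "x < of_int q" "of_int q < y" by linarith
  then show ?case
  proof cases
    case 1 then show ?thesis using IH step.prems by auto
  next
    case 2 then show ?thesis using new step.prems by auto
  next
    case 3
    then have "m * (of_int q - x) \<le> lin_interp a (of_int q) - lin_interp a x \<and> lin_interp a (of_int q) - lin_interp a x \<le> M * (of_int q - x)"
      using IH[of x "of_int q"] step.prems by auto
    moreover have "m * (y - of_int q) \<le> lin_interp a y - lin_interp a (of_int q) \<and> lin_interp a y - lin_interp a (of_int q) \<le> M * (y - of_int q)"
      using new[of "of_int q" y] step.prems 3 by auto
    ultimately show ?thesis by (auto simp: algebra_simps)
  qed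
qed

lemma log2_bilip:
  assumes "0 < a" "a \<le> x" "x \<le> y" "y \<le> b"
  shows "(y - x) / (b * ln 2) \<le> log 2 y - log 2 x" "log 2 y - log 2 x \<le> (y - x) / (a * ln 2)"
proof -
  have e: "log 2 y - log 2 x = ln (y / x) / ln 2" using assms by (simp add: log_def ln_div diff_divide_distrib)
  have "ln (y / x) \<le> y / x - 1" using assms by (intro ln_le_minus_one) auto
  also have "\<dots> = (y - x) / x" using assms by (simp add: field_simps)
  also have "\<dots> \<le> (y - x) / a" using assms by (intro divide_left_mono) auto
  finally show "log 2 y - log 2 x \<le> (y - x) / (a * ln 2)"
    unfolding e using divide_right_mono[of "ln (y/x)" "(y - x) / a" "ln 2"] by simp
  have "ln (x / y) \<le> x / y - 1" using assms by (intro ln_le_minus_one) auto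
  moreover have "ln (x / y) = - ln (y / x)" using assms by (simp add: ln_div)
  ultimately have "(y - x) / y \<le> ln (y / x)" using assms by (simp add: field_simps)
  moreover have "(y - x) / b \<le> (y - x) / y" using assms by (intro divide_left_mono) auto
  ultimately show "(y - x) / (b * ln 2) \<le> log 2 y - log 2 x"
    unfolding e using divide_right_mono[of "(y - x) / b" "ln (y/x)" "ln 2"] by simp
qed

text \<open>Node \<open>k\<close> sits at \<open>2 powr k\<close>, so that a sequence indexed by all
  integers covers the open half-line and its two ends correspond to \<open>0\<close> and infinity.
  Between nodes the function is linear in \<open>log 2 r\<close>, not in \<open>r\<close>; on
  compact intervals the logarithm changes increments only by bounded factors.\<close>

definition dyadic_interp :: "(int \<Rightarrow> real) \<Rightarrow> real \<Rightarrow> real" where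
  "dyadic_interp a r = (if 0 < r then lin_interp a (log 2 r) else 0)"

lemma loc_bilip_dyadic_interp:
  assumes inc: "\<And>k. a k < a (k + 1)"
  shows "loc_bilip (dyadic_interp a)"
  unfolding loc_bilip_def
proof (intro allI impI)
  fix u v :: real assume uv: "0 < u" "u \<le> v"
  define p q where "p = \<lfloor>log 2 u\<rfloor>" and "q = \<lfloor>log 2 v\<rfloor> + 1"
  have "log 2 u \<le> log 2 v" using uv by simp
  then have pq: "p < q" unfolding p_def q_def by linarith
  \<comment> \<open>Only finitely many cells meet \<open>{u..v}\<close>, so extreme slopes exist;
    the logarithm contributes the factors \<open>1 / (v * ln 2)\<close> and
    \<open>1 / (u * ln 2)\<close>.\<close>
  define m M where "m = Min ((\<lambda>k. a (k + 1) - a k) ` {p..<q})" and "M = Max ((\<lambda>k. a (k + 1) - a k) ` {p..<q})"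
  have fin: "finite ((\<lambda>k. a (k + 1) - a k) ` {p..<q})" "(\<lambda>k. a (k + 1) - a k) ` {p..<q} \<noteq> {}" using pq by auto
  have sl: "m \<le> a (k + 1) - a k \<and> a (k + 1) - a k \<le> M" if "p \<le> k" "k < q" for k
    unfolding m_def M_def using that by (auto intro!: Min_le Max_ge)
  have m: "0 < m" unfolding m_def using fin inc by (subst Min_gr_iff) auto
  have M: "0 < M" using m sl[of p] pq by force
  have F: "m / (v * ln 2) * (y - x) \<le> dyadic_interp a y - dyadic_interp a x \<and>
      dyadic_interp a y - dyadic_interp a x \<le> M / (u * ln 2) * (y - x)" if xy: "u \<le> x" "x \<le> y" "y \<le> v" for x y
  proof -
    have pos: "0 < x" "0 < y" using xy uv by auto
    have l: "of_int p \<le> log 2 x" "log 2 x \<le> log 2 y" "log 2 y \<le> of_int q"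
    proof -
      have "log 2 u \<le> log 2 x" "log 2 y \<le> log 2 v" using xy uv by auto
      then show "of_int p \<le> log 2 x" "log 2 y \<le> of_int q" unfolding p_def q_def by linarith+
    qed (use xy pos in auto)
    have 1: "m * (log 2 y - log 2 x) \<le> dyadic_interp a y - dyadic_interp a x"
      "dyadic_interp a y - dyadic_interp a x \<le> M * (log 2 y - log 2 x)"
      using lin_interp_slope[of p q m a M "log 2 x" "log 2 y"] sl l pq pos by (auto simp: dyadic_interp_def)
    have "m * ((y - x) / (v * ln 2)) \<le> m * (log 2 y - log 2 x)" "M * (log 2 y - log 2 x) \<le> M * ((y - x) / (u * ln 2))"
      using mult_left_mono[OF log2_bilip(1)[OF uv(1) xy], of m]
        mult_left_mono[OF log2_bilip(2)[OF uv(1) xy], of M] m M by auto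
    then show ?thesis using 1 by auto
  qed
  show "\<exists>m M. 0 < m \<and> 0 < M \<and> (\<forall>x y. u \<le> x \<longrightarrow> x \<le> y \<longrightarrow> y \<le> v \<longrightarrow>
      m * (y - x) \<le> dyadic_interp a y - dyadic_interp a x \<and> dyadic_interp a y - dyadic_interp a x \<le> M * (y - x))"
    by (rule exI[of _ "m / (v * ln 2)"], rule exI[of _ "M / (u * ln 2)"]) (use m M uv F in auto)
qed

lemma dyadic_interp_between:
  assumes inc: "\<And>k. a k < a (k + 1)" and r: "0 < r" and k: "k = \<lfloor>log 2 r\<rfloor>"
  shows "a k \<le> dyadic_interp a r" "dyadic_interp a r \<le> a (k + 1)"
proof -
  define t where "t = log 2 r - of_int k"
  have t: "0 \<le> t" "t \<le> 1" unfolding t_def k by linarith+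
  have e: "dyadic_interp a r = a k + t * (a (k + 1) - a k)"
    using r by (simp add: dyadic_interp_def lin_interp_def k t_def)
  have d: "0 \<le> a (k + 1) - a k" using inc[of k] by simp
  show "a k \<le> dyadic_interp a r" unfolding e using t d by simp
  have "t * (a (k + 1) - a k) \<le> 1 * (a (k + 1) - a k)" using t d by (intro mult_right_mono) auto
  then show "dyadic_interp a r \<le> a (k + 1)" unfolding e by simp
qed

text \<open>Continuity at \<open>0\<close> and unboundedness are read off at the nodes from the two
  ends of the sequence; continuity and strict growth on the open half-line come from the
  bi-Lipschitz bounds.\<close>

lemma classKinf_dyadic_interp:
  assumes pos: "\<And>k. 0 < a k" and inc: "\<And>k. a k < a (k + 1)"
    and up: "filterlim (\<lambda>k. a (int k)) at_top sequentially" and down: "(\<lambda>k. a (- int k)) \<longlonglongrightarrow> 0"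
  shows "classKinf (dyadic_interp a)"
proof -
  let ?g = "dyadic_interp a"
  have g0: "?g 0 = 0" by (simp add: dyadic_interp_def)
  have gpos: "0 < ?g x" if "0 < x" for x
    using dyadic_interp_between(1)[of a, OF inc that refl] pos[of "\<lfloor>log 2 x\<rfloor>"] by linarith
  have bl: "loc_bilip ?g" using inc by (rule loc_bilip_dyadic_interp)
  have strict: "?g x < ?g y" if "0 \<le> x" "x < y" for x y
  proof (cases "x = 0")
    case True then show ?thesis using gpos[of y] that g0 by simp
  next
    case False
    then have "0 < x" "x \<le> y" using \<open>0 \<le> x\<close> \<open>x < y\<close> by auto
    then have "\<exists>m M. 0 < m \<and> 0 < M \<and> (\<forall>u v. x \<le> u \<longrightarrow> u \<le> v \<longrightarrow> v \<le> y \<longrightarrow>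
        m * (v - u) \<le> ?g v - ?g u \<and> ?g v - ?g u \<le> M * (v - u))"
      using bl unfolding loc_bilip_def by blast
    then obtain m where "0 < m" "m * (y - x) \<le> ?g y - ?g x" using \<open>x < y\<close> by (meson less_imp_le order_refl)
    moreover have "0 < m * (y - x)" using \<open>0 < m\<close> \<open>x < y\<close> by simp
    ultimately show ?thesis by linarith
  qed
  have at_pow: "?g (2 powr of_int k) = a k" for k
  proof -
    have "lin_interp a (of_int k) = a k" by (subst lin_interp_eq[of k]) auto
    then show ?thesis by (simp add: dyadic_interp_def)
  qed
  have "continuous (at x within {0..}) ?g" if x: "0 \<le> x" for x
  proof (cases "x = 0")
    case True
    show ?thesis unfolding continuous_within_eps_delta
    proof (intro allI impI)
      fix e :: real assume e: "0 < e"
      have "eventually (\<lambda>k. a (- int k) < e) sequentially" using down e by (rule order_tendstoD)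
      then obtain k where k: "a (- int k) < e" unfolding eventually_sequentially by blast
      show "\<exists>d>0. \<forall>y\<in>{0..}. dist y x < d \<longrightarrow> dist (?g y) (?g x) < e"
      proof (intro exI[of _ "2 powr of_int (- int k)"] conjI ballI impI)
        fix y :: real assume y: "y \<in> {0..}" "dist y x < 2 powr of_int (- int k)"
        then have "0 \<le> y" "y < 2 powr of_int (- int k)" using True by (auto simp: dist_real_def)
        then have "0 \<le> ?g y" "?g y < a (- int k)"
          using gpos[of y] strict[of y "2 powr of_int (- int k)"] at_pow[of "- int k"] g0 by (cases "y = 0"; force)+
        then show "dist (?g y) (?g x) < e" using k True g0 by (simp add: dist_real_def)
      qed simp
    qed
  next
    case False
    then have "x \<in> {0<..}" using x by simp
    moreover from loc_bilip_imp_loc_lipschitz_on[OF bl] this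
    obtain r L where r: "r > 0" "L-lipschitz_on (cball x r \<inter> {0<..}) ?g" unfolding loc_lipschitz_on_def by blast
    ultimately have "continuous_on (ball x r \<inter> {0<..}) ?g"
      using lipschitz_on_continuous_on[OF r(2)] by (auto intro: continuous_on_subset)
    then have "isCont ?g x" using \<open>x \<in> {0<..}\<close> r(1) by (subst (asm) continuous_on_eq_continuous_at) auto
    then show ?thesis by (rule continuous_at_imp_continuous_at_within)
  qed
  then have "continuous_on {0..} ?g" by (simp add: continuous_on_eq_continuous_within)
  then have "classK ?g" using strict g0 by (intro classKI) auto
  then show ?thesis
  proof (rule classKinfI)
    fix M
    have "eventually (\<lambda>k. M \<le> a (int k)) sequentially" using up by (simp add: filterlim_at_top)
    then obtain k where "M \<le> a (int k)" unfolding eventually_sequentially by blast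
    then show "\<exists>x\<ge>0. M \<le> ?g x" using at_pow[of "int k"] by (intro exI[of _ "2 powr of_int (int k)"]) auto
  qed
qed

section \<open>Rademacher's theorem\<close>

text \<open>A Cauchy criterion with countable outer quantifiers and a non-strict inequality: for
  difference quotients of a continuous function it presents the set where the limit exists as a
  countable intersection of countable unions of closed sets.\<close>

lemma ex_lim_at_right_iff:
  fixes \<phi> :: "real \<Rightarrow> real"
  shows "(\<exists>d. (\<phi> \<longlongrightarrow> d) (at_right 0)) \<longleftrightarrow>
    (\<forall>k::nat. \<exists>m::nat. \<forall>s\<in>{0<..<inverse (real (Suc m))}. \<forall>t\<in>{0<..<inverse (real (Suc m))}. \<bar>\<phi> s - \<phi> t\<bar> \<le> inverse (real (Suc k)))"
    (is "?L \<longleftrightarrow> ?R")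
proof
  assume ?L
  then obtain d where d: "(\<phi> \<longlongrightarrow> d) (at_right 0)" by blast
  show ?R
  proof
    fix k
    have "eventually (\<lambda>h. dist (\<phi> h) d < inverse (real (Suc k)) / 2) (at_right 0)"
      using d by (rule tendstoD) simp
    then obtain b where b: "b > 0" "\<And>h. 0 < h \<Longrightarrow> h < b \<Longrightarrow> dist (\<phi> h) d < inverse (real (Suc k)) / 2"
      unfolding eventually_at_right_field by blast
    obtain m where m: "inverse (real (Suc m)) < b" using reals_Archimedean[OF b(1)] by blast
    have "\<bar>\<phi> s - \<phi> t\<bar> \<le> inverse (real (Suc k))" if "0 < s" "s < inverse (real (Suc m))" "0 < t" "t < inverse (real (Suc m))" for s t
    proof -
      have "dist (\<phi> s) d < inverse (real (Suc k)) / 2" "dist (\<phi> t) d < inverse (real (Suc k)) / 2"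
        using that m b(2)[of s] b(2)[of t] by auto
      then show ?thesis unfolding dist_real_def by linarith
    qed
    then show "\<exists>m::nat. \<forall>s\<in>{0<..<inverse (real (Suc m))}. \<forall>t\<in>{0<..<inverse (real (Suc m))}. \<bar>\<phi> s - \<phi> t\<bar> \<le> inverse (real (Suc k))"
      by (intro exI[of _ m]) auto
  qed
next
  assume R: ?R
  define x where "x j = \<phi> (inverse (real (Suc (Suc j))))" for j
  have small: "inverse (real (Suc (Suc j))) \<in> {0<..<inverse (real (Suc m))}" if "m \<le> j" for m j
    using that by (simp add: field_simps)
  have Rk: "\<exists>m::nat. \<forall>s\<in>{0<..<inverse (real (Suc m))}. \<forall>t\<in>{0<..<inverse (real (Suc m))}. \<bar>\<phi> s - \<phi> t\<bar> < e" if "0 < e" for e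
  proof -
    obtain k where k: "inverse (real (Suc k)) < e" using reals_Archimedean[OF \<open>0 < e\<close>] by blast
    obtain m where "\<forall>s\<in>{0<..<inverse (real (Suc m))}. \<forall>t\<in>{0<..<inverse (real (Suc m))}. \<bar>\<phi> s - \<phi> t\<bar> \<le> inverse (real (Suc k))"
      using R by blast
    then show ?thesis using k by (intro exI[of _ m]) force
  qed
  have "Cauchy x"
  proof (rule metric_CauchyI)
    fix e :: real assume "0 < e"
    then obtain m where m: "\<forall>s\<in>{0<..<inverse (real (Suc m))}. \<forall>t\<in>{0<..<inverse (real (Suc m))}. \<bar>\<phi> s - \<phi> t\<bar> < e"
      using Rk by blast
    show "\<exists>M. \<forall>i\<ge>M. \<forall>j\<ge>M. dist (x i) (x j) < e"
      unfolding x_def dist_real_def using m small by (intro exI[of _ m] allI impI) blast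
  qed
  then obtain d where d: "x \<longlonglongrightarrow> d" using Cauchy_convergent_iff convergent_def by blast
  have "(\<phi> \<longlongrightarrow> d) (at_right 0)"
  proof (rule tendstoI)
    fix e :: real assume e: "0 < e"
    then obtain m where m: "\<forall>s\<in>{0<..<inverse (real (Suc m))}. \<forall>t\<in>{0<..<inverse (real (Suc m))}. \<bar>\<phi> s - \<phi> t\<bar> < e/2"
      using Rk[of "e/2"] by auto
    have "eventually (\<lambda>j. dist (x j) d < e/2) sequentially" using d by (rule tendstoD) (use e in simp)
    then obtain J where J: "\<And>j. J \<le> j \<Longrightarrow> dist (x j) d < e/2" unfolding eventually_sequentially by blast
    define j where "j = max m J"
    have "\<bar>\<phi> t - \<phi> (inverse (real (Suc (Suc j))))\<bar> < e/2" if "0 < t" "t < inverse (real (Suc m))" for t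
      using m small[of m j] that by (auto simp: j_def)
    moreover have "dist (x j) d < e/2" by (rule J) (simp add: j_def)
    ultimately have "dist (\<phi> t) d < e" if "0 < t" "t < inverse (real (Suc m))" for t
      using that unfolding x_def dist_real_def by (smt (verit) field_sum_of_halves)
    then show "eventually (\<lambda>t. dist (\<phi> t) d < e) (at_right 0)"
      unfolding eventually_at_right_field by (intro exI[of _ "inverse (real (Suc m))"]) auto
  qed
  then show ?L by blast
qed

text \<open>The map \<open>F = f + (L + 1) id\<close> is a bi-Lipschitz bijection, so the image of Lebesgue measure under
  its inverse is absolutely continuous; its density is the derivative of \<open>F\<close>.\<close>
lemma lipschitz_ae_right_derivative:
  fixes f :: "real \<Rightarrow> real"
  assumes lip: "L-lipschitz_on UNIV f"
  shows "negligible {x. \<not> (\<exists>d. ((\<lambda>h. (f (x + h) - f x) / h) \<longlongrightarrow> d) (at_right 0))}"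
proof -
  have L: "0 \<le> L" using lip by (rule lipschitz_on_nonneg)
  \<comment> \<open>The slope \<open>L + 1\<close> exceeds the Lipschitz constant by one, so
    increments of \<open>F\<close> are between \<open>1\<close> and \<open>2 * L + 1\<close> times
    those of the argument.\<close>
  define F where "F x = f x + (L + 1) * x" for x
  have fd: "\<bar>f y - f x\<bar> \<le> L * \<bar>y - x\<bar>" for x y
    using lipschitz_onD[OF lip, of y x] by (simp add: dist_real_def)
  have F1: "y - x \<le> F y - F x" if "x \<le> y" for x y
    using fd[of y x] that by (simp add: F_def algebra_simps abs_le_iff)
  have F2: "\<bar>F y - F x\<bar> \<le> (2 * L + 1) * \<bar>y - x\<bar>" for x y
    using fd[of y x] L by (simp add: F_def algebra_simps abs_le_iff abs_if split: if_splits) 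
  have F_lip: "(2 * L + 1)-lipschitz_on UNIV F"
    using F2 L by (intro lipschitz_onI) (auto simp: dist_real_def)
  then have F_cont: "continuous_on S F" for S by (meson lipschitz_on_continuous_on continuous_on_subset top_greatest)
  have F_mono: "F x \<le> F y \<longleftrightarrow> x \<le> y" for x y using F1[of x y] F1[of y x] by linarith
  have inj: "inj F" by (rule injI) (metis F_mono antisym order_refl)
  have surj: "surj F"
  proof (rule surjI)
    fix y
    define t where "t = \<bar>y\<bar> + \<bar>F 0\<bar>"
    have t: "0 \<le> t" "- t \<le> t" by (auto simp: t_def)
    then have "F (- t) \<le> y" "y \<le> F t" using F1[of 0 t] F1[of "-t" 0] t_def by linarith+
    moreover note t(2)
    ultimately obtain x where "F x = y" using IVT'[of F "-t" y t] F_cont by blast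
    then show "F (inv F y) = y" by (rule f_inv_into_f[of y F UNIV, OF range_eqI, OF sym])
  qed
  define G where "G = inv F"
  have FG: "F (G y) = y" for y unfolding G_def using surj by (rule surj_f_inv_f)
  have GF: "G (F x) = x" for x unfolding G_def using inj by (rule inv_f_f)
  have G_lip: "1-lipschitz_on UNIV G"
  proof (rule lipschitz_onI)
    fix u v
    show "dist (G u) (G v) \<le> 1 * dist u v"
    proof (cases "G u \<le> G v")
      case True
      then show ?thesis using F1[OF True] by (simp add: FG dist_real_def)
    next
      case False
      then have "G v \<le> G u" by simp
      from F1[OF this] this show ?thesis by (simp add: FG dist_real_def)
    qed
  qed simp
  have G_meas[measurable]: "G \<in> borel_measurable borel"
    using lipschitz_on_continuous_on[OF G_lip] by (rule borel_measurable_continuous_onI)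
  \<comment> \<open>The measure of a set is the length of its image under \<open>F\<close>; in
    particular \<open>{a..b}\<close> receives \<open>F b - F a\<close>.\<close>
  define \<mu> where "\<mu> = distr lborel borel G"
  have vim: "G -` A = F ` A" for A using FG GF by (metis (no_types, lifting) equalityI image_subsetI subsetI vimageE vimageI image_eqI)
  have \<mu>: "emeasure \<mu> A = emeasure lborel (F ` A)" if [measurable]: "A \<in> sets borel" for A
    unfolding \<mu>_def by (subst emeasure_distr) (auto simp: vim)
  have "absolutely_continuous lborel \<mu>"
    unfolding absolutely_continuous_def
  proof
    fix A :: "real set" assume A: "A \<in> null_sets lborel"
    then have bA[measurable]: "A \<in> sets borel" by auto
    have "negligible A" using A by (simp add: negligible_iff_null_sets null_sets_completionI)
    then have "negligible (F ` A)"
    proof (rule negligible_locally_Lipschitz_image[rotated])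
      show "\<exists>T B. open T \<and> x \<in> T \<and> (\<forall>y\<in>A \<inter> T. norm (F y - F x) \<le> B * norm (y - x))" for x
        using F2 by (intro exI[of _ UNIV] exI[of _ "2 * L + 1"]) auto
    qed simp
    moreover have "F ` A \<in> sets lborel" using measurable_sets_borel[OF G_meas bA] by (simp add: vim)
    ultimately have "emeasure lborel (F ` A) = 0"
      by (simp add: negligible_iff_null_sets null_sets_completion_iff null_setsD1)
    then show "A \<in> null_sets \<mu>" using \<mu>[OF bA] by (auto simp: null_sets_def \<mu>_def)
  qed
  then obtain h where h[measurable]: "h \<in> borel_measurable lborel" and dh: "density lborel h = \<mu>"
    using sigma_finite_measure.Radon_Nikodym[OF lborel.sigma_finite_measure_axioms, of \<mu>] by (auto simp: \<mu>_def)
  have F_im: "F ` {a..b} = {F a..F b}" for a b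
  proof (intro equalityI subsetI)
    fix y assume "y \<in> {F a..F b}"
    then have "G y \<in> {a..b}" using F_mono[of a "G y"] F_mono[of "G y" b] FG by auto
    then show "y \<in> F ` {a..b}" using FG by (metis image_eqI)
  qed (auto simp: F_mono)
  have int_h: "(\<integral>\<^sup>+x. h x * indicator {a..b} x \<partial>lborel) = ennreal (F b - F a)" if "a \<le> b" for a b
  proof -
    have "(\<integral>\<^sup>+x. h x * indicator {a..b} x \<partial>lborel) = emeasure \<mu> {a..b}"
      by (subst dh[symmetric], subst emeasure_density) auto
    also have "\<dots> = emeasure lborel {F a..F b}" by (simp add: \<mu> F_im)
    also have "\<dots> = ennreal (F b - F a)" using F_mono[of a b] that by simp
    finally show ?thesis .
  qed
  have "AE x in lborel. \<forall>m::nat. h x * indicator {-real m..real m} x \<noteq> \<infinity>"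
  proof (subst AE_all_countable, intro allI)
    fix m :: nat
    show "AE x in lborel. h x * indicator {-real m..real m} x \<noteq> \<infinity>"
      by (rule nn_integral_noteq_infinite) (auto simp: int_h)
  qed
  then have fin: "AE x in lborel. h x \<noteq> \<infinity>"
  proof eventually_elim
    case (elim x)
    obtain m where "\<bar>x\<bar> \<le> real m" using real_arch_simple by blast
    then show ?case using spec[OF elim, of m] by (auto simp: indicator_def abs_le_iff split: if_splits)
  qed
  define k where "k x = enn2real (h x)" for x
  have k_int: "(k has_integral (F b - F a)) {a..b}" if ab: "a \<le> b" for a b
  proof -
    have "((\<lambda>x. indicator {a..b} x * k x) has_integral (F b - F a)) UNIV"
    proof (rule nn_integral_has_integral)
      show "(\<lambda>x. indicator {a..b} x * k x) \<in> borel_measurable borel" unfolding k_def by measurable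
      have "(\<integral>\<^sup>+x. ennreal (indicator {a..b} x * k x) \<partial>lborel) = (\<integral>\<^sup>+x. h x * indicator {a..b} x \<partial>lborel)"
        using fin by (intro nn_integral_cong_AE) (auto simp: k_def indicator_def less_top[symmetric] elim!: eventually_mono)
      then show "(\<integral>\<^sup>+x. ennreal (indicator {a..b} x * k x) \<partial>lborel) = ennreal (F b - F a)"
        using int_h[OF ab] by simp
    qed (use F_mono[of a b] ab in \<open>auto simp: k_def\<close>)
    then have "((\<lambda>x. if x \<in> {a..b} then k x else 0) has_integral (F b - F a)) UNIV"
      by (rule has_integral_eq[rotated]) (auto simp: indicator_def)
    then show ?thesis by (simp only: has_integral_restrict_UNIV)
  qed
  have k_on: "k integrable_on cbox a b" for a b
    using k_int[of a b] by (cases "a \<le> b") (auto simp: integrable_on_def)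
  \<comment> \<open>Lebesgue differentiation over cubes having the point as lower corner. On the
    line these are intervals to the right of the point, which is why one-sided derivatives appear
    throughout.\<close>
  obtain N where N: "negligible N" "\<And>x e. x \<notin> N \<Longrightarrow> 0 < e \<Longrightarrow> \<exists>d>0. \<forall>h. 0 < h \<and> h < d \<longrightarrow>
      norm (integral (cbox x (x + h *\<^sub>R One)) k /\<^sub>R h ^ DIM(real) - k x) < e"
    using integrable_ccontinuous_explicit[of k] k_on by metis
  have "\<exists>d. ((\<lambda>h. (f (x + h) - f x) / h) \<longlongrightarrow> d) (at_right 0)" if x: "x \<notin> N" for x
  proof -
    have "((\<lambda>h. (F (x + h) - F x) / h) \<longlongrightarrow> k x) (at_right 0)"
    proof (rule tendstoI)
      fix e :: real assume "0 < e"
      from N(2)[OF x this] obtain d where d: "d > 0"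
        "\<And>h. 0 < h \<Longrightarrow> h < d \<Longrightarrow> norm (integral (cbox x (x + h *\<^sub>R One)) k /\<^sub>R h ^ DIM(real) - k x) < e" by blast
      have "dist ((F (x + h) - F x) / h) (k x) < e" if "0 < h" "h < d" for h
        using d(2)[OF that] integral_unique[OF k_int[of x "x + h"]] that
        by (simp add: dist_real_def divide_inverse mult.commute)
      then show "eventually (\<lambda>h. dist ((F (x + h) - F x) / h) (k x) < e) (at_right 0)"
        unfolding eventually_at_right_field using d(1) by blast
    qed
    then have "((\<lambda>h. (F (x + h) - F x) / h - (L + 1)) \<longlongrightarrow> k x - (L + 1)) (at_right 0)"
      by (intro tendsto_intros)
    moreover have "eventually (\<lambda>h. (F (x + h) - F x) / h - (L + 1) = (f (x + h) - f x) / h) (at_right 0)"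
      unfolding eventually_at_right_field by (intro exI[of _ 1]) (auto simp: F_def field_simps)
    ultimately have "((\<lambda>h. (f (x + h) - f x) / h) \<longlongrightarrow> k x - (L + 1)) (at_right 0)"
      by (rule Lim_transform_eventually)
    then show ?thesis by blast
  qed
  then have "{x. \<not> (\<exists>d. ((\<lambda>h. (f (x + h) - f x) / h) \<longlongrightarrow> d) (at_right 0))} \<subseteq> N" by blast
  with N(1) show ?thesis by (rule negligible_subset)
qed

text \<open>Each line in direction \<open>v\<close> meets the exceptional set in a null set by the
  one-dimensional case. Fubini is applied to translates by \<open>t *\<^sub>R v\<close> for
  \<open>t\<close> in \<open>{0..1}\<close>, which spares a change of coordinates adapted to
  \<open>v\<close>.\<close>

lemma lipschitz_ae_directional_derivative:
  fixes g :: "'a::euclidean_space \<Rightarrow> real"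
  assumes lip: "L-lipschitz_on UNIV g"
  shows "negligible {x. \<not> (\<exists>d. ((\<lambda>h. (g (x + h *\<^sub>R v) - g x) / h) \<longlongrightarrow> d) (at_right 0))}"
proof -
  define E where "E = {x. \<not> (\<exists>d. ((\<lambda>h. (g (x + h *\<^sub>R v) - g x) / h) \<longlongrightarrow> d) (at_right 0))}"
  have cont: "continuous_on S g" for S
    using lipschitz_on_continuous_on[OF lip] continuous_on_subset by blast
  define C where "C k m = {x. \<forall>s\<in>{0<..<inverse (real (Suc m))}. \<forall>t\<in>{0<..<inverse (real (Suc m))}.
    \<bar>(g (x + s *\<^sub>R v) - g x) / s - (g (x + t *\<^sub>R v) - g x) / t\<bar> \<le> inverse (real (Suc k))}" for k m :: nat
  have clC: "closed (C k m)" for k m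
  proof -
    have "C k m = (\<Inter>s\<in>{0<..<inverse (real (Suc m))}. \<Inter>t\<in>{0<..<inverse (real (Suc m))}.
        {x. \<bar>(g (x + s *\<^sub>R v) - g x) / s - (g (x + t *\<^sub>R v) - g x) / t\<bar> \<le> inverse (real (Suc k))})"
      by (auto simp: C_def)
    moreover have "closed {x. \<bar>(g (x + s *\<^sub>R v) - g x) / s - (g (x + t *\<^sub>R v) - g x) / t\<bar> \<le> inverse (real (Suc k))}" if "0 < s" "0 < t" for s t
      using that by (intro closed_Collect_le continuous_intros continuous_on_compose2[OF cont[of UNIV]]) auto
    ultimately show ?thesis by (auto intro!: closed_INT)
  qed
  have E: "E = - (\<Inter>k. \<Union>m. C k m)" unfolding E_def ex_lim_at_right_iff C_def by blast
  have [measurable]: "C k m \<in> sets borel" for k m using clC by (rule borel_closed)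
  have "(\<Inter>k. \<Union>m. C k m) \<in> sets borel" by measurable
  then have Eb[measurable]: "E \<in> sets borel" unfolding E by (rule borel_comp)
  let ?I = "indicator E :: 'a \<Rightarrow> ennreal"
  have lines: "{t. x + t *\<^sub>R v \<in> E} \<in> null_sets lborel" for x
  proof -
    have "(L * norm v)-lipschitz_on UNIV (\<lambda>t. g (x + t *\<^sub>R v))"
    proof (rule lipschitz_onI)
      fix s t :: real
      have "dist (g (x + s *\<^sub>R v)) (g (x + t *\<^sub>R v)) \<le> L * dist (x + s *\<^sub>R v) (x + t *\<^sub>R v)"
        by (rule lipschitz_onD[OF lip]) auto
      also have "dist (x + s *\<^sub>R v) (x + t *\<^sub>R v) = norm v * dist s t"
        by (simp add: dist_norm scaleR_left_diff_distrib[symmetric] mult.commute)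
      finally show "dist (g (x + s *\<^sub>R v)) (g (x + t *\<^sub>R v)) \<le> L * norm v * dist s t" by simp
    qed (use lipschitz_on_nonneg[OF lip] in simp)
    from lipschitz_ae_right_derivative[OF this]
    have "negligible {t. x + t *\<^sub>R v \<in> E}" by (simp add: E_def scaleR_left_distrib add.assoc)
    moreover have "{t. x + t *\<^sub>R v \<in> E} \<in> sets lborel"
    proof -
      have "(\<lambda>t. x + t *\<^sub>R v) \<in> borel_measurable borel" by measurable
      from measurable_sets_borel[OF this Eb] show ?thesis by (simp add: vimage_def)
    qed
    ultimately show ?thesis by (simp add: negligible_iff_null_sets null_sets_completion_iff)
  qed
  have tr: "(\<integral>\<^sup>+x. ?I (x + t *\<^sub>R v) \<partial>lborel) = emeasure lborel E" for t
  proof -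
    have "(\<integral>\<^sup>+x. ?I x \<partial>lborel) = (\<integral>\<^sup>+x. ?I x \<partial>distr lborel borel ((+) (t *\<^sub>R v)))"
      by (simp add: lborel_distr_plus)
    also have "\<dots> = (\<integral>\<^sup>+x. ?I (t *\<^sub>R v + x) \<partial>lborel)" by (subst nn_integral_distr) auto
    finally show ?thesis by (simp add: add.commute)
  qed
  have meas: "(\<lambda>(x, t). indicator {0..1} t * ?I (x + t *\<^sub>R v)) \<in> borel_measurable (lborel \<Otimes>\<^sub>M (lborel :: real measure))"
  proof -
    have m1: "(\<lambda>p :: 'a \<times> real. fst p + snd p *\<^sub>R v) \<in> (lborel \<Otimes>\<^sub>M lborel) \<rightarrow>\<^sub>M borel" by measurable
    have "(\<lambda>p :: 'a \<times> real. ?I (fst p + snd p *\<^sub>R v)) \<in> borel_measurable (lborel \<Otimes>\<^sub>M lborel)"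
      using measurable_compose[OF m1 borel_measurable_indicator[OF Eb]] by simp
    moreover have "(\<lambda>p :: 'a \<times> real. indicator {0..1::real} (snd p) :: ennreal) \<in> borel_measurable (lborel \<Otimes>\<^sub>M lborel)" by measurable
    ultimately show ?thesis by (simp add: case_prod_beta')
  qed
  \<comment> \<open>All translates of \<open>E\<close> have the same measure, so averaging over
    \<open>t\<close> keeps it; after exchanging the integrals the inner one runs along a line and
    vanishes.\<close>
  have "emeasure lborel E = (\<integral>\<^sup>+t. indicator {0..1::real} t * emeasure lborel E \<partial>lborel)"
    by (subst nn_integral_multc) auto
  also have "\<dots> = (\<integral>\<^sup>+t. (\<integral>\<^sup>+x. indicator {0..1} t * ?I (x + t *\<^sub>R v) \<partial>lborel) \<partial>lborel)"
  proof (rule nn_integral_cong)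
    fix t :: real
    have "(\<lambda>x. x + t *\<^sub>R v) \<in> borel_measurable (lborel :: 'a measure)" by measurable
    then have "(\<lambda>x. ?I (x + t *\<^sub>R v)) \<in> borel_measurable lborel"
      using measurable_compose[OF _ borel_measurable_indicator[OF Eb]] by blast
    then show "indicator {0..1} t * emeasure lborel E = (\<integral>\<^sup>+x. indicator {0..1} t * ?I (x + t *\<^sub>R v) \<partial>lborel)"
      by (simp add: nn_integral_cmult tr)
  qed
  also have "\<dots> = (\<integral>\<^sup>+x. (\<integral>\<^sup>+t. indicator {0..1} t * ?I (x + t *\<^sub>R v) \<partial>lborel) \<partial>lborel)"
    using meas by (rule lborel_pair.Fubini')
  also have "\<dots> = (\<integral>\<^sup>+x. 0 \<partial>(lborel :: 'a measure))"
  proof (rule nn_integral_cong)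
    fix x :: 'a
    have "AE t in lborel. t \<notin> {t. x + t *\<^sub>R v \<in> E}" using lines[of x] by (rule AE_not_in)
    then have "(\<integral>\<^sup>+t. indicator {0..1} t * ?I (x + t *\<^sub>R v) \<partial>lborel) = (\<integral>\<^sup>+t. 0 \<partial>(lborel :: real measure))"
      by (intro nn_integral_cong_AE) (auto simp: indicator_def elim!: eventually_mono)
    then show "(\<integral>\<^sup>+t. indicator {0..1} t * ?I (x + t *\<^sub>R v) \<partial>lborel) = 0" by simp
  qed
  finally have "E \<in> null_sets lborel" using Eb by (simp add: null_sets_def)
  then have "negligible E" by (simp add: negligible_iff_null_sets null_sets_completionI)
  then show ?thesis by (simp only: E_def)
qed

section \<open>One-sided directional derivatives as sequential limits\<close>

definition dquot :: "('a::euclidean_space \<Rightarrow> real) \<Rightarrow> 'a \<Rightarrow> nat \<Rightarrow> 'a \<Rightarrow> real" where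
  "dquot g v k x = (g (x + inverse (real (Suc k)) *\<^sub>R v) - g x) * real (Suc k)"

text \<open>The limit is taken along one fixed sequence so that the result is a Borel function. It
  equals the right derivative where that exists and is an unspecified value where the sequence
  diverges.\<close>

definition rderiv :: "('a::euclidean_space \<Rightarrow> real) \<Rightarrow> 'a \<Rightarrow> 'a \<Rightarrow> real" where
  "rderiv g v x = lim (\<lambda>k. dquot g v k x)"

lemma rderivI:
  assumes "((\<lambda>h. (g (x + h *\<^sub>R v) - g x) / h) \<longlongrightarrow> d) (at_right 0)"
  shows "(\<lambda>k. dquot g v k x) \<longlonglongrightarrow> d" "rderiv g v x = d"
proof -
  have "filterlim (\<lambda>k. inverse (real (Suc k))) (at_right 0) sequentially"
    unfolding filterlim_at using LIMSEQ_inverse_real_of_nat by simp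
  from filterlim_compose[OF assms this] show "(\<lambda>k. dquot g v k x) \<longlonglongrightarrow> d"
    by (simp add: dquot_def divide_inverse)
  then show "rderiv g v x = d" unfolding rderiv_def by (rule limI)
qed

lemma rderiv_tendsto:
  assumes "\<exists>d. ((\<lambda>h. (g (x + h *\<^sub>R v) - g x) / h) \<longlongrightarrow> d) (at_right 0)"
  shows "((\<lambda>h. (g (x + h *\<^sub>R v) - g x) / h) \<longlongrightarrow> rderiv g v x) (at_right 0)"
    "(\<lambda>k. dquot g v k x) \<longlonglongrightarrow> rderiv g v x"
proof -
  obtain d where d: "((\<lambda>h. (g (x + h *\<^sub>R v) - g x) / h) \<longlongrightarrow> d) (at_right 0)" using assms by blast
  from rderivI[OF d] d show "((\<lambda>h. (g (x + h *\<^sub>R v) - g x) / h) \<longlongrightarrow> rderiv g v x) (at_right 0)"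
    "(\<lambda>k. dquot g v k x) \<longlonglongrightarrow> rderiv g v x" by simp_all
qed

lemma dquot_bound:
  assumes "L-lipschitz_on UNIV g" shows "\<bar>dquot g v k x\<bar> \<le> L * norm v"
proof -
  have "\<bar>g (x + inverse (real (Suc k)) *\<^sub>R v) - g x\<bar> \<le> L * norm (inverse (real (Suc k)) *\<^sub>R v)"
    using lipschitz_onD[OF assms, of "x + inverse (real (Suc k)) *\<^sub>R v" x] by (simp add: dist_norm)
  then have "\<bar>g (x + inverse (real (Suc k)) *\<^sub>R v) - g x\<bar> * real (Suc k) \<le> L * norm (inverse (real (Suc k)) *\<^sub>R v) * real (Suc k)"
    by (rule mult_right_mono) simp
  also have "\<dots> = L * norm v" by (simp del: of_nat_Suc)
  finally show ?thesis by (simp add: dquot_def abs_mult)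
qed

text \<open>At almost every point the value is a limit of averages over shrinking cubes, and all
  these averages vanish.\<close>

lemma ae_zero_if_box_integrals_zero:
  fixes e :: "'a::euclidean_space \<Rightarrow> real"
  assumes "\<And>a b. (e has_integral 0) (cbox a b)"
  shows "negligible {x. e x \<noteq> 0}"
proof -
  have "e integrable_on cbox a b" for a b using assms by (auto simp: integrable_on_def)
  then obtain N where N: "negligible N" "\<And>x \<epsilon>. x \<notin> N \<Longrightarrow> 0 < \<epsilon> \<Longrightarrow> \<exists>d>0. \<forall>h. 0 < h \<and> h < d \<longrightarrow>
      norm (integral (cbox x (x + h *\<^sub>R One)) e /\<^sub>R h ^ DIM('a) - e x) < \<epsilon>"
    using integrable_ccontinuous_explicit[of e] by metis
  have "e x = 0" if x: "x \<notin> N" for x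
  proof (rule ccontr)
    assume "e x \<noteq> 0"
    then obtain d where d: "d > 0" "\<forall>h. 0 < h \<and> h < d \<longrightarrow>
      norm (integral (cbox x (x + h *\<^sub>R One)) e /\<^sub>R h ^ DIM('a) - e x) < \<bar>e x\<bar>" using N(2)[OF x, of "\<bar>e x\<bar>"] by auto
    have "norm (integral (cbox x (x + (d/2) *\<^sub>R One)) e /\<^sub>R (d/2) ^ DIM('a) - e x) < \<bar>e x\<bar>"
      using d(1) by (intro d(2)[rule_format]) auto
    then show False by (simp only: integral_unique[OF assms]) simp
  qed
  then have "{x. e x \<noteq> 0} \<subseteq> N" by blast
  with N(1) show ?thesis by (rule negligible_subset)
qed

text \<open>The difference quotient in direction \<open>a + b\<close> is the one in direction \<open>a\<close> plus a translate of the one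
  in direction \<open>b\<close>. Under an integral over a box the translation moves to the box, and disappears in
  the limit.\<close>
lemma rderiv_add_ae:
  fixes g :: "'a::euclidean_space \<Rightarrow> real"
  assumes lip: "L-lipschitz_on UNIV g"
  shows "negligible {x. rderiv g (a + b) x \<noteq> rderiv g a x + rderiv g b x}"
proof -
  have cont: "continuous_on S g" for S
    using lipschitz_on_continuous_on[OF lip] continuous_on_subset by blast
  have gm[measurable]: "g \<in> borel_measurable borel" by (rule borel_measurable_continuous_onI[OF cont])
  have qm[measurable]: "dquot g v k \<in> borel_measurable borel" for v k unfolding dquot_def by measurable
  have rm[measurable]: "rderiv g v \<in> borel_measurable borel" for v
    unfolding rderiv_def by (rule borel_measurable_lim_metric) measurable
  have ae: "AE x in lborel. (\<lambda>k. dquot g v k x) \<longlonglongrightarrow> rderiv g v x" for v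
  proof -
    have "{x. \<not> (\<exists>d. ((\<lambda>h. (g (x + h *\<^sub>R v) - g x) / h) \<longlongrightarrow> d) (at_right 0))} \<in> null_sets (completion lborel)"
      using lipschitz_ae_directional_derivative[OF lip, of v] by (simp add: negligible_iff_null_sets)
    from AE_not_in[OF this]
    have "AE x in completion lborel. \<exists>d. ((\<lambda>h. (g (x + h *\<^sub>R v) - g x) / h) \<longlongrightarrow> d) (at_right 0)" by simp
    then show ?thesis unfolding AE_completion_iff by eventually_elim (rule rderiv_tendsto(2))
  qed
  have key: "(\<lambda>k. \<integral>y. indicator (cbox c d) (y - inverse (real (Suc k)) *\<^sub>R w) * dquot g v k y \<partial>lborel)
      \<longlonglongrightarrow> (\<integral>y. indicator (cbox c d) y * rderiv g v y \<partial>lborel)"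
    and key_int: "integrable lborel (\<lambda>y. indicator (cbox c d) y * rderiv g v y)" for c d v w
  proof -
    obtain R where R: "\<And>x. x \<in> cbox c d \<Longrightarrow> norm x \<le> R"
      using bounded_cbox[of c d] unfolding bounded_iff by blast
    \<comment> \<open>The shifts are never longer than \<open>norm w\<close>, so all shifted boxes
      lie in one ball and a single integrable bound serves every \<open>k\<close>.\<close>
    let ?D = "\<lambda>y::'a. L * norm v * indicator (cball 0 (R + norm w)) y :: real"
    have Dint: "integrable lborel ?D"
      using emeasure_bounded_finite[OF bounded_cball, of "0::'a" "R + norm w"]
      by (intro integrable_mult_right integrable_real_indicator) auto
    have L0: "0 \<le> L * norm v" using lipschitz_on_nonneg[OF lip] by simp
    have bound: "norm (indicator (cbox c d) (y - inverse (real (Suc k)) *\<^sub>R w) * dquot g v k y) \<le> ?D y" for k y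
    proof (cases "y - inverse (real (Suc k)) *\<^sub>R w \<in> cbox c d")
      case True
      have "norm (inverse (real (Suc k)) *\<^sub>R w) = inverse (real (Suc k)) * norm w" by simp
      also have "\<dots> \<le> 1 * norm w" by (intro mult_right_mono) (auto simp: field_simps)
      finally have "norm (inverse (real (Suc k)) *\<^sub>R w) \<le> norm w" by simp
      then have "norm y \<le> R + norm w"
        using R[OF True] norm_triangle_ineq2[of y "inverse (real (Suc k)) *\<^sub>R w"] by linarith
      then show ?thesis using dquot_bound[OF lip, of v k y] True by (simp add: indicator_def)
    qed (use L0 in \<open>simp add: indicator_def\<close>)
    \<comment> \<open>Off the boundary of the box, the indicator of the shifted box agrees with that
      of the box for all large \<open>k\<close>.\<close>
    have "AE x in lborel. x \<notin> frontier (cbox c d)"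
      using negligible_frontier_interval[of c d] AE_not_in[of "frontier (cbox c d)" lborel] 
      by (simp add: negligible_iff_null_sets null_sets_completion_iff frontier_def cbox_borel box_borel sets.Diff interior_cbox)
    then have lim: "AE y in lborel. (\<lambda>k. indicator (cbox c d) (y - inverse (real (Suc k)) *\<^sub>R w) * dquot g v k y)
        \<longlonglongrightarrow> indicator (cbox c d) y * rderiv g v y"
      using ae[of v]
    proof eventually_elim
      case (elim y)
      have l: "(\<lambda>k. y - inverse (real (Suc k)) *\<^sub>R w) \<longlonglongrightarrow> y - 0 *\<^sub>R w"
        by (intro tendsto_intros LIMSEQ_inverse_real_of_nat)
      have "(\<lambda>k. indicator (cbox c d) (y - inverse (real (Suc k)) *\<^sub>R w) :: real) \<longlonglongrightarrow> indicator (cbox c d) y"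
      proof (cases "y \<in> cbox c d")
        case True
        then have "y \<in> interior (cbox c d)" using elim(1) by (auto simp: frontier_def)
        then have "eventually (\<lambda>k. y - inverse (real (Suc k)) *\<^sub>R w \<in> interior (cbox c d)) sequentially"
          using l by (intro topological_tendstoD) auto
        then have "eventually (\<lambda>k. indicator (cbox c d) (y - inverse (real (Suc k)) *\<^sub>R w) = (indicator (cbox c d) y :: real)) sequentially"
          by eventually_elim (use True box_subset_cbox[of c d] in \<open>auto simp: indicator_def\<close>)
        then show ?thesis by (rule tendsto_eventually)
      next
        case False
        then have "eventually (\<lambda>k. y - inverse (real (Suc k)) *\<^sub>R w \<in> - cbox c d) sequentially"
          using l by (intro topological_tendstoD) auto
        then have "eventually (\<lambda>k. indicator (cbox c d) (y - inverse (real (Suc k)) *\<^sub>R w) = (indicator (cbox c d) y :: real)) sequentially"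
          by eventually_elim (use False in \<open>auto simp: indicator_def\<close>)
        then show ?thesis by (rule tendsto_eventually)
      qed
      then show ?case using elim(2) by (rule tendsto_mult)
    qed
    have m1: "(\<lambda>y. indicator (cbox c d) y * rderiv g v y) \<in> borel_measurable lborel" by measurable
    have m2: "(\<lambda>y. indicator (cbox c d) (y - inverse (real (Suc k)) *\<^sub>R w) * dquot g v k y) \<in> borel_measurable lborel" for k
      by measurable
    show "(\<lambda>k. \<integral>y. indicator (cbox c d) (y - inverse (real (Suc k)) *\<^sub>R w) * dquot g v k y \<partial>lborel)
      \<longlonglongrightarrow> (\<integral>y. indicator (cbox c d) y * rderiv g v y \<partial>lborel)"
      "integrable lborel (\<lambda>y. indicator (cbox c d) y * rderiv g v y)"
      using integral_dominated_convergence[OF m1 m2 Dint lim] integrable_dominated_convergence[OF m1 m2 Dint lim] bound by auto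
  qed
  have box0: "(\<integral>y. indicator (cbox c d) y * rderiv g (a + b) y \<partial>lborel) =
     (\<integral>y. indicator (cbox c d) y * rderiv g a y \<partial>lborel) + (\<integral>y. indicator (cbox c d) y * rderiv g b y \<partial>lborel)" for c d
  proof (rule LIMSEQ_unique)
    show "(\<lambda>k. \<integral>y. indicator (cbox c d) y * dquot g (a + b) k y \<partial>lborel)
      \<longlonglongrightarrow> (\<integral>y. indicator (cbox c d) y * rderiv g (a + b) y \<partial>lborel)" using key[of c d 0 "a + b"] by simp
    have lims: "(\<lambda>k. (\<integral>y. indicator (cbox c d) y * dquot g a k y \<partial>lborel) +
        (\<integral>y. indicator (cbox c d) (y - inverse (real (Suc k)) *\<^sub>R a) * dquot g b k y \<partial>lborel))
      \<longlonglongrightarrow> (\<integral>y. indicator (cbox c d) y * rderiv g a y \<partial>lborel) + (\<integral>y. indicator (cbox c d) y * rderiv g b y \<partial>lborel)"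
      using key[of c d 0 a] key[of c d a b] by (intro tendsto_add) auto
    moreover have "(\<integral>y. indicator (cbox c d) y * dquot g a k y \<partial>lborel) +
        (\<integral>y. indicator (cbox c d) (y - inverse (real (Suc k)) *\<^sub>R a) * dquot g b k y \<partial>lborel)
      = (\<integral>y. indicator (cbox c d) y * dquot g (a + b) k y \<partial>lborel)" for k
    proof -
      let ?r = "inverse (real (Suc k))"
      have bi: "integrable lborel (\<lambda>y. indicator (cbox c d) y * h y)" if [measurable]: "h \<in> borel_measurable borel"
        and hb: "\<And>y. \<bar>h y\<bar> \<le> B" for h :: "'a \<Rightarrow> real" and B
      proof (rule Bochner_Integration.integrable_bound[of _ "\<lambda>y. B * indicator (cbox c d) y"])
        show "integrable lborel (\<lambda>y. B * indicator (cbox c d) y :: real)"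
          using emeasure_bounded_finite[OF bounded_cbox, of c d]
          by (intro integrable_mult_right integrable_real_indicator) auto
        have "0 \<le> B" using hb[of 0] by linarith
        then show "AE y in lborel. norm (indicator (cbox c d) y * h y) \<le> norm (B * indicator (cbox c d) y)"
          using hb by (auto simp: indicator_def)
      qed measurable
      have "(\<integral>y. indicator (cbox c d) (y - ?r *\<^sub>R a) * dquot g b k y \<partial>lborel)
        = (\<integral>y. indicator (cbox c d) (y - ?r *\<^sub>R a) * dquot g b k y \<partial>distr lborel borel ((+) (?r *\<^sub>R a)))"
        by (simp add: lborel_distr_plus)
      also have "\<dots> = (\<integral>y. indicator (cbox c d) y * dquot g b k (?r *\<^sub>R a + y) \<partial>lborel)"
        by (subst integral_distr) auto
      finally have "(\<integral>y. indicator (cbox c d) y * dquot g a k y \<partial>lborel) +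
        (\<integral>y. indicator (cbox c d) (y - ?r *\<^sub>R a) * dquot g b k y \<partial>lborel) =
        (\<integral>y. indicator (cbox c d) y * dquot g a k y + indicator (cbox c d) y * dquot g b k (?r *\<^sub>R a + y) \<partial>lborel)"
        by (subst Bochner_Integration.integral_add) (use dquot_bound[OF lip] in \<open>auto intro!: bi\<close>)
      also have "\<dots> = (\<integral>y. indicator (cbox c d) y * dquot g (a + b) k y \<partial>lborel)"
        by (intro Bochner_Integration.integral_cong) (auto simp: dquot_def algebra_simps)
      finally show ?thesis .
    qed
    ultimately show "(\<lambda>k. \<integral>y. indicator (cbox c d) y * dquot g (a + b) k y \<partial>lborel)
      \<longlonglongrightarrow> (\<integral>y. indicator (cbox c d) y * rderiv g a y \<partial>lborel) + (\<integral>y. indicator (cbox c d) y * rderiv g b y \<partial>lborel)"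
      by simp
  qed
  let ?e = "\<lambda>x. rderiv g (a + b) x - rderiv g a x - rderiv g b x"
  have "(?e has_integral 0) (cbox c d)" for c d
  proof -
    have si: "set_integrable lborel (cbox c d) (rderiv g v)" for v
      unfolding set_integrable_def using key_int by simp
    have lb: "(LINT y:cbox c d|lborel. rderiv g v y) = (\<integral>y. indicator (cbox c d) y * rderiv g v y \<partial>lborel)" for v
      by (simp add: set_lebesgue_integral_def)
    have hi: "(rderiv g v has_integral (\<integral>y. indicator (cbox c d) y * rderiv g v y \<partial>lborel)) (cbox c d)" for v
      using set_borel_integral_eq_integral[OF si[of v]] unfolding lb by (metis integrable_integral)
    show ?thesis using has_integral_diff[OF has_integral_diff[OF hi[of "a+b"] hi[of a]] hi[of b]] box0[of c d] by simp
  qed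
  then have "negligible {x. ?e x \<noteq> 0}" by (rule ae_zero_if_box_integrals_zero)
  then show ?thesis by (simp add: diff_diff_eq)
qed

section \<open>From countably many directions to total differentiability\<close>

definition rat_pts :: "'a::euclidean_space set" where
  "rat_pts = {w. \<forall>b\<in>Basis. w \<bullet> b \<in> \<rat>}"

lemma countable_rat_pts: "countable (rat_pts :: 'a::euclidean_space set)"
proof (rule countable_subset)
  let ?P = "PiE (Basis :: 'a set) (\<lambda>_. \<rat> :: real set)"
  show "countable ((\<lambda>r. \<Sum>b\<in>Basis. r b *\<^sub>R b) ` ?P)"
    by (intro countable_image countable_PiE) (auto simp: countable_rat)
  show "rat_pts \<subseteq> (\<lambda>r. \<Sum>b\<in>Basis. r b *\<^sub>R b) ` ?P"
  proof
    fix w :: 'a assume w: "w \<in> rat_pts"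
    have "w = (\<Sum>b\<in>Basis. (restrict (\<lambda>b. w \<bullet> b) Basis) b *\<^sub>R b)"
      by (simp add: euclidean_representation)
    moreover have "restrict (\<lambda>b. w \<bullet> b) Basis \<in> ?P" using w by (auto simp: rat_pts_def)
    ultimately show "w \<in> (\<lambda>r. \<Sum>b\<in>Basis. r b *\<^sub>R b) ` ?P" by blast
  qed
qed

lemma rat_pts_dense:
  fixes u :: "'a::euclidean_space"
  assumes "0 < e" obtains w where "w \<in> rat_pts" "norm (u - w) < e"
proof -
  have d: "0 < e / DIM('a)" using assms by simp
  have "\<exists>r\<in>\<rat>. \<bar>u \<bullet> b - r\<bar> < e / DIM('a)" for b
  proof -
    obtain r where "r \<in> \<rat>" "u \<bullet> b < r" "r < u \<bullet> b + e / DIM('a)"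
      using Rats_dense_in_real[of "u \<bullet> b" "u \<bullet> b + e / DIM('a)"] d by auto
    then show ?thesis by (intro bexI[of _ r]) auto
  qed
  then obtain r where r: "\<And>b. r b \<in> \<rat>" "\<And>b. \<bar>u \<bullet> b - r b\<bar> < e / DIM('a)" by metis
  define w where "w = (\<Sum>b\<in>Basis. r b *\<^sub>R b)"
  have wb: "w \<bullet> b = r b" if "b \<in> Basis" for b using that by (simp add: w_def)
  have "norm (u - w) \<le> (\<Sum>b\<in>Basis. \<bar>(u - w) \<bullet> b\<bar>)" by (rule norm_le_l1)
  also have "\<dots> < (\<Sum>b\<in>(Basis::'a set). e / DIM('a))"
    by (rule sum_strict_mono) (use r wb in \<open>auto simp: inner_diff_left\<close>)
  also have "\<dots> = e" by simp
  finally have "norm (u - w) < e" .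
  moreover have "w \<in> rat_pts" using wb r by (auto simp: rat_pts_def)
  ultimately show ?thesis using that by blast
qed

text \<open>Outside a single null set the right derivatives in all rational directions agree with
  one linear map. Uniformity in the direction comes from compactness: finitely many rational
  directions approximate the unit sphere up to \<eta>, and both the quotient and the linear map are
  Lipschitz in the direction.\<close>

theorem rademacher:
  fixes g :: "'a::euclidean_space \<Rightarrow> real"
  assumes lip: "L-lipschitz_on UNIV g"
  shows "negligible {x. \<not> g differentiable (at x)}"
proof -
  have L0: "0 \<le> L" using lip by (rule lipschitz_on_nonneg)
  define E where "E v = {x. \<not> (\<exists>d. ((\<lambda>h. (g (x + h *\<^sub>R v) - g x) / h) \<longlongrightarrow> d) (at_right 0))}" for v
  define A where "A p = {x. rderiv g (fst p + snd p) x \<noteq> rderiv g (fst p) x + rderiv g (snd p) x}" for p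
  have A: "negligible (A p)" for p unfolding A_def by (rule rderiv_add_ae[OF lip])
  define N where "N = (\<Union>v\<in>rat_pts. E v) \<union> (\<Union>p\<in>rat_pts \<times> rat_pts. A p)"
  have neg: "negligible N"
    unfolding N_def
  proof (rule negligible_Un)
    show "negligible (\<Union>v\<in>rat_pts. E v)"
      using countable_rat_pts lipschitz_ae_directional_derivative[OF lip]
      by (intro negligible_countable_Union) (auto simp: E_def)
    show "negligible (\<Union>p\<in>rat_pts \<times> rat_pts. A p)"
      using countable_rat_pts A by (intro negligible_countable_Union countable_image countable_SIGMA) auto
  qed
  have "g differentiable (at x)" if x: "x \<notin> N" for x
  proof -
    let ?D = "\<lambda>v. rderiv g v x"
    have lim: "((\<lambda>h. (g (x + h *\<^sub>R v) - g x) / h) \<longlongrightarrow> ?D v) (at_right 0)" if "v \<in> rat_pts" for v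
      using x that by (intro rderiv_tendsto) (auto simp: N_def E_def)
    have add: "?D (a + b) = ?D a + ?D b" if "a \<in> rat_pts" "b \<in> rat_pts" for a b
      using x that by (auto simp: N_def A_def)
    have zero: "?D 0 = 0" using rderivI(2)[of g x 0 0] by simp
    have basis: "r *\<^sub>R b \<in> rat_pts" if "r \<in> \<rat>" "b \<in> Basis" for r and b :: 'a
      using that by (auto simp: rat_pts_def inner_Basis)
    have pos: "?D (r *\<^sub>R b) = r * ?D b" if r: "0 \<le> r" "r \<in> \<rat>" and b: "b \<in> Basis" for r b
    proof (cases "r = 0")
      case False
      then have r0: "0 < r" using r by simp
      have bl: "((\<lambda>h. (g (x + h *\<^sub>R b) - g x) / h) \<longlongrightarrow> ?D b) (at_right 0)" using lim[OF basis[of 1 b]] b by simp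
      have "filterlim (\<lambda>h. h * r) (at_right 0) (at_right (0::real))"
        unfolding filterlim_at
      proof
        show "\<forall>\<^sub>F h in at_right 0. h * r \<in> {0<..} \<and> h * r \<noteq> 0"
          unfolding eventually_at_right_field using r0 by (intro exI[of _ 1]) auto
        have "((\<lambda>h. h * r) \<longlongrightarrow> 0 * r) (at_right 0)" by (intro tendsto_intros)
        then show "((\<lambda>h. h * r) \<longlongrightarrow> 0) (at_right 0)" by simp
      qed
      from tendsto_mult_left[OF filterlim_compose[OF bl this], of r]
      have "((\<lambda>h. r * ((g (x + (h * r) *\<^sub>R b) - g x) / (h * r))) \<longlongrightarrow> r * ?D b) (at_right 0)" by simp
      then have "((\<lambda>h. (g (x + h *\<^sub>R (r *\<^sub>R b)) - g x) / h) \<longlongrightarrow> r * ?D b) (at_right 0)" using r0 by simp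
      then show ?thesis by (rule rderivI(2))
    qed (simp add: zero)
    \<comment> \<open>A right derivative is homogeneous only for nonnegative factors; negative ones
      follow from additivity at \<open>r *\<^sub>R b\<close> and its negative, whose sum has
      derivative \<open>0\<close>.\<close>
    have hom: "?D (r *\<^sub>R b) = r * ?D b" if r: "r \<in> \<rat>" and b: "b \<in> Basis" for r b
    proof (cases "0 \<le> r")
      case False
      have "?D (r *\<^sub>R b + (-r) *\<^sub>R b) = ?D (r *\<^sub>R b) + ?D ((-r) *\<^sub>R b)" using r b by (intro add basis) auto
      moreover have "?D ((-r) *\<^sub>R b) = (-r) * ?D b" using r b False by (intro pos) auto
      ultimately show ?thesis using zero by (simp add: scaleR_left_distrib[symmetric])
    qed (use pos r b in auto)
    define T where "T w = (\<Sum>b\<in>Basis. (w \<bullet> b) * ?D b)" for w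
    have blT: "bounded_linear T" unfolding T_def
      by (intro bounded_linear_sum bounded_linear_mult_const bounded_linear_inner_left)
    then obtain K where K: "0 < K" "\<And>w. \<bar>T w\<bar> \<le> norm w * K" using bounded_linear.pos_bounded by force
    have DT: "?D w = T w" if w: "w \<in> rat_pts" for w
    proof -
      have "?D (\<Sum>b\<in>S. (w \<bullet> b) *\<^sub>R b) = (\<Sum>b\<in>S. (w \<bullet> b) * ?D b)" if "S \<subseteq> Basis" for S
        using finite_subset[OF that finite_Basis] that
      proof (induction S rule: finite_induct)
        case empty then show ?case by (simp add: zero)
      next
        case (insert c S)
        have "(\<Sum>b\<in>S. (w \<bullet> b) *\<^sub>R b) \<bullet> b' \<in> \<rat>" if "b' \<in> Basis" for b'
        proof -
          have "(\<Sum>b\<in>S. (w \<bullet> b) *\<^sub>R b) \<bullet> b' = (\<Sum>b\<in>S. if b = b' then w \<bullet> b else 0)"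
            using insert.prems that by (auto simp: inner_sum_left inner_Basis intro!: sum.cong)
          also have "\<dots> = (if b' \<in> S then w \<bullet> b' else 0)" using insert.hyps(1) by (simp add: sum.delta')
          also have "\<dots> \<in> \<rat>" using w that by (auto simp: rat_pts_def)
          finally show ?thesis .
        qed
        then have "(\<Sum>b\<in>S. (w \<bullet> b) *\<^sub>R b) \<in> rat_pts" by (simp add: rat_pts_def)
        moreover have "w \<bullet> c \<in> \<rat>" using w insert.prems by (auto simp: rat_pts_def)
        ultimately show ?case using insert by (simp add: add basis hom)
      qed
      from this[of Basis] show ?thesis by (simp add: euclidean_representation T_def)
    qed
    have "(g has_derivative T) (at x)"
      unfolding has_derivative_at_alt
    proof (intro conjI blT allI impI)
      fix e :: real assume e: "0 < e"
      \<comment> \<open>Three errors are added: the quotient in a nearby net direction, the change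
        of \<open>g\<close>, and the change of \<open>T\<close> between the two directions. They
        contribute \<open>1\<close>, \<open>L\<close> and \<open>K\<close> times \<eta>.\<close>
      define \<eta> where "\<eta> = e / (L + K + 1)"
      have \<eta>: "0 < \<eta>" "\<eta> * (L + K + 1) = e" using e L0 K(1) by (auto simp: \<eta>_def)
      have cov: "sphere (0::'a) 1 \<subseteq> (\<Union>w\<in>rat_pts. ball w \<eta>)"
      proof
        fix u :: 'a
        obtain w where "w \<in> rat_pts" "norm (u - w) < \<eta>" using rat_pts_dense[OF \<eta>(1), of u] by blast
        then show "u \<in> (\<Union>w\<in>rat_pts. ball w \<eta>)" by (auto simp: dist_norm norm_minus_commute)
      qed
      obtain W where W: "W \<subseteq> rat_pts" "finite W" "sphere (0::'a) 1 \<subseteq> (\<Union>w\<in>W. ball w \<eta>)"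
        using compactE_image[OF compact_sphere[of "0::'a" 1], of rat_pts "\<lambda>w. ball w \<eta>"] cov by auto
      have "eventually (\<lambda>h. \<forall>w\<in>W. dist ((g (x + h *\<^sub>R w) - g x) / h) (?D w) < \<eta>) (at_right 0)"
        using W \<eta>(1) by (intro eventually_ball_finite ballI tendstoD lim) auto
      then obtain d where d: "d > 0"
        "\<And>h w. 0 < h \<Longrightarrow> h < d \<Longrightarrow> w \<in> W \<Longrightarrow> dist ((g (x + h *\<^sub>R w) - g x) / h) (?D w) < \<eta>"
        unfolding eventually_at_right_field by blast
      show "\<exists>d>0. \<forall>y. norm (y - x) < d \<longrightarrow> norm (g y - g x - T (y - x)) \<le> e * norm (y - x)"
      proof (intro exI[of _ d] conjI allI impI d(1))
        fix y assume y: "norm (y - x) < d"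
        show "norm (g y - g x - T (y - x)) \<le> e * norm (y - x)"
        proof (cases "y = x")
          case True then show ?thesis using linear_0[OF bounded_linear.linear[OF blT]] by simp
        next
          case False
          define h where "h = norm (y - x)"
          define u where "u = (y - x) /\<^sub>R h"
          have h: "0 < h" "h < d" using False y by (auto simp: h_def)
          have "norm u = 1" using h by (simp add: u_def h_def)
          then obtain w where w: "w \<in> W" "norm (u - w) < \<eta>"
            using W(3) by (force simp: dist_norm norm_minus_commute)
          have yx: "y = x + h *\<^sub>R u" "y - x = h *\<^sub>R u" using h by (auto simp: u_def)
          have "dist ((g (x + h *\<^sub>R w) - g x) / h) (?D w) < \<eta>" using d(2)[OF h w(1)] .
          then have "\<bar>(g (x + h *\<^sub>R w) - g x) / h - T w\<bar> < \<eta>" using DT w(1) W(1) by (auto simp: dist_real_def)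
          then have 1: "\<bar>g (x + h *\<^sub>R w) - g x - h * T w\<bar> \<le> \<eta> * h"
            using h by (simp add: field_simps abs_le_iff abs_less_iff)
          have "\<bar>g y - g (x + h *\<^sub>R w)\<bar> \<le> L * norm (y - (x + h *\<^sub>R w))"
            using lipschitz_onD[OF lip, of y "x + h *\<^sub>R w"] by (simp add: dist_norm)
          also have "y - (x + h *\<^sub>R w) = h *\<^sub>R (u - w)" unfolding yx by (simp add: algebra_simps)
          also have "L * norm (h *\<^sub>R (u - w)) \<le> L * (h * \<eta>)"
            using h w L0 by (auto intro!: mult_left_mono)
          finally have 2: "\<bar>g y - g (x + h *\<^sub>R w)\<bar> \<le> L * (h * \<eta>)" .
          have "h * T w - T (y - x) = h * T (w - u)"
            unfolding yx using bounded_linear.linear[OF blT] by (simp add: linear_scale linear_diff right_diff_distrib)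
          then have "\<bar>h * T w - T (y - x)\<bar> = h * \<bar>T (w - u)\<bar>" using h by (simp add: abs_mult)
          also have "\<dots> \<le> h * (\<eta> * K)"
          proof (intro mult_left_mono)
            have "\<bar>T (w - u)\<bar> \<le> norm (w - u) * K" by (rule K(2))
            also have "\<dots> \<le> \<eta> * K" using w(2) K(1) by (auto simp: norm_minus_commute intro!: mult_right_mono)
            finally show "\<bar>T (w - u)\<bar> \<le> \<eta> * K" .
          qed (use h in simp)
          finally have 3: "\<bar>h * T w - T (y - x)\<bar> \<le> h * (\<eta> * K)" .
          have "\<bar>g y - g x - T (y - x)\<bar> \<le> L * (h * \<eta>) + \<eta> * h + h * (\<eta> * K)" using 1 2 3 by linarith
          also have "\<dots> = (\<eta> * (L + K + 1)) * h" by (simp add: algebra_simps)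
          finally show ?thesis using \<eta>(2) by (simp add: h_def)
        qed
      qed
    qed
    then show ?thesis by (auto simp: differentiable_def)
  qed
  then have "{x. \<not> g differentiable (at x)} \<subseteq> N" by blast
  with neg show ?thesis by (rule negligible_subset)
qed

section \<open>Increments from derivative bounds that hold almost everywhere\<close>

lemma has_derivative_directional:
  fixes g :: "'a::real_normed_vector \<Rightarrow> real"
  assumes "(g has_derivative D) (at y)"
  shows "((\<lambda>h. (g (y + h *\<^sub>R v) - g y) / h) \<longlongrightarrow> D v) (at 0)"
proof -
  have l: "linear D" using assms has_derivative_linear by blast
  have "((\<lambda>h. g (y + h *\<^sub>R v)) has_derivative (\<lambda>h. D (h *\<^sub>R v))) (at 0)"
    by (rule has_derivative_compose[of "\<lambda>h. y + h *\<^sub>R v" "\<lambda>h. h *\<^sub>R v", simplified])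
      (use assms in \<open>auto intro!: derivative_eq_intros\<close>)
  then have "((\<lambda>h. g (y + h *\<^sub>R v)) has_real_derivative D v) (at 0)"
    unfolding has_field_derivative_def using l by (simp add: linear_scale mult.commute[of _ "D v"])
  then show ?thesis unfolding DERIV_def by simp
qed

text \<open>Integrating \<open>g (y + t *\<^sub>R v)\<close> over \<open>y\<close> in a small box gives a function of \<open>t\<close> that is
  differentiable everywhere and does not see the exceptional set.\<close>
lemma lipschitz_increment_le_ae:
  fixes g :: "'a::euclidean_space \<Rightarrow> real"
  assumes lip: "L-lipschitz_on UNIV g" and N: "negligible N"
    and seg: "closed_segment z (z + v) \<subseteq> S" "open S"
    and le: "\<And>y D. y \<in> S \<Longrightarrow> y \<notin> N \<Longrightarrow> (g has_derivative D) (at y) \<Longrightarrow> D v \<le> c"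
  shows "g (z + v) - g z \<le> c"
proof (rule ccontr)
  assume neg: "\<not> ?thesis"
  define \<epsilon> where "\<epsilon> = g (z + v) - g z - c"
  have \<epsilon>: "0 < \<epsilon>" using neg by (simp add: \<epsilon>_def)
  have L0: "0 \<le> L" using lip by (rule lipschitz_on_nonneg)
  have cont: "continuous_on A g" for A
    using lipschitz_on_continuous_on[OF lip] continuous_on_subset by blast
  have gm[measurable]: "g \<in> borel_measurable borel" by (rule borel_measurable_continuous_onI[OF cont])
  define N' where "N' = {x. \<not> g differentiable (at x)}"
  have N': "negligible N'" "\<And>x. x \<notin> N' \<Longrightarrow> g differentiable (at x)"
    using rademacher[OF lip] by (auto simp: N'_def)
  obtain r where r: "r > 0" "(\<Union>x\<in>closed_segment z (z + v). ball x r) \<subseteq> S"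
    using compact_subset_open_imp_ball_epsilon_subset[OF compact_segment seg(2,1)] by blast
  \<comment> \<open>Moving both endpoints by \<delta> changes the increment of \<open>g\<close> by
    at most \<open>2 * (L * \<delta>)\<close>, so half of the assumed excess \<epsilon> survives on
    the whole box; \<open>\<delta> \<le> r\<close> keeps the moved segments inside
    \<open>S\<close>.\<close>
  define \<delta> where "\<delta> = min r (\<epsilon> / (4 * L + 4))"
  have \<delta>: "0 < \<delta>" "\<delta> \<le> r" "2 * (L * \<delta>) \<le> \<epsilon> / 2"
  proof -
    have "L * (\<epsilon> / (4 * L + 4)) \<le> \<epsilon> / 4" using L0 \<epsilon> by (simp add: field_simps)
    moreover have "L * \<delta> \<le> L * (\<epsilon> / (4 * L + 4))" using L0 by (intro mult_left_mono) (auto simp: \<delta>_def)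
    ultimately show "2 * (L * \<delta>) \<le> \<epsilon> / 2" by linarith
  qed (use r \<epsilon> L0 in \<open>auto simp: \<delta>_def\<close>)
  obtain a b where ab: "z \<in> box a b" "cbox a b \<subseteq> ball z \<delta>"
    using open_contains_cbox[THEN iffD1, OF open_ball, rule_format, of z z \<delta>] \<delta>(1) by (metis centre_in_ball)
  let ?Q = "cbox a b"
  let ?I = "\<lambda>y. indicator ?Q y :: real"
  define \<mu> where "\<mu> = measure lborel ?Q"
  have \<mu>: "0 < \<mu>"
  proof -
    have "\<forall>i\<in>Basis. a \<bullet> i < b \<bullet> i" using ab(1) by (auto simp: mem_box intro: less_trans)
    then show ?thesis unfolding \<mu>_def by (simp add: content_pos_lt_eq)
  qed
  have Iint: "integrable lborel ?I" 
    using emeasure_bounded_finite[OF bounded_cbox, of a b] by (intro integrable_real_indicator) auto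
  define \<Phi> where "\<Phi> t = (\<integral>y. ?I y * g (y + t *\<^sub>R v) \<partial>lborel)" for t
  have gint: "integrable lborel (\<lambda>y. ?I y * g (y + t *\<^sub>R v))" for t
  proof -
    have "compact ((\<lambda>y. g (y + t *\<^sub>R v)) ` ?Q)"
      by (intro compact_continuous_image continuous_on_compose2[OF cont[of UNIV]] continuous_intros) auto
    then have "bounded ((\<lambda>y. g (y + t *\<^sub>R v)) ` ?Q)" by (rule compact_imp_bounded)
    then obtain B where B: "\<And>y. y \<in> ?Q \<Longrightarrow> \<bar>g (y + t *\<^sub>R v)\<bar> \<le> B"
      unfolding bounded_iff by auto
    show ?thesis
    proof (rule Bochner_Integration.integrable_bound[of _ "\<lambda>y. B * ?I y"])
      show "AE y in lborel. norm (?I y * g (y + t *\<^sub>R v)) \<le> norm (B * ?I y)"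
      proof (rule AE_I2)
        fix y
        show "norm (?I y * g (y + t *\<^sub>R v)) \<le> norm (B * ?I y)" using B[of y] by (auto simp: indicator_def)
      qed
    qed (use Iint in auto)
  qed
  have "\<exists>d. (\<Phi> has_real_derivative d) (at t) \<and> d \<le> c * \<mu>" if t: "t \<in> {0..1}" for t
  proof -
    define D where "D y = frechet_derivative g (at y) v" for y
    let ?q = "\<lambda>h y. ?I y * ((g (y + (t + h) *\<^sub>R v) - g (y + t *\<^sub>R v)) / h)"
    have tr: "negligible ((+) (- (t *\<^sub>R v)) ` (N \<union> N'))" using N N'(1) by (intro negligible_translation negligible_Un)
    have "AE y in lebesgue. y \<notin> (+) (- (t *\<^sub>R v)) ` (N \<union> N')"
      using tr by (intro AE_not_in) (simp add: negligible_iff_null_sets)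
    then have aeN: "AE y in lborel. y + t *\<^sub>R v \<notin> N \<union> N'"
      unfolding AE_completion_iff
      by (rule eventually_mono) (force simp: image_iff)
    have lim: "((\<lambda>h. (g (y + (t + h) *\<^sub>R v) - g (y + t *\<^sub>R v)) / h) \<longlongrightarrow> D (y + t *\<^sub>R v)) (at 0)"
      if "y + t *\<^sub>R v \<notin> N \<union> N'" for y
    proof -
      let ?y = "y + t *\<^sub>R v"
      have der: "(g has_derivative frechet_derivative g (at ?y)) (at ?y)"
        using N'(2)[of ?y] that by (simp add: frechet_derivative_works)
      from has_derivative_directional[OF this] show ?thesis by (simp add: D_def scaleR_left_distrib add.assoc)
    qed
    have qb: "\<bar>?q h y\<bar> \<le> L * norm v * ?I y" for h y
    proof (cases "h = 0")
      case False
      have "\<bar>g (y + (t + h) *\<^sub>R v) - g (y + t *\<^sub>R v)\<bar> \<le> L * norm (h *\<^sub>R v)"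
        using lipschitz_onD[OF lip, of "y + (t + h) *\<^sub>R v" "y + t *\<^sub>R v"] by (simp add: dist_norm scaleR_left_distrib)
      then show ?thesis using False by (auto simp: indicator_def abs_mult field_simps)
    qed (use L0 in \<open>auto simp: indicator_def\<close>)
    have hk: "\<forall>k. inverse (real (Suc k)) \<noteq> 0" "(\<lambda>k. inverse (real (Suc k))) \<longlonglongrightarrow> 0"
      using LIMSEQ_inverse_real_of_nat by auto
    have qm: "?q h \<in> borel_measurable lborel" for h by measurable
    \<comment> \<open>Defined as a sequential limit to be measurable; almost everywhere it equals
      the directional derivative multiplied by the indicator of the box.\<close>
    define m where "m y = lim (\<lambda>k. ?q (inverse (real (Suc k))) y)" for y
    have mm: "m \<in> borel_measurable lborel"
      unfolding m_def by (rule borel_measurable_lim_metric) (rule qm)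
    have seqlim: "AE y in lborel. (\<lambda>k. ?q (X k) y) \<longlonglongrightarrow> m y" if X: "\<forall>k. X k \<noteq> 0" "X \<longlonglongrightarrow> 0" for X
      using aeN
    proof eventually_elim
      case (elim y)
      have X': "filterlim Y (at 0) sequentially" if "\<forall>k. Y k \<noteq> 0" "Y \<longlonglongrightarrow> 0" for Y :: "nat \<Rightarrow> real"
        using that by (simp add: filterlim_at)
      have l: "(\<lambda>k. ?q (Y k) y) \<longlonglongrightarrow> ?I y * D (y + t *\<^sub>R v)" if "\<forall>k. Y k \<noteq> 0" "Y \<longlonglongrightarrow> 0" for Y
        by (intro tendsto_mult_left filterlim_compose[OF lim[OF elim] X'[OF that]])
      have "m y = ?I y * D (y + t *\<^sub>R v)"
        unfolding m_def by (rule limI[OF l[OF hk]])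
      then show ?case using l[OF X] by simp
    qed
    \<comment> \<open>The limit of the integrals is the same for every sequence of nonzero steps
      tending to \<open>0\<close>, which is exactly differentiability of \<open>\<Phi>\<close> at
      \<open>t\<close>.\<close>
    have conv: "(\<lambda>k. \<integral>y. ?q (X k) y \<partial>lborel) \<longlonglongrightarrow> (\<integral>y. m y \<partial>lborel)" "integrable lborel m"
      if X: "\<forall>k. X k \<noteq> 0" "X \<longlonglongrightarrow> 0" for X
      using integral_dominated_convergence[OF mm qm _ seqlim[OF X], of "\<lambda>y. L * norm v * ?I y"]
        integrable_dominated_convergence[OF mm qm _ seqlim[OF X], of "\<lambda>y. L * norm v * ?I y"] qb Iint by auto
    have quot: "(\<Phi> (t + h) - \<Phi> t) / h = (\<integral>y. ?q h y \<partial>lborel)" for h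
    proof -
      have "\<Phi> (t + h) - \<Phi> t = (\<integral>y. ?I y * g (y + (t + h) *\<^sub>R v) - ?I y * g (y + t *\<^sub>R v) \<partial>lborel)"
        unfolding \<Phi>_def by (rule Bochner_Integration.integral_diff[symmetric]; rule gint)
      then have "(\<Phi> (t + h) - \<Phi> t) / h = (\<integral>y. (?I y * g (y + (t + h) *\<^sub>R v) - ?I y * g (y + t *\<^sub>R v)) / h \<partial>lborel)" by simp
      also have "\<dots> = (\<integral>y. ?q h y \<partial>lborel)"
        by (intro Bochner_Integration.integral_cong) (auto simp: right_diff_distrib diff_divide_distrib)
      finally show ?thesis .
    qed
    have "(\<Phi> has_real_derivative (\<integral>y. m y \<partial>lborel)) (at t)"
      unfolding DERIV_def tendsto_at_iff_sequentially
      using conv(1) by (simp add: quot o_def)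
    moreover have "(\<integral>y. m y \<partial>lborel) \<le> (\<integral>y. c * ?I y \<partial>lborel)"
    proof (rule integral_mono_AE)
      show "integrable lborel m" by (rule conv(2)[OF hk])
      have sl: "AE y in lborel. (\<lambda>k. ?q (inverse (real (Suc k))) y) \<longlonglongrightarrow> m y"
        by (rule seqlim[OF hk])
      show "AE y in lborel. m y \<le> c * ?I y"
        using sl aeN
      proof eventually_elim
        case (elim y)
        have X': "filterlim (\<lambda>k. inverse (real (Suc k))) (at 0) sequentially"
          unfolding filterlim_at using LIMSEQ_inverse_real_of_nat by simp
        have "(\<lambda>k. ?q (inverse (real (Suc k))) y) \<longlonglongrightarrow> ?I y * D (y + t *\<^sub>R v)"
          by (intro tendsto_mult_left filterlim_compose[OF lim[OF elim(2)] X'])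
        then have my: "m y = ?I y * D (y + t *\<^sub>R v)" using LIMSEQ_unique[OF elim(1)] by blast
        show ?case
        proof (cases "y \<in> ?Q")
          case True
          have "z + t *\<^sub>R v \<in> closed_segment z (z + v)"
            unfolding in_segment using t by (intro exI[of _ t]) (auto simp: algebra_simps)
          moreover have "y + t *\<^sub>R v \<in> ball (z + t *\<^sub>R v) r"
            using True ab(2) \<delta>(2) by (auto simp: dist_norm subset_iff)
          ultimately have "y + t *\<^sub>R v \<in> S" using r(2) by blast
          moreover have "(g has_derivative frechet_derivative g (at (y + t *\<^sub>R v))) (at (y + t *\<^sub>R v))"
            using N'(2)[of "y + t *\<^sub>R v"] elim(2) by (simp add: frechet_derivative_works)
          ultimately have "D (y + t *\<^sub>R v) \<le> c" unfolding D_def using le elim(2) by blast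
          then show ?thesis using my True by simp
        qed (use my in simp)
      qed
    qed (use Iint in auto)
    moreover have "(\<integral>y. c * ?I y \<partial>lborel) = c * \<mu>" by (simp add: \<mu>_def)
    ultimately show ?thesis by auto
  qed
  then obtain d where d: "\<And>t. t \<in> {0..1} \<Longrightarrow> (\<Phi> has_real_derivative d t) (at t)" "\<And>t. t \<in> {0..1} \<Longrightarrow> d t \<le> c * \<mu>" by metis
  obtain t where t: "0 < t" "t < 1" "\<Phi> 1 - \<Phi> 0 = (1 - 0) * d t"
    using MVT2[of 0 1 \<Phi> d] d(1) by auto
  have upper: "\<Phi> 1 - \<Phi> 0 \<le> c * \<mu>" using t d(2)[of t] by simp
  have "(c + \<epsilon> / 2) * \<mu> = (\<integral>y. (c + \<epsilon> / 2) * ?I y \<partial>lborel)" by (simp add: \<mu>_def)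
  also have "\<dots> \<le> (\<integral>y. ?I y * g (y + 1 *\<^sub>R v) - ?I y * g (y + 0 *\<^sub>R v) \<partial>lborel)"
  proof (rule integral_mono)
    show "integrable lborel (\<lambda>y. ?I y * g (y + 1 *\<^sub>R v) - ?I y * g (y + 0 *\<^sub>R v))"
      by (rule Bochner_Integration.integrable_diff; rule gint)
    fix y :: 'a
    show "(c + \<epsilon> / 2) * ?I y \<le> ?I y * g (y + 1 *\<^sub>R v) - ?I y * g (y + 0 *\<^sub>R v)"
    proof (cases "y \<in> ?Q")
      case True
      then have yz: "dist y z \<le> \<delta>" using ab(2) by (auto simp: dist_commute subset_iff less_imp_le)
      have "\<bar>g y - g z\<bar> \<le> L * dist y z" "\<bar>g (y + v) - g (z + v)\<bar> \<le> L * dist y z"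
        using lipschitz_onD[OF lip, of y z] lipschitz_onD[OF lip, of "y + v" "z + v"] by (auto simp: dist_norm)
      moreover have "L * dist y z \<le> L * \<delta>" using yz L0 by (rule mult_left_mono)
      ultimately have "g y - g z \<le> L * \<delta>" "g (z + v) - g (y + v) \<le> L * \<delta>" by linarith+
      moreover have "g (z + v) - g z = c + \<epsilon>" by (simp add: \<epsilon>_def)
      ultimately have "c + \<epsilon> / 2 \<le> g (y + v) - g y" using \<delta>(3) by linarith
      then show ?thesis using True by simp
    qed simp
  qed (use Iint in auto)
  also have "\<dots> = \<Phi> 1 - \<Phi> 0" unfolding \<Phi>_def by (rule Bochner_Integration.integral_diff; rule gint)
  finally have "(c + \<epsilon> / 2) * \<mu> \<le> c * \<mu>" using upper by linarith
  then show False using \<mu> \<epsilon> by simp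
qed

section \<open>Increments of locally Lipschitz functions\<close>

lemma lipschitz_derivative_bound:
  fixes g :: "'a::real_normed_vector \<Rightarrow> real"
  assumes lip: "K-lipschitz_on S g" and S: "open S" "y \<in> S" and D: "(g has_derivative D) (at y)"
  shows "\<bar>D v\<bar> \<le> K * norm v"
proof (rule tendsto_upperbound[OF tendsto_rabs[OF has_derivative_directional[OF D]]])
  have "((\<lambda>h. y + h *\<^sub>R v) \<longlongrightarrow> y + 0 *\<^sub>R v) (at 0)" by (intro tendsto_intros)
  then have "eventually (\<lambda>h. y + h *\<^sub>R v \<in> S) (at 0)" using S by (intro topological_tendstoD) auto
  then show "eventually (\<lambda>h. \<bar>(g (y + h *\<^sub>R v) - g y) / h\<bar> \<le> K * norm v) (at 0)"
  proof eventually_elim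
    case (elim h)
    have "\<bar>g (y + h *\<^sub>R v) - g y\<bar> \<le> K * norm (h *\<^sub>R v)"
      using lipschitz_onD[OF lip elim S(2)] by (simp add: dist_norm)
    then show ?case using lipschitz_on_nonneg[OF lip] by (cases "h = 0") (auto simp: field_simps)
  qed
qed simp

text \<open>Composition with the nearest point map of the closed ball extends \<open>g\<close> to
  the whole space with the same Lipschitz constant. It changes nothing on the ball, hence no
  derivative at interior points.\<close>

lemma increment_le_ae:
  fixes g :: "'a::euclidean_space \<Rightarrow> real"
  assumes lip: "L-lipschitz_on (cball x r) g" and N: "negligible N"
    and z: "z \<in> ball x r" "z + v \<in> ball x r"
    and le: "\<And>y D. y \<in> ball x r \<Longrightarrow> y \<notin> N \<Longrightarrow> (g has_derivative D) (at y) \<Longrightarrow> D v \<le> c"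
  shows "g (z + v) - g z \<le> c"
proof -
  let ?c = "closest_point (cball x r)"
  have ne: "cball x r \<noteq> {}" using z(1) ball_subset_cball by blast
  define G where "G y = g (?c y)" for y
  have Glip: "L-lipschitz_on UNIV G"
  proof (rule lipschitz_onI)
    fix p q
    have "dist (G p) (G q) \<le> L * dist (?c p) (?c q)"
      unfolding G_def using closest_point_in_set[OF closed_cball ne] by (intro lipschitz_onD[OF lip]) auto
    also have "\<dots> \<le> L * dist p q"
      by (intro mult_left_mono closest_point_lipschitz[OF convex_cball closed_cball ne] lipschitz_on_nonneg[OF lip])
    finally show "dist (G p) (G q) \<le> L * dist p q" .
  qed (rule lipschitz_on_nonneg[OF lip])
  have Gg: "G y = g y" if "y \<in> ball x r" for y
    using that closest_point_self[of y "cball x r"] by (auto simp: G_def)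
  have "G (z + v) - G z \<le> c"
  proof (rule lipschitz_increment_le_ae[OF Glip N])
    show "closed_segment z (z + v) \<subseteq> ball x r" using z by (rule closed_segment_subset) auto
    show "D v \<le> c" if "y \<in> ball x r" "y \<notin> N" "(G has_derivative D) (at y)" for y D
      using le[OF that(1,2)] has_derivative_transform_within_open[OF that(3) open_ball that(1) Gg] by blast
  qed auto
  then show ?thesis using Gg z by simp
qed

text \<open>Freezing the direction costs \<open>D (\<Phi> y - \<Phi> z)\<close>, which is small near \<open>y\<close> because \<open>K\<close> bounds the
  norm of every derivative \<open>D\<close>.\<close>
lemma increment_along_field:
  fixes g :: "'a::euclidean_space \<Rightarrow> real" and \<Phi> :: "'a \<Rightarrow> 'a"
  assumes lip: "K-lipschitz_on (cball y r) g" and r: "0 < r"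
    and \<Phi>: "isCont \<Phi> y" and \<beta>: "isCont \<beta> y"
    and dec: "\<And>z D. z \<in> ball y r \<Longrightarrow> (g has_derivative D) (at z) \<Longrightarrow> D (\<Phi> z) \<le> - \<beta> z"
    and \<epsilon>: "0 < \<epsilon>"
  shows "\<exists>\<delta>>0. \<forall>z h. 0 \<le> h \<longrightarrow> z \<in> ball y \<delta> \<longrightarrow> z + h *\<^sub>R \<Phi> y \<in> ball y \<delta> \<longrightarrow>
    g (z + h *\<^sub>R \<Phi> y) - g z \<le> h * (- \<beta> y + \<epsilon>)"
proof -
  have K: "0 \<le> K" using lip by (rule lipschitz_on_nonneg)
  \<comment> \<open>Half of \<epsilon> pays for the change of direction at rate \<open>K\<close>,
    the other half for the variation of \<beta>; \<open>K + 1\<close> guards against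
    \<open>K = 0\<close>.\<close>
  have "0 < \<epsilon> / (2 * (K + 1))" using \<epsilon> K by simp
  then obtain d1 where d1: "d1 > 0" "\<forall>z. dist z y < d1 \<longrightarrow> dist (\<Phi> z) (\<Phi> y) < \<epsilon> / (2 * (K + 1))"
    using \<Phi> unfolding continuous_at_eps_delta by blast
  have "0 < \<epsilon> / 2" using \<epsilon> by simp
  then obtain d2 where d2: "d2 > 0" "\<forall>z. dist z y < d2 \<longrightarrow> dist (\<beta> z) (\<beta> y) < \<epsilon> / 2"
    using \<beta> unfolding continuous_at_eps_delta by blast
  define \<delta> where "\<delta> = min r (min d1 d2)"
  have \<delta>: "0 < \<delta>" "\<delta> \<le> r" "\<delta> \<le> d1" "\<delta> \<le> d2" using r d1 d2 by (auto simp: \<delta>_def)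
  have "g (z + h *\<^sub>R \<Phi> y) - g z \<le> h * (- \<beta> y + \<epsilon>)"
    if h: "0 \<le> h" and z: "z \<in> ball y \<delta>" "z + h *\<^sub>R \<Phi> y \<in> ball y \<delta>" for z h
  proof (rule increment_le_ae[OF _ negligible_empty z])
    show "K-lipschitz_on (cball y \<delta>) g" using lip \<delta>(2) by (rule lipschitz_on_subset[OF _ subset_cball])
    fix p D assume p: "p \<in> ball y \<delta>" and D: "(g has_derivative D) (at p)"
    have l: "linear D" using D has_derivative_linear by blast
    have pr: "p \<in> ball y r" "dist p y < d1" "dist p y < d2" using p \<delta> by (auto simp: dist_commute)
    have "\<bar>D (\<Phi> y - \<Phi> p)\<bar> \<le> K * norm (\<Phi> y - \<Phi> p)"
      by (rule lipschitz_derivative_bound[OF lipschitz_on_subset[OF lip ball_subset_cball] open_ball pr(1) D])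
    also have "\<dots> \<le> K * (\<epsilon> / (2 * (K + 1)))"
      using d1(2) pr(2) K by (intro mult_left_mono) (auto simp: dist_norm norm_minus_commute intro: less_imp_le)
    also have "\<dots> \<le> \<epsilon> / 2" using K \<epsilon> by (simp add: field_simps)
    finally have "D (\<Phi> y - \<Phi> p) \<le> \<epsilon> / 2" by simp
    moreover have "D (\<Phi> p) \<le> - \<beta> p" by (rule dec[OF pr(1) D])
    moreover have "dist (\<beta> p) (\<beta> y) < \<epsilon> / 2" using d2(2) pr(3) by blast
    then have "\<beta> y - \<epsilon> / 2 \<le> \<beta> p" unfolding dist_real_def by linarith
    moreover have "D (\<Phi> y) = D (\<Phi> y - \<Phi> p) + D (\<Phi> p)" using linear_diff[OF l] by simp
    ultimately have "D (\<Phi> y) \<le> - \<beta> y + \<epsilon>" by linarith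
    then show "D (h *\<^sub>R \<Phi> y) \<le> h * (- \<beta> y + \<epsilon>)"
      using h by (simp add: linear_scale[OF l] mult_left_mono)
  qed
  then show ?thesis using \<delta>(1) by blast
qed

section \<open>Input-to-state stability from a Lyapunov function\<close>

lemma classKL_exp_decay:
  assumes g: "classKinf g" and h: "classKinf h"
  shows "classKL (\<lambda>s t. g (exp (- t) * h s))"
  unfolding classKL_def
proof (intro conjI allI impI)
  note gK = classKinfD[OF g] and hK = classKinfD[OF h]
  have "continuous_on ({0..} \<times> {0..}) (\<lambda>p::real \<times> real. g (exp (- snd p) * h (fst p)))"
  proof (rule continuous_on_compose2[OF classK_cont[OF gK]])
    show "continuous_on ({0..} \<times> {0..}) (\<lambda>p::real \<times> real. exp (- snd p) * h (fst p))"
      by (intro continuous_intros continuous_on_compose2[OF classK_cont[OF hK]]) auto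
  qed (auto simp: classK_nonneg[OF hK])
  then show "continuous_on ({0..} \<times> {0..}) (\<lambda>(s, t). g (exp (- t) * h s))" by (simp add: case_prod_beta')
  show "classK (\<lambda>s. g (exp (- t) * h s))" for t
  proof (rule classK_compose[OF gK])
    show "classK (\<lambda>s. exp (- t) * h s)"
      by (rule classKI) (auto simp: classK_0[OF hK] classK_less[OF hK] intro!: continuous_intros classK_cont[OF hK])
  qed
  fix s :: real assume s: "0 \<le> s"
  show "g (exp (- t2) * h s) \<le> g (exp (- t1) * h s)" if "t1 \<le> t2" for t1 t2
    by (rule classK_mono[OF gK]) (use that classK_nonneg[OF hK s] in \<open>auto intro!: mult_right_mono\<close>)
  have e: "((\<lambda>t. exp (- t)) \<longlongrightarrow> (0::real)) at_top"
    by (rule filterlim_compose[OF exp_at_bot filterlim_uminus_at_bot_at_top])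
  have "((\<lambda>t. exp (- t) * h s) \<longlongrightarrow> 0 * h s) at_top" by (intro tendsto_intros e)
  then have "((\<lambda>t. g (exp (- t) * h s)) \<longlongrightarrow> g 0) at_top"
    by (intro classK_tendsto[OF gK]) (use classK_nonneg[OF hK s] in auto)
  then show "((\<lambda>t. g (exp (- t) * h s)) \<longlongrightarrow> 0) at_top" by (simp add: classK_0[OF gK])
qed

text \<open>The solution of \<open>h' = h / a\<close> turns the decay \<open>w' \<le> - a w\<close> into \<open>(h w)' \<le> - h w\<close>. The bound
  \<open>a r \<le> r\<close> makes \<open>1 / a\<close> non-integrable both at \<open>0\<close> and at infinity.\<close>
lemma ex_exponential_gauge:
  assumes a: "posdef a" and le: "\<And>r. 0 \<le> r \<Longrightarrow> a r \<le> r"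
  shows "\<exists>E. (\<forall>r>0. (E has_real_derivative inverse (a r)) (at r)) \<and>
    classKinf (\<lambda>r. if 0 < r then exp (E r) else 0)"
proof -
  have pos: "0 < a r" if "0 < r" for r
    using a that unfolding posdef_def by (metis less_eq_real_def less_irrefl)
  have contpos: "continuous_on {0<..} a" using a unfolding posdef_def by (auto intro: continuous_on_subset)
  have "\<exists>E. \<forall>x::real. (0::ereal) < x \<longrightarrow> x < \<infinity> \<longrightarrow> (E has_vector_derivative inverse (a x)) (at x)"
  proof (rule einterval_antiderivative)
    fix x :: real assume "(0::ereal) < x"
    then have x: "x \<in> {0<..}" by simp
    then have "isCont a x" using contpos by (simp add: continuous_on_eq_continuous_at)
    then show "isCont (\<lambda>x. inverse (a x)) x" using pos[of x] x by (intro continuous_intros) auto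
  qed simp
  then obtain E where E: "(E has_real_derivative inverse (a x)) (at x)" if "0 < x" for x
    by (auto simp: has_real_derivative_iff_has_vector_derivative)
  define h where "h r = (if 0 < r then exp (E r) else 0)" for r
  have E_less: "E x < E y" if "0 < x" "x < y" for x y
  proof (rule DERIV_pos_imp_increasing[OF that(2)])
    fix z assume "x \<le> z" "z \<le> y"
    then show "\<exists>d. DERIV E z :> d \<and> d > 0" using E[of z] pos[of z] that by auto
  qed
  \<comment> \<open>From \<open>a z \<le> z\<close>, \<open>E\<close> grows at least as fast as the
    logarithm. Hence \<open>exp (E r)\<close> is at most \<open>exp (E 1) * r\<close> for
    \<open>r \<le> 1\<close>, giving the limit \<open>0\<close>, and at least that for
    \<open>r \<ge> 1\<close>, giving unboundedness.\<close>
  have E_ln: "E x - ln x \<le> E y - ln y" if "0 < x" "x \<le> y" for x y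
  proof (rule DERIV_nonneg_imp_nondecreasing[OF that(2)])
    fix z assume z: "x \<le> z" "z \<le> y"
    then have z0: "0 < z" using that by simp
    have "((\<lambda>z. E z - ln z) has_real_derivative inverse (a z) - inverse z) (at z)"
      using z0 by (auto intro!: derivative_eq_intros E simp: divide_inverse)
    moreover have "inverse z \<le> inverse (a z)" using le[of z] pos[of z] z0 by (intro le_imp_inverse_le) auto
    ultimately show "\<exists>d. DERIV (\<lambda>z. E z - ln z) z :> d \<and> 0 \<le> d" by (intro exI conjI) auto
  qed
  have cont: "continuous (at x within {0..}) h" if x: "0 \<le> x" for x
  proof (cases "x = 0")
    case True
    have "(h \<longlongrightarrow> 0) (at 0 within {0..})"
    proof (rule tendsto_sandwich)
      show "eventually (\<lambda>r. 0 \<le> h r) (at 0 within {0..})" by (simp add: h_def)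
      show "eventually (\<lambda>r. h r \<le> exp (E 1) * r) (at 0 within {0..})"
        using eventually_at_ball[of 1 "0::real" "{0..}", OF zero_less_one]
      proof eventually_elim
        case (elim r)
        show ?case
        proof (cases "r = 0")
          case False
          then have r: "0 < r" "r \<le> 1" using elim by (auto simp: dist_real_def)
          then have "E r \<le> E 1 + ln r" using E_ln[of r 1] by simp
          then have "exp (E r) \<le> exp (E 1 + ln r)" by simp
          then show ?thesis using r by (simp add: h_def exp_add)
        qed (simp add: h_def)
      qed
      have "((\<lambda>r. exp (E 1) * r) \<longlongrightarrow> exp (E 1) * 0) (at 0 within {0..})" by (intro tendsto_intros)
      then show "((\<lambda>r. exp (E 1) * r) \<longlongrightarrow> 0) (at 0 within {0..})" by simp
    qed simp
    then show ?thesis using True by (simp add: continuous_within h_def)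
  next
    case False
    then have x: "0 < x" using x by simp
    have "isCont (\<lambda>r. exp (E r)) x" using DERIV_isCont[OF E[OF x]] by (intro continuous_intros)
    moreover have "eventually (\<lambda>r. h r = exp (E r)) (nhds x)"
      using eventually_nhds_in_open[of "{0<..}" x] x by (auto simp: h_def elim!: eventually_mono)
    ultimately have "isCont h x" by (simp add: isCont_cong)
    then show ?thesis by (rule continuous_at_imp_continuous_at_within)
  qed
  have "classKinf h"
  proof (rule classKinfI, rule classKI)
    show "continuous_on {0..} h" using cont by (simp add: continuous_on_eq_continuous_within)
    show "h x < h y" if "0 \<le> x" "x < y" for x y using E_less[of x y] that by (auto simp: h_def)
    show "\<exists>x\<ge>0. M \<le> h x" for M
    proof -
      define x where "x = max 1 (M / exp (E 1))"
      have x: "1 \<le> x" "M / exp (E 1) \<le> x" by (auto simp: x_def)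
      have "E 1 + ln x \<le> E x" using E_ln[of 1 x] x by simp
      then have "exp (E 1 + ln x) \<le> exp (E x)" by simp
      then have "exp (E 1) * x \<le> h x" using x by (simp add: exp_add h_def)
      moreover have "M \<le> exp (E 1) * x" using x(2) by (simp add: field_simps)
      ultimately show ?thesis using x by (intro exI[of _ x]) auto
    qed
  qed (simp add: h_def)
  then show ?thesis using E unfolding h_def by blast
qed

lemma loc_lipschitz_on_compact:
  fixes V :: "'a::metric_space \<Rightarrow> 'b::metric_space"
  assumes V: "loc_lipschitz_on S V" and X: "compact X" "X \<subseteq> S"
  obtains L where "L-lipschitz_on X V"
proof -
  \<comment> \<open>\<open>local_lipschitz\<close> carries a time parameter; a single dummy time
    reduces it to a statement about \<open>V\<close>.\<close>
  have ll: "local_lipschitz {0::real} X (\<lambda>_. V)"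
  proof (rule local_lipschitzI)
    fix t :: real and x assume "x \<in> X"
    then obtain r L where rL: "r > 0" "L-lipschitz_on (cball x r \<inter> S) V"
      using V X(2) unfolding loc_lipschitz_on_def by blast
    have "L-lipschitz_on (cball x r \<inter> X) V" using X(2) by (intro lipschitz_on_subset[OF rL(2)]) auto
    then show "\<exists>u>0. \<exists>L. \<forall>t\<in>cball t u \<inter> {0}. L-lipschitz_on (cball x u \<inter> X) V" using rL(1) by blast
  qed
  obtain L where "\<And>t. t \<in> {0::real} \<Longrightarrow> L-lipschitz_on X V"
    using local_lipschitz_compact_implies_lipschitz[OF ll X(1), of thesis] by auto
  then show ?thesis using that by blast
qed

section \<open>Essential bounds on inputs and regularity of solutions\<close>

lemma integral_norm_le_ae:
  fixes \<phi> :: "real \<Rightarrow> 'a::euclidean_space"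
  assumes int: "\<phi> integrable_on {a..b}" and ab: "a \<le> b" and N: "negligible N" and M: "0 \<le> M"
    and bound: "\<And>t. t \<in> {a..b} \<Longrightarrow> t \<notin> N \<Longrightarrow> norm (\<phi> t) \<le> M"
  shows "norm (integral {a..b} \<phi>) \<le> M * (b - a)"
proof -
  let ?\<psi> = "\<lambda>t. if t \<in> N then 0 else \<phi> t"
  have "(\<phi> has_integral integral {a..b} \<phi>) {a..b}" using int by (rule integrable_integral)
  then have "(?\<psi> has_integral integral {a..b} \<phi>) {a..b}"
    by (rule has_integral_spike[OF N, rotated]) auto
  then have "norm (integral {a..b} \<phi>) \<le> M * measure lborel {a..b}"
    by (intro has_integral_bound_real[OF M, of "{}"]) (use bound M in auto)
  then show ?thesis using ab by simp
qed

text \<open>The infimum is attained, because the bounds with margins \<open>1 / (k + 1)\<close> fail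
  only on countably many null sets. It is nonnegative, because a negative bound would make
  \<open>{0..1}\<close> a null set.\<close>

lemma ae_bound_linf_norm:
  assumes "admissible_input u"
  shows "0 \<le> linf_norm u" "negligible {t \<in> {0..}. \<not> norm (u t) \<le> linf_norm u}"
proof -
  define C where "C = {c. AE t in lebesgue. t \<in> {0..} \<longrightarrow> norm (u t) \<le> c}"
  have ne: "C \<noteq> {}" using assms by (auto simp: C_def admissible_input_def)
  have lower: "0 \<le> c" if "c \<in> C" for c
  proof (rule ccontr)
    assume c: "\<not> 0 \<le> c"
    have "AE t in lebesgue. t \<notin> {0..1::real}"
      using \<open>c \<in> C\<close> unfolding C_def mem_Collect_eq
    proof eventually_elim
      case (elim t)
      then show ?case using c norm_ge_zero[of "u t"] by fastforce
    qed
    then have "emeasure lebesgue {0..1::real} = 0" by (subst (asm) AE_iff_measurable[of "{0..1}"]) auto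
    then show False by simp
  qed
  have Inf: "linf_norm u = Inf C" by (simp only: linf_norm_def C_def)
  show "0 \<le> linf_norm u" unfolding Inf using ne lower by (intro cInf_greatest) auto
  have "AE t in lebesgue. \<forall>k::nat. t \<in> {0..} \<longrightarrow> norm (u t) \<le> linf_norm u + inverse (real (Suc k))"
  proof (subst AE_all_countable, intro allI)
    fix k :: nat
    have "Inf C < linf_norm u + inverse (real (Suc k))" by (simp add: Inf del: of_nat_Suc)
    then obtain c where "c \<in> C" and c: "c < linf_norm u + inverse (real (Suc k))"
      using cInf_lessD[OF ne] by blast
    from this(1) show "AE t in lebesgue. t \<in> {0..} \<longrightarrow> norm (u t) \<le> linf_norm u + inverse (real (Suc k))"
      unfolding C_def mem_Collect_eq by eventually_elim (use c in auto)
  qed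
  then have "AE t in lebesgue. t \<in> {0..} \<longrightarrow> norm (u t) \<le> linf_norm u"
  proof eventually_elim
    case (elim t)
    show ?case
    proof
      assume t: "t \<in> {0..}"
      show "norm (u t) \<le> linf_norm u"
      proof (rule field_le_epsilon)
        fix e :: real assume "0 < e"
        then obtain k where "inverse (real (Suc k)) < e" using reals_Archimedean by blast
        moreover have "norm (u t) \<le> linf_norm u + inverse (real (Suc k))" using elim t by blast
        ultimately show "norm (u t) \<le> linf_norm u + e" by linarith
      qed
    qed
  qed
  then obtain N where N: "N \<in> null_sets lebesgue" "{t \<in> space lebesgue. \<not> (t \<in> {0..} \<longrightarrow> norm (u t) \<le> linf_norm u)} \<subseteq> N"
    unfolding eventually_ae_filter by blast
  have "negligible N" using N(1) by (simp add: negligible_iff_null_sets)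
  then show "negligible {t \<in> {0..}. \<not> norm (u t) \<le> linf_norm u}"
    by (rule negligible_subset) (use N(2) in auto)
qed

lemma solution_ae_right_derivative:
  fixes F :: "'a::euclidean_space \<Rightarrow> 'b \<Rightarrow> 'a"
  assumes sol: "is_solution F x0 u {0..T} x"
  shows "negligible {t \<in> {0..<T}. \<not> ((\<lambda>h. (x (t + h) - x t) /\<^sub>R h) \<longlongrightarrow> F (x t) (u t)) (at_right 0)}"
proof -
  let ?\<phi> = "\<lambda>s. F (x s) (u s)"
  \<comment> \<open>Extension by zero makes the integrand integrable on every interval, as the
    differentiation theorem demands; right increments at \<open>t < T\<close> do not notice
    it.\<close>
  define \<psi> where "\<psi> s = (if s \<in> {0..T} then ?\<phi> s else 0)" for s
  have int: "?\<phi> integrable_on {0..t}" "x t = x0 + integral {0..t} ?\<phi>" if "t \<in> {0..T}" for t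
    using sol that by (auto simp: is_solution_def absolutely_integrable_on_def)
  have "\<psi> integrable_on UNIV"
  proof (cases "0 \<le> T")
    case True
    then show ?thesis unfolding \<psi>_def integrable_restrict_UNIV using int(1)[of T] by simp
  next
    case False
    then have "\<psi> = (\<lambda>_. 0)" by (auto simp: \<psi>_def)
    then show ?thesis by (simp add: integrable_0)
  qed
  then have "\<psi> integrable_on cbox a b" for a b by (rule integrable_on_subcbox) simp
  then obtain N where N: "negligible N" "\<And>t e. t \<notin> N \<Longrightarrow> 0 < e \<Longrightarrow> \<exists>d>0. \<forall>h. 0 < h \<and> h < d \<longrightarrow>
      norm (integral (cbox t (t + h *\<^sub>R One)) \<psi> /\<^sub>R h ^ DIM(real) - \<psi> t) < e"
    using integrable_ccontinuous_explicit[of \<psi>] by metis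
  have "((\<lambda>h. (x (t + h) - x t) /\<^sub>R h) \<longlongrightarrow> ?\<phi> t) (at_right 0)" if t: "t \<in> {0..<T}" "t \<notin> N" for t
  proof (rule tendstoI)
    fix e :: real assume e: "0 < e"
    obtain d where d: "d > 0" "\<forall>h. 0 < h \<and> h < d \<longrightarrow>
      norm (integral (cbox t (t + h *\<^sub>R One)) \<psi> /\<^sub>R h ^ DIM(real) - \<psi> t) < e" using N(2)[OF t(2) e] by blast
    have "dist ((x (t + h) - x t) /\<^sub>R h) (?\<phi> t) < e" if h: "0 < h" "h < min d (T - t)" for h
    proof -
      have "integral {t..t + h} \<psi> = integral {t..t + h} ?\<phi>"
        using t h by (intro integral_cong) (auto simp: \<psi>_def)
      moreover have "integral {0..t} ?\<phi> + integral {t..t + h} ?\<phi> = integral {0..t + h} ?\<phi>"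
        using t h int(1)[of "t + h"] by (intro Henstock_Kurzweil_Integration.integral_combine) auto
      ultimately have "x (t + h) - x t = integral {t..t + h} \<psi>"
        using int(2)[of t] int(2)[of "t + h"] t h by (simp add: algebra_simps)
      moreover have "norm (integral (cbox t (t + h *\<^sub>R One)) \<psi> /\<^sub>R h ^ DIM(real) - \<psi> t) < e"
        using d(2) h by auto
      ultimately show ?thesis using t by (simp add: dist_norm \<psi>_def)
    qed
    then show "eventually (\<lambda>h. dist ((x (t + h) - x t) /\<^sub>R h) (?\<phi> t) < e) (at_right 0)"
      unfolding eventually_at_right_field using d(1) t by (intro exI[of _ "min d (T - t)"]) auto
  qed
  then have "{t \<in> {0..<T}. \<not> ((\<lambda>h. (x (t + h) - x t) /\<^sub>R h) \<longlongrightarrow> ?\<phi> t) (at_right 0)} \<subseteq> N" by blast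
  with N(1) show ?thesis by (rule negligible_subset)
qed

text \<open>On a compact time interval the state stays in a compact set and the input, almost
  everywhere, in a ball; the continuous field is bounded there.\<close>

lemma solution_lipschitz:
  fixes F :: "'a::euclidean_space \<Rightarrow> 'b::euclidean_space \<Rightarrow> 'a"
  assumes sol: "is_solution F x0 u {0..T} x" and F: "continuous_on UNIV (\<lambda>(x, u). F x u)"
    and N: "negligible N" "\<And>t. 0 \<le> t \<Longrightarrow> t \<notin> N \<Longrightarrow> norm (u t) \<le> U"
  shows "\<exists>M. M-lipschitz_on {0..T} x"
proof -
  let ?\<phi> = "\<lambda>s. F (x s) (u s)"
  have cx: "continuous_on {0..T} x" using sol by (simp add: is_solution_def)
  have int: "?\<phi> integrable_on {0..t}" "x t = x0 + integral {0..t} ?\<phi>" if "t \<in> {0..T}" for t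
    using sol that by (auto simp: is_solution_def absolutely_integrable_on_def)
  have "compact ((\<lambda>(x, u). F x u) ` (x ` {0..T} \<times> cball 0 U))"
    by (intro compact_continuous_image compact_Times continuous_on_subset[OF F] cx) auto
  then have "bounded ((\<lambda>(x, u). F x u) ` (x ` {0..T} \<times> cball 0 U))" by (rule compact_imp_bounded)
  then obtain M where M0: "0 < M" "\<forall>y\<in>(\<lambda>(x, u). F x u) ` (x ` {0..T} \<times> cball 0 U). norm y \<le> M"
    unfolding bounded_pos by blast
  have M: "0 < M" "norm (F (x s) v) \<le> M" if "s \<in> {0..T}" "norm v \<le> U" for s v
    using M0 that by auto
  have *: "norm (x t - x s) \<le> M * (t - s)" if st: "0 \<le> s" "s \<le> t" "t \<le> T" for s t
  proof -
    have "integral {0..s} ?\<phi> + integral {s..t} ?\<phi> = integral {0..t} ?\<phi>"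
      using st int(1)[of t] by (intro Henstock_Kurzweil_Integration.integral_combine) auto
    then have "x t - x s = integral {s..t} ?\<phi>" using int(2)[of s] int(2)[of t] st by (simp add: algebra_simps)
    moreover have "norm (integral {s..t} ?\<phi>) \<le> M * (t - s)"
    proof (rule integral_norm_le_ae[OF _ st(2) N(1)])
      show "?\<phi> integrable_on {s..t}" 
        by (rule integrable_subinterval_real[of _ 0 t]) (use int(1)[of t] st in auto)
      show "norm (?\<phi> \<tau>) \<le> M" if "\<tau> \<in> {s..t}" "\<tau> \<notin> N" for \<tau>
        using that st N(2)[of \<tau>] by (intro M(2)) auto
    qed (use M0(1) in simp)
    ultimately show ?thesis by simp
  qed
  have "M-lipschitz_on {0..T} x"
  proof (rule lipschitz_onI)
    fix s t assume "s \<in> {0..T}" "t \<in> {0..T}"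
    then show "dist (x s) (x t) \<le> M * dist s t"
      using *[of s t] *[of t s] by (cases "s \<le> t") (auto simp: dist_norm norm_minus_commute)
  qed (use M0(1) in simp)
  then show ?thesis by blast
qed

text \<open>\<open>a\<close> measures the decay rate by the value of \<open>V\<close> instead of the
  norm of the state, which turns the decay along a solution into a scalar differential inequality;
  \<open>E\<close> integrates it.\<close>

locale lyapunov_data =
  fixes F :: "'a::euclidean_space \<Rightarrow> 'b::euclidean_space \<Rightarrow> 'a" and V :: "'a \<Rightarrow> real"
    and \<gamma> \<alpha> a E h :: "real \<Rightarrow> real"
  assumes F_cont: "continuous_on UNIV (\<lambda>(x, u). F x u)"
    and V_cont: "continuous_on UNIV V" and V_lip: "loc_lipschitz_on (UNIV - {0}) V" and V_0: "V 0 = 0"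
    and V_nonneg: "0 \<le> V y"
    and \<gamma>: "classK \<gamma>" and \<alpha>: "posdef \<alpha>"
    and dec: "(V has_derivative D) (at y) \<Longrightarrow> \<gamma> (norm v) \<le> V y \<Longrightarrow> D (F y v) \<le> - \<alpha> (norm y)"
    and a: "posdef a" and a_le: "0 < V y \<Longrightarrow> a (V y) \<le> \<alpha> (norm y)"
    and E: "0 < r \<Longrightarrow> (E has_real_derivative inverse (a r)) (at r)"
    and h_def: "h = (\<lambda>r. if 0 < r then exp (E r) else 0)" and h: "classKinf h"
begin

lemma a_pos: "0 < r \<Longrightarrow> 0 < a r"
  using a unfolding posdef_def by (metis less_eq_real_def less_irrefl)

lemma E_mono: "E x \<le> E y" if "0 < x" "x \<le> y"
proof (rule DERIV_nonneg_imp_nondecreasing[OF that(2)])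
  fix z assume "x \<le> z" "z \<le> y"
  then show "\<exists>d. DERIV E z :> d \<and> 0 \<le> d"
    using E[of z] a_pos[of z] that by (intro exI[of _ "inverse (a z)"]) auto
qed

lemma E_lipschitz:
  assumes "0 < c" "c \<le> d" obtains L where "L-lipschitz_on {c..d} E"
proof -
  have "continuous_on {c..d} a" using a assms unfolding posdef_def by (auto intro: continuous_on_subset)
  then obtain m where m: "m \<in> {c..d}" "\<And>r. r \<in> {c..d} \<Longrightarrow> a m \<le> a r"
    using continuous_attains_inf[of "{c..d}" a] assms by auto
  have am: "0 < a m" using m(1) assms a_pos by auto
  have *: "\<bar>E y - E x\<bar> \<le> inverse (a m) * (y - x)" if xy: "c \<le> x" "x < y" "y \<le> d" for x y
  proof -
    obtain z where z: "x < z" "z < y" "E y - E x = (y - x) * inverse (a z)"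
      using MVT2[OF xy(2), of E "\<lambda>z. inverse (a z)"] E xy assms by auto
    have "a m \<le> a z" using z that by (intro m(2)) auto
    then have "inverse (a z) \<le> inverse (a m)" using am by (rule le_imp_inverse_le)
    then have "(y - x) * inverse (a z) \<le> (y - x) * inverse (a m)" using that by (intro mult_left_mono) auto
    moreover have "0 \<le> E y - E x" using E_mono[of x y] that assms by simp
    ultimately show ?thesis using z(3) by (simp add: mult.commute)
  qed
  have "(inverse (a m))-lipschitz_on {c..d} E"
  proof (rule lipschitz_onI)
    fix x y assume xy: "x \<in> {c..d}" "y \<in> {c..d}"
    show "dist (E x) (E y) \<le> inverse (a m) * dist x y"
      using *[of x y] *[of y x] xy by (cases x y rule: linorder_cases) (auto simp: dist_real_def)
  qed (use am in simp)
  then show ?thesis using that by blast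
qed

lemma V_forward:
  assumes "\<gamma> (norm v) < V y" "0 < \<epsilon>"
  shows "\<exists>\<delta>>0. \<forall>s. 0 \<le> s \<longrightarrow> s < \<delta> \<longrightarrow> V (y + s *\<^sub>R F y v) - V y \<le> s * (- \<alpha> (norm y) + \<epsilon>)"
    and "\<exists>K r. 0 < r \<and> K-lipschitz_on (cball y r) V"
proof -
  have "0 \<le> \<gamma> (norm v)" using classK_nonneg[OF \<gamma>] by simp
  then have y0: "y \<in> UNIV - {0}" using assms V_0 by auto
  then obtain r1 K where r1: "r1 > 0" "K-lipschitz_on (cball y r1 \<inter> (UNIV - {0})) V"
    using V_lip unfolding loc_lipschitz_on_def by blast
  have "open {z. \<gamma> (norm v) < V z}" using V_cont by (intro open_Collect_less) auto
  then obtain r2 where r2: "r2 > 0" "ball y r2 \<subseteq> {z. \<gamma> (norm v) < V z}"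
    using assms(1) open_contains_ball by blast
  define r where "r = min r1 (r2 / 2)"
  have r: "0 < r" "cball y r \<subseteq> cball y r1" "cball y r \<subseteq> ball y r2" using r1(1) r2(1) by (auto simp: r_def)
  have "0 \<notin> cball y r"
  proof
    assume "0 \<in> cball y r"
    then have "\<gamma> (norm v) < V 0" using r(3) r2(2) by blast
    then show False using V_0 \<open>0 \<le> \<gamma> (norm v)\<close> by simp
  qed
  then have lip: "K-lipschitz_on (cball y r) V" using r(2) by (intro lipschitz_on_subset[OF r1(2)]) blast
  then show "\<exists>K r. 0 < r \<and> K-lipschitz_on (cball y r) V" using r(1) by blast
  have "continuous_on UNIV (\<lambda>z. (\<lambda>(x, u). F x u) (z, v))"
    by (rule continuous_on_compose2[OF F_cont]) (auto intro!: continuous_intros)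
  then have c1: "isCont (\<lambda>z. F z v) y" by (simp add: continuous_on_eq_continuous_at)
  have ca: "continuous_on {0..} \<alpha>" using \<alpha> by (simp add: posdef_def)
  have "continuous_on UNIV (\<lambda>z::'a. \<alpha> (norm z))" by (rule continuous_on_compose2[OF ca continuous_on_norm_id]) auto
  then have c2: "isCont (\<lambda>z. \<alpha> (norm z)) y" by (simp add: continuous_on_eq_continuous_at)
  have dd: "D (F z v) \<le> - \<alpha> (norm z)" if "z \<in> ball y r" "(V has_derivative D) (at z)" for z D
  proof (rule dec[OF that(2)])
    have "z \<in> ball y r2" using that(1) ball_subset_cball r(3) by blast
    then show "\<gamma> (norm v) \<le> V z" using r2(2) by auto
  qed
  have "\<exists>\<delta>>0. \<forall>z h. 0 \<le> h \<longrightarrow> z \<in> ball y \<delta> \<longrightarrow> z + h *\<^sub>R F y v \<in> ball y \<delta> \<longrightarrow>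
      V (z + h *\<^sub>R F y v) - V z \<le> h * (- \<alpha> (norm y) + \<epsilon>)"
    by (rule increment_along_field[where \<Phi>="\<lambda>z. F z v" and \<beta>="\<lambda>z. \<alpha> (norm z)", OF lip r(1) c1 c2 _ assms(2)])
      (rule dd)
  then obtain \<delta> where \<delta>: "\<delta> > 0" "\<forall>z h. 0 \<le> h \<longrightarrow> z \<in> ball y \<delta> \<longrightarrow> z + h *\<^sub>R F y v \<in> ball y \<delta> \<longrightarrow>
      V (z + h *\<^sub>R F y v) - V z \<le> h * (- \<alpha> (norm y) + \<epsilon>)" by blast
  define \<eta> where "\<eta> = \<delta> / (norm (F y v) + 1)"
  have \<eta>: "0 < \<eta>" using \<delta>(1) by (simp add: \<eta>_def add_nonneg_pos)
  have "V (y + s *\<^sub>R F y v) - V y \<le> s * (- \<alpha> (norm y) + \<epsilon>)" if s: "0 \<le> s" "s < \<eta>" for s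
  proof -
    have "s * norm (F y v) \<le> s * (norm (F y v) + 1)" using s by (intro mult_left_mono) auto
    also have "\<dots> < \<eta> * (norm (F y v) + 1)" using s by (intro mult_strict_right_mono) (auto simp: add_nonneg_pos)
    also have "\<dots> = \<delta>"
    proof -
      have "norm (F y v) + 1 \<noteq> 0" using norm_ge_zero[of "F y v"] by linarith
      then show ?thesis by (simp add: \<eta>_def)
    qed
    finally have "y + s *\<^sub>R F y v \<in> ball y \<delta>" using s by (simp add: dist_norm)
    then show ?thesis using \<delta> s by simp
  qed
  then show "\<exists>\<delta>>0. \<forall>s. 0 \<le> s \<longrightarrow> s < \<delta> \<longrightarrow> V (y + s *\<^sub>R F y v) - V y \<le> s * (- \<alpha> (norm y) + \<epsilon>)"
    using \<eta> by blast
qed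

text \<open>\<open>E (V (x \<tau>)) + \<tau>\<close> is Lipschitz in \<tau>, so its derivative has
  to be bounded only off a null set, where the input bound holds and \<open>x\<close> has a right
  derivative. There the curve is compared with its tangent, along which \<open>V_forward\<close>
  applies, and \<open>a (V y) \<le> \<alpha> (norm y)\<close> makes the bound nonpositive.\<close>

lemma decay:
  assumes sol: "is_solution F x0 u {0..T} x"
    and N: "negligible N" "\<And>t. 0 \<le> t \<Longrightarrow> t \<notin> N \<Longrightarrow> norm (u t) \<le> U" and U: "0 \<le> U"
    and st: "0 \<le> s" "s \<le> t" "t \<le> T" and above: "\<And>\<tau>. s \<le> \<tau> \<Longrightarrow> \<tau> \<le> t \<Longrightarrow> \<gamma> U < V (x \<tau>)"
  shows "E (V (x t)) + t \<le> E (V (x s)) + s"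
proof (cases "s = t")
  case False
  have cx: "continuous_on {0..T} x" using sol by (simp add: is_solution_def)
  have sub: "{s..t} \<subseteq> {0..T}" using st by auto
  have \<gamma>U: "0 \<le> \<gamma> U" using classK_nonneg[OF \<gamma> U] .
  let ?X = "x ` {s..t}"
  have "compact ?X" using continuous_on_subset[OF cx sub] by (intro compact_continuous_image) auto
  moreover have "?X \<subseteq> UNIV - {0}" using above V_0 \<gamma>U by force
  ultimately obtain K where K: "K-lipschitz_on ?X V" using loc_lipschitz_on_compact[OF V_lip] by blast
  obtain M where M: "M-lipschitz_on {0..T} x" using solution_lipschitz[OF sol F_cont N] by blast
  have cw: "continuous_on {s..t} (\<lambda>\<tau>. V (x \<tau>))"
    by (rule continuous_on_compose2[OF V_cont continuous_on_subset[OF cx sub]]) auto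
  obtain p where p: "p \<in> {s..t}" "\<And>\<tau>. \<tau> \<in> {s..t} \<Longrightarrow> V (x p) \<le> V (x \<tau>)"
    using continuous_attains_inf[OF _ _ cw] st by auto
  obtain q where q: "q \<in> {s..t}" "\<And>\<tau>. \<tau> \<in> {s..t} \<Longrightarrow> V (x \<tau>) \<le> V (x q)"
    using continuous_attains_sup[OF _ _ cw] st by auto
  have p0: "0 < V (x p)" using above[of p] p \<gamma>U by auto
  obtain L where L: "L-lipschitz_on {V (x p)..V (x q)} E" using E_lipschitz[OF p0 q(2)[OF p(1)]] .
  define Q where "Q \<tau> = E (V (x \<tau>)) + \<tau>" for \<tau>
  \<comment> \<open>The interval is written as a ball of the real line to match
    \<open>increment_le_ae\<close>.\<close>
  define m r where "m = (s + t) / 2" and "r = (t - s) / 2"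
  have mr: "cball m r = {s..t}" "ball m r = {s<..<t}" unfolding cball_eq_atLeastAtMost ball_eq_greaterThanLessThan m_def r_def
    by (auto simp: field_simps)
  have nn: "0 \<le> K" "0 \<le> M" "0 \<le> L" using K M L lipschitz_on_nonneg by auto
  have Qlip: "(L * (K * M) + 1)-lipschitz_on (cball m r) Q"
  proof (rule lipschitz_onI)
    fix \<tau> \<tau>' assume "\<tau> \<in> cball m r" "\<tau>' \<in> cball m r"
    then have \<tau>: "\<tau> \<in> {s..t}" "\<tau>' \<in> {s..t}" by (auto simp: mr)
    have "dist (E (V (x \<tau>))) (E (V (x \<tau>'))) \<le> L * dist (V (x \<tau>)) (V (x \<tau>'))"
      using \<tau> p(2) q(2) by (intro lipschitz_onD[OF L]) auto
    also have "\<dots> \<le> L * (K * dist (x \<tau>) (x \<tau>'))"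
      using \<tau> nn by (intro mult_left_mono lipschitz_onD[OF K]) auto
    also have "\<dots> \<le> L * (K * (M * dist \<tau> \<tau>'))"
      using \<tau> nn sub by (intro mult_left_mono lipschitz_onD[OF M]) auto
    finally have "\<bar>E (V (x \<tau>)) - E (V (x \<tau>'))\<bar> \<le> L * (K * M) * \<bar>\<tau> - \<tau>'\<bar>" by (simp add: dist_real_def mult.assoc)
    then have "\<bar>E (V (x \<tau>)) - E (V (x \<tau>'))\<bar> + \<bar>\<tau> - \<tau>'\<bar> \<le> L * (K * M) * \<bar>\<tau> - \<tau>'\<bar> + \<bar>\<tau> - \<tau>'\<bar>" by simp
    moreover have "dist (Q \<tau>) (Q \<tau>') \<le> \<bar>E (V (x \<tau>)) - E (V (x \<tau>'))\<bar> + \<bar>\<tau> - \<tau>'\<bar>"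
      unfolding Q_def dist_real_def by linarith
    ultimately show "dist (Q \<tau>) (Q \<tau>') \<le> (L * (K * M) + 1) * dist \<tau> \<tau>'"
      by (simp add: dist_real_def distrib_right)
  qed (use nn in simp)
  define N' where "N' = N \<union> {\<tau> \<in> {0..<T}. \<not> ((\<lambda>k. (x (\<tau> + k) - x \<tau>) /\<^sub>R k) \<longlongrightarrow> F (x \<tau>) (u \<tau>)) (at_right 0)}"
  have N': "negligible N'" unfolding N'_def by (intro negligible_Un N(1) solution_ae_right_derivative[OF sol])
  have ptw: "D v \<le> 0" if \<tau>: "\<tau> \<in> ball m r" "\<tau> \<notin> N'" and D: "(Q has_derivative D) (at \<tau>)" and v: "0 \<le> v" for \<tau> D v
  proof -
    have \<tau>': "s < \<tau>" "\<tau> < t" "\<tau> \<in> {0..<T}" "0 \<le> \<tau>" using \<tau>(1) st by (auto simp: mr)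
    define y f where "y = x \<tau>" and "f = F (x \<tau>) (u \<tau>)"
    have xl: "((\<lambda>k. (x (\<tau> + k) - y) /\<^sub>R k) \<longlongrightarrow> f) (at_right 0)" using \<tau>(2) \<tau>'(3) by (auto simp: N'_def y_def f_def)
    have "norm (u \<tau>) \<le> U" using N(2)[OF \<tau>'(4)] \<tau>(2) by (auto simp: N'_def)
    then have "\<gamma> (norm (u \<tau>)) \<le> \<gamma> U" by (intro classK_mono[OF \<gamma>]) auto
    then have gy: "\<gamma> (norm (u \<tau>)) < V y" using above[of \<tau>] \<tau>' by (simp add: y_def)
    have w0: "0 < V y" using above[of \<tau>] \<tau>' \<gamma>U by (simp add: y_def)
    have av: "a (V y) \<le> \<alpha> (norm y)" "0 < a (V y)" using a_le[OF w0] a_pos[OF w0] by auto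
    have Dlim: "((\<lambda>k. (Q (\<tau> + k) - Q \<tau>) / k) \<longlongrightarrow> D 1) (at_right 0)"
      using has_derivative_directional[OF D, of 1] by (simp add: at_le tendsto_mono[rotated])
    \<comment> \<open>One \<epsilon> stems from \<open>V_forward\<close>, the other from replacing
      the curve by its tangent, an error of at most \<open>K' * (\<epsilon> / (K' + 1))\<close> per
      unit of time.\<close>
    have eps: "D 1 \<le> inverse (a (V y)) * (- \<alpha> (norm y) + 2 * \<epsilon>) + 1" if \<epsilon>: "0 < \<epsilon>" for \<epsilon>
    proof -
      let ?c = "- \<alpha> (norm y) + 2 * \<epsilon>"
      obtain \<delta> where \<delta>: "\<delta> > 0" "\<forall>k. 0 \<le> k \<longrightarrow> k < \<delta> \<longrightarrow> V (y + k *\<^sub>R f) - V y \<le> k * (- \<alpha> (norm y) + \<epsilon>)"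
        using V_forward(1)[OF gy \<epsilon>] unfolding y_def f_def by blast
      obtain K' r' where K': "0 < r'" "K'-lipschitz_on (cball y r') V" using V_forward(2)[OF gy \<epsilon>] by blast
      have K0: "0 \<le> K'" using K'(2) lipschitz_on_nonneg by blast
      have ek: "0 < \<epsilon> / (K' + 1)" using \<epsilon> K0 by simp
      have ev1: "eventually (\<lambda>k. dist ((x (\<tau> + k) - y) /\<^sub>R k) f < \<epsilon> / (K' + 1)) (at_right 0)" using tendstoD[OF xl ek] .
      have "((\<lambda>k. y + k *\<^sub>R f) \<longlongrightarrow> y + 0 *\<^sub>R f) (at_right 0)" by (intro tendsto_intros)
      then have ev2: "eventually (\<lambda>k. dist (y + k *\<^sub>R f) y < r') (at_right 0)" using tendstoD[OF _ K'(1)] by force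
      have kid: "((\<lambda>k. k) \<longlongrightarrow> 0) (at_right (0::real))" by (rule tendsto_ident_at)
      have "((\<lambda>k. k *\<^sub>R ((x (\<tau> + k) - y) /\<^sub>R k) + y) \<longlongrightarrow> 0 *\<^sub>R f + y) (at_right 0)"
        by (intro tendsto_intros xl kid)
      then have "eventually (\<lambda>k. dist (k *\<^sub>R ((x (\<tau> + k) - y) /\<^sub>R k) + y) (0 *\<^sub>R f + y) < r') (at_right 0)"
        using K'(1) by (rule tendstoD)
      then have ev3: "eventually (\<lambda>k. dist (x (\<tau> + k)) y < r') (at_right 0)"
        using eventually_at_right_less[of "0::real"] by eventually_elim simp
      have "((\<lambda>k. V y + k * ?c) \<longlongrightarrow> V y + 0 * ?c) (at_right 0)" by (intro tendsto_intros kid)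
      then have ev4: "eventually (\<lambda>k. 0 < V y + k * ?c) (at_right 0)" using w0 by (intro order_tendstoD) auto
      have ev5: "eventually (\<lambda>k. 0 < k \<and> k < min \<delta> (t - \<tau>)) (at_right 0)"
        unfolding eventually_at_right_field using \<delta>(1) \<tau>' by (intro exI[of _ "min \<delta> (t - \<tau>)"]) auto
      have up: "eventually (\<lambda>k. (Q (\<tau> + k) - Q \<tau>) / k \<le> (E (V y + k * ?c) - E (V y)) / k + 1) (at_right 0)"
        using ev1 ev2 ev3 ev4 ev5
      proof eventually_elim
        case (elim k)
        then have k: "0 < k" "k < \<delta>" "\<tau> + k < t" by auto
        have "dist (x (\<tau> + k)) (y + k *\<^sub>R f) = k * dist ((x (\<tau> + k) - y) /\<^sub>R k) f"
        proof -
          have "x (\<tau> + k) - (y + k *\<^sub>R f) = k *\<^sub>R ((x (\<tau> + k) - y) /\<^sub>R k - f)"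
            using k by (simp add: scaleR_diff_right)
          then show ?thesis using k by (simp add: dist_norm)
        qed
        also have "\<dots> \<le> k * (\<epsilon> / (K' + 1))" using elim(1) k by (intro mult_left_mono) auto
        finally have d: "dist (x (\<tau> + k)) (y + k *\<^sub>R f) \<le> k * (\<epsilon> / (K' + 1))" .
        have "dist (V (x (\<tau> + k))) (V (y + k *\<^sub>R f)) \<le> K' * dist (x (\<tau> + k)) (y + k *\<^sub>R f)"
          using elim(2,3) by (intro lipschitz_onD[OF K'(2)]) (auto simp: dist_commute less_imp_le)
        also have "\<dots> \<le> K' * (k * (\<epsilon> / (K' + 1)))" using d K0 by (rule mult_left_mono)
        also have "\<dots> = k * (K' * (\<epsilon> / (K' + 1)))" by simp
        also have "\<dots> \<le> k * \<epsilon>" using k K0 \<epsilon> by (intro mult_left_mono) (auto simp: field_simps)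
        finally have "V (x (\<tau> + k)) \<le> V (y + k *\<^sub>R f) + k * \<epsilon>" unfolding dist_real_def by linarith
        moreover have "V (y + k *\<^sub>R f) - V y \<le> k * (- \<alpha> (norm y) + \<epsilon>)" using \<delta>(2) k by simp
        ultimately have "V (x (\<tau> + k)) \<le> V y + k * ?c" by (simp add: algebra_simps)
        moreover have "0 < V (x (\<tau> + k))" using above[of "\<tau> + k"] \<tau>' k \<gamma>U by auto
        ultimately have "E (V (x (\<tau> + k))) \<le> E (V y + k * ?c)" by (intro E_mono)
        then have "Q (\<tau> + k) - Q \<tau> \<le> E (V y + k * ?c) - E (V y) + k" by (simp add: Q_def y_def)
        then have "(Q (\<tau> + k) - Q \<tau>) / k \<le> (E (V y + k * ?c) - E (V y) + k) / k" using k by (intro divide_right_mono) auto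
        then show ?case using k by (simp add: add_divide_distrib)
      qed
      have "((\<lambda>k. E (V y + k * ?c)) has_real_derivative inverse (a (V y)) * ?c) (at 0)"
        by (rule DERIV_chain2[of E "inverse (a (V y))"]) (use E[OF w0] in \<open>auto intro!: derivative_eq_intros\<close>)
      then have "((\<lambda>k. (E (V y + k * ?c) - E (V y)) / k) \<longlongrightarrow> inverse (a (V y)) * ?c) (at 0)"
        unfolding DERIV_def by simp
      then have "((\<lambda>k. (E (V y + k * ?c) - E (V y)) / k) \<longlongrightarrow> inverse (a (V y)) * ?c) (at_right 0)"
        by (rule tendsto_mono[rotated]) (simp add: at_le)
      then have "((\<lambda>k. (E (V y + k * ?c) - E (V y)) / k + 1) \<longlongrightarrow> inverse (a (V y)) * ?c + 1) (at_right 0)"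
        by (intro tendsto_intros)
      from tendsto_le[OF _ this Dlim up] show ?thesis by simp
    qed
    have "D 1 \<le> inverse (a (V y)) * (- \<alpha> (norm y)) + 1 + \<epsilon>" if "0 < \<epsilon>" for \<epsilon>
      using eps[of "a (V y) * \<epsilon> / 2"] av(2) that by (simp add: algebra_simps)
    then have "D 1 \<le> inverse (a (V y)) * (- \<alpha> (norm y)) + 1" by (rule field_le_epsilon)
    also have "\<dots> \<le> 0" using av by (simp add: field_simps)
    finally have "D 1 \<le> 0" .
    moreover have "D v = v * D 1"
      using linear_scale[OF has_derivative_linear[OF D], of v 1] by simp
    ultimately show ?thesis using v by (simp add: mult_nonneg_nonpos)
  qed
  \<comment> \<open>The increment estimate needs both times in the open interval; the endpoints
    follow by continuity of \<open>Q\<close>.\<close>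
  have inner: "Q t' \<le> Q s'" if "s < s'" "s' \<le> t'" "t' < t" for s' t'
  proof -
    have "Q (s' + (t' - s')) - Q s' \<le> 0"
    proof (rule increment_le_ae[OF Qlip N'])
      show "s' \<in> ball m r" "s' + (t' - s') \<in> ball m r" using that by (auto simp: mr)
      show "D (t' - s') \<le> 0" if "y \<in> ball m r" "y \<notin> N'" "(Q has_derivative D) (at y)" for y D
        using ptw[OF that] \<open>s' \<le> t'\<close> by simp
    qed
    then show ?thesis by simp
  qed
  have Qc: "continuous_on {s..t} Q" using lipschitz_on_continuous_on[OF Qlip] by (simp add: mr)
  have "s < t" using False st by simp
  have "(Q \<longlongrightarrow> Q s) (at_right s)" "(Q \<longlongrightarrow> Q t) (at_left t)"
    using Qc \<open>s < t\<close> by (auto simp: continuous_on_Icc_at_rightD continuous_on_Icc_at_leftD)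
  define c where "c = (s + t) / 2"
  have c: "s < c" "c < t" using \<open>s < t\<close> by (auto simp: c_def)
  have "Q c \<le> Q s"
    by (rule tendsto_lowerbound[OF \<open>(Q \<longlongrightarrow> Q s) (at_right s)\<close>])
      (auto simp: eventually_at_right_field intro!: exI[of _ c] inner c)
  moreover have "Q t \<le> Q c"
    by (rule tendsto_upperbound[OF \<open>(Q \<longlongrightarrow> Q t) (at_left t)\<close>])
      (auto simp: eventually_at_left_field intro!: exI[of _ c] inner c)
  ultimately show ?thesis by (simp add: Q_def)
qed simp

text \<open>If \<open>V\<close> stays above \<open>\<gamma> U\<close> up to \<open>t\<close>, then
  \<open>decay\<close> applies on all of \<open>{0..t}\<close>. Otherwise let \<open>s\<close> be
  the last time with value at most \<open>\<gamma> U\<close>: after \<open>s\<close> the value at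
  \<open>t\<close> is dominated by all earlier ones, hence by the one at \<open>s\<close>.\<close>

lemma solution_estimate:
  assumes sol: "is_solution F x0 u {0..T} x"
    and N: "negligible N" "\<And>t. 0 \<le> t \<Longrightarrow> t \<notin> N \<Longrightarrow> norm (u t) \<le> U" and U: "0 \<le> U"
    and t: "t \<in> {0..T}"
  shows "V (x t) \<le> max (sinv h (exp (- t) * h (V x0))) (\<gamma> U)"
proof (rule ccontr)
  assume "\<not> ?thesis"
  then have n: "sinv h (exp (- t) * h (V x0)) < V (x t)" "\<gamma> U < V (x t)" by auto
  have cx: "continuous_on {0..T} x" and x0: "x 0 = x0" using sol by (auto simp: is_solution_def)
  have cw: "continuous_on {0..T} (\<lambda>\<tau>. V (x \<tau>))" by (rule continuous_on_compose2[OF V_cont cx]) auto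
  have \<gamma>U: "0 \<le> \<gamma> U" using classK_nonneg[OF \<gamma> U] .
  have hV: "0 \<le> h (V y)" for y using classK_nonneg[OF classKinfD[OF h] V_nonneg] .
  show False
  proof (cases "\<exists>\<tau>\<in>{0..t}. V (x \<tau>) \<le> \<gamma> U")
    case False
    then have ab: "\<gamma> U < V (x \<tau>)" if "0 \<le> \<tau>" "\<tau> \<le> t" for \<tau> using that by (auto simp: not_le)
    have "E (V (x t)) + t \<le> E (V (x 0)) + 0" using t by (intro decay[OF sol N U _ _ _ ab]) auto
    then have "exp (E (V (x t))) \<le> exp (- t + E (V x0))" using x0 by simp
    moreover have "0 < V (x t)" "0 < V x0" using ab[of t] ab[of 0] \<gamma>U t x0 by auto
    ultimately have "h (V (x t)) \<le> exp (- t) * h (V x0)" by (simp add: h_def mult_exp_exp)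
    moreover have "exp (- t) * h (V x0) < h (V (x t))"
      using sinv_less_iff[OF h, of "exp (- t) * h (V x0)" "V (x t)"] n(1) hV V_nonneg by simp
    ultimately show False by simp
  next
    case True
    define S where "S = {\<tau> \<in> {0..t}. V (x \<tau>) \<le> \<gamma> U}"
    have cwt: "continuous_on {0..t} (\<lambda>\<tau>. V (x \<tau>))" using cw t by (auto intro: continuous_on_subset)
    have "S = {0..t} \<inter> (\<lambda>\<tau>. V (x \<tau>)) -` {..\<gamma> U}" by (auto simp: S_def)
    then have "closed S" using continuous_closed_preimage[OF cwt, of "{..\<gamma> U}"] by simp
    moreover have "bounded S" by (rule bounded_subset[of "{0..t}"]) (auto simp: S_def)
    ultimately have "compact S" by (simp add: compact_eq_bounded_closed)
    moreover have "S \<noteq> {}" using True by (auto simp: S_def)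
    ultimately obtain s where s: "s \<in> S" "\<forall>\<tau>\<in>S. \<tau> \<le> s" using compact_attains_sup[of S] by blast
    have st: "0 \<le> s" "s < t" "V (x s) \<le> \<gamma> U" using s(1) n(2) by (auto simp: S_def less_le)
    have ab: "\<gamma> U < V (x \<tau>)" if "s < \<tau>" "\<tau> \<le> t" for \<tau>
    proof (rule ccontr)
      assume "\<not> \<gamma> U < V (x \<tau>)"
      then have "\<tau> \<in> S" using that st by (auto simp: S_def)
      then show False using s(2) that by auto
    qed
    have ge: "V (x t) \<le> V (x s')" if s': "s < s'" "s' < t" for s'
    proof (rule ccontr)
      assume neg: "\<not> V (x t) \<le> V (x s')"
      have "E (V (x t)) + t \<le> E (V (x s')) + s'" using t st s' by (intro decay[OF sol N U]) (auto intro: ab)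
      moreover have "E (V (x s')) \<le> E (V (x t))" using neg ab[of s'] s' \<gamma>U by (intro E_mono) auto
      ultimately show False using s' by simp
    qed
    have "((\<lambda>\<tau>. V (x \<tau>)) \<longlongrightarrow> V (x s)) (at_right s)"
      using continuous_on_Icc_at_rightD[of s t "\<lambda>\<tau>. V (x \<tau>)"] continuous_on_subset[OF cwt, of "{s..t}"] st by auto
    then have "V (x t) \<le> V (x s)"
      by (rule tendsto_lowerbound) (use st ge in \<open>auto simp: eventually_at_right_field intro!: exI[of _ t]\<close>)
    then show False using st(3) n(2) by simp
  qed
qed

end

text \<open>Transfers a curve from the truncated system with a corrected input to the original
  system wherever the two fields agree along it almost everywhere.\<close>

lemma is_solution_cong_ae:
  assumes sol: "is_solution F x0 u I x" and N: "negligible N" and J: "J \<subseteq> I"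
    and eq: "\<And>s t. t \<in> J \<Longrightarrow> s \<in> {0..t} \<Longrightarrow> s \<notin> N \<Longrightarrow> G (x s) (v s) = F (x s) (u s)"
  shows "is_solution G x0 v J x"
  unfolding is_solution_def
proof (intro conjI ballI)
  show "continuous_on J x" "x 0 = x0" using sol J by (auto simp: is_solution_def intro: continuous_on_subset)
  fix t assume t: "t \<in> J"
  then have *: "(\<lambda>s. F (x s) (u s)) absolutely_integrable_on {0..t}" "x t = x0 + integral {0..t} (\<lambda>s. F (x s) (u s))"
    using sol J by (auto simp: is_solution_def)
  show "(\<lambda>s. G (x s) (v s)) absolutely_integrable_on {0..t}"
    by (rule absolutely_integrable_spike[OF *(1) N]) (use eq[OF t] in auto)
  have "integral {0..t} (\<lambda>s. F (x s) (u s)) = integral {0..t} (\<lambda>s. G (x s) (v s))"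
    by (rule integral_spike[OF N]) (use eq[OF t] in auto)
  then show "x t = x0 + integral {0..t} (\<lambda>s. G (x s) (v s))" using *(2) by simp
qed

text \<open>Picard iteration on the whole half-line at once, with an exponential weight in place of
  a subdivision of time. The iterates converge pointwise, and the uniform bound \<open>M\<close>
  lets dominated convergence pass to the limit in the integral equation.\<close>

lemma lipschitz_solution_exists:
  fixes F :: "'a::euclidean_space \<Rightarrow> 'b::euclidean_space \<Rightarrow> 'a"
  assumes Fc: "continuous_on UNIV (\<lambda>(x, u). F x u)"
    and lip: "\<And>v y z. norm v \<le> U \<Longrightarrow> norm (F y v - F z v) \<le> L * norm (y - z)" and L: "1 \<le> L"
    and bound: "\<And>v y. norm v \<le> U \<Longrightarrow> norm (F y v) \<le> M"
    and u: "u \<in> borel_measurable lebesgue" "\<And>t. norm (u t) \<le> U"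
  shows "\<exists>x. is_solution F x0 u {0..} x"
proof -
  have M: "0 \<le> M" using bound[OF u(2), of 0] norm_ge_zero order_trans by blast
  let ?L = "lebesgue_on {0::real..}"
  have Fm: "(\<lambda>s. F (Y s) (u s)) \<in> borel_measurable ?L" if "Y \<in> borel_measurable ?L" for Y
  proof -
    have um: "u \<in> borel_measurable ?L" using u(1) by (rule measurable_restrict_space1)
    have "continuous_on UNIV (\<lambda>p. F (fst p) (snd p))" using Fc by (simp add: case_prod_beta')
    from borel_measurable_continuous_Pair[OF that um this] show ?thesis .
  qed
  have Fi: "(\<lambda>s. F (Y s) (u s)) absolutely_integrable_on {a..t}" if Y: "Y \<in> borel_measurable ?L" and a: "0 \<le> a" for Y a t
  proof (rule measurable_bounded_by_integrable_imp_absolutely_integrable[of _ _ "\<lambda>_. M"])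
    show "(\<lambda>s. F (Y s) (u s)) \<in> borel_measurable (lebesgue_on {a..t})"
      by (rule measurable_restrict_mono[OF Fm[OF Y]]) (use a in auto)
    show "norm (F (Y s) (u s)) \<le> M" for s by (rule bound[OF u(2)])
  qed auto
  have Fi': "(\<lambda>s. F (Y s) (u s)) integrable_on {a..t}" if "Y \<in> borel_measurable ?L" "0 \<le> a" for Y a t
    using Fi[OF that] by (simp add: absolutely_integrable_on_def)
  have cont: "continuous_on {0..} (\<lambda>t. x0 + integral {0..t} (\<lambda>s. F (Y s) (u s)))"
    if Y: "Y \<in> borel_measurable ?L" for Y
  proof -
    let ?I = "\<lambda>t. x0 + integral {0..t} (\<lambda>s. F (Y s) (u s))"
    have *: "norm (?I t - ?I s) \<le> M * (t - s)" if st: "0 \<le> s" "s \<le> t" for s t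
    proof -
      have "integral {0..s} (\<lambda>s. F (Y s) (u s)) + integral {s..t} (\<lambda>s. F (Y s) (u s)) = integral {0..t} (\<lambda>s. F (Y s) (u s))"
        using st Fi'[OF Y] by (intro Henstock_Kurzweil_Integration.integral_combine) auto
      then have "?I t - ?I s = integral {s..t} (\<lambda>s. F (Y s) (u s))" by (simp add: algebra_simps)
      moreover have "norm (integral {s..t} (\<lambda>s. F (Y s) (u s))) \<le> M * (t - s)"
        by (rule integral_norm_le_ae[OF Fi'[OF Y st(1)] st(2) negligible_empty M bound[OF u(2)]])
      ultimately show ?thesis by simp
    qed
    have "M-lipschitz_on {0..} ?I"
    proof (rule lipschitz_onI[OF _ M])
      fix s t :: real assume "s \<in> {0..}" "t \<in> {0..}"
      then show "dist (?I s) (?I t) \<le> M * dist s t"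
        using *[of s t] *[of t s] by (cases "s \<le> t") (auto simp: dist_norm norm_minus_commute)
    qed
    then show ?thesis by (rule lipschitz_on_continuous_on)
  qed
  have cm: "Y \<in> borel_measurable ?L" if "continuous_on {0..} Y" for Y :: "real \<Rightarrow> 'a"
    using that by (rule continuous_imp_measurable_on_sets_lebesgue) auto
  define X where "X k = ((\<lambda>Y t. x0 + integral {0..t} (\<lambda>s. F (Y s) (u s))) ^^ k) (\<lambda>_. x0)" for k :: nat
  have X0: "X 0 t = x0" and XS: "X (Suc k) t = x0 + integral {0..t} (\<lambda>s. F (X k s) (u s))" for k t
    by (simp_all add: X_def)
  have Xc: "continuous_on {0..} (X k)" for k
  proof (induction k)
    case (Suc k)
    then show ?case using cont[OF cm] by (simp add: XS[abs_def])
  qed (simp add: X_def)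
  have Xm: "X k \<in> borel_measurable ?L" for k using Xc by (rule cm)
  \<comment> \<open>Integrating \<open>L\<close> times the weight \<open>exp (2 * L * s)\<close>
    gains the factor \<open>1/2\<close> per iteration; \<open>1 \<le> L\<close> fits the first
    difference, at most \<open>M * t\<close>, under the weight.\<close>
  have diff: "norm (X (Suc k) t - X k t) \<le> M * (1/2) ^ k * exp (2 * L * t)" if "0 \<le> t" for k t
    using that
  proof (induction k arbitrary: t)
    case 0
    have "norm (integral {0..t} (\<lambda>s. F (X 0 s) (u s))) \<le> M * (t - 0)"
      by (rule integral_norm_le_ae[OF Fi'[OF Xm order_refl] 0 negligible_empty M bound[OF u(2)]])
    also have "\<dots> \<le> M * exp (2 * L * t)"
    proof (intro mult_left_mono M)
      have "t \<le> 2 * L * t" using 0 L mult_right_mono[of 1 "2 * L" t] by simp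
      also have "\<dots> \<le> exp (2 * L * t)" using exp_ge_add_one_self[of "2 * L * t"] by linarith
      finally show "t - 0 \<le> exp (2 * L * t)" by simp
    qed
    finally show ?case by (simp add: XS X0)
  next
    case (Suc k)
    let ?C = "M * (1/2) ^ k"
    have "X (Suc (Suc k)) t - X (Suc k) t = integral {0..t} (\<lambda>s. F (X (Suc k) s) (u s)) - integral {0..t} (\<lambda>s. F (X k s) (u s))"
      by (simp add: XS[of "Suc k"] XS[of k])
    also have "\<dots> = integral {0..t} (\<lambda>s. F (X (Suc k) s) (u s) - F (X k s) (u s))"
      by (rule Henstock_Kurzweil_Integration.integral_diff[symmetric]) (intro Fi' Xm order_refl)+
    finally have e: "X (Suc (Suc k)) t - X (Suc k) t = integral {0..t} (\<lambda>s. F (X (Suc k) s) (u s) - F (X k s) (u s))" .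
    have hi: "((\<lambda>s. L * (?C * exp (2 * L * s))) has_integral ?C * exp (2 * L * t) / 2 - ?C * exp (2 * L * 0) / 2) {0..t}"
      by (rule fundamental_theorem_of_calculus[OF Suc.prems])
        (auto intro!: derivative_eq_intros simp: has_real_derivative_iff_has_vector_derivative[symmetric])
    have "norm (integral {0..t} (\<lambda>s. F (X (Suc k) s) (u s) - F (X k s) (u s))) \<le> integral {0..t} (\<lambda>s. L * (?C * exp (2 * L * s)))"
    proof (rule integral_norm_bound_integral)
      show "(\<lambda>s. F (X (Suc k) s) (u s) - F (X k s) (u s)) integrable_on {0..t}"
        by (intro Henstock_Kurzweil_Integration.integrable_diff Fi' Xm order_refl)
      show "(\<lambda>s. L * (?C * exp (2 * L * s))) integrable_on {0..t}" using hi by (rule has_integral_integrable)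
      fix s assume "s \<in> {0..t}"
      then have "norm (X (Suc k) s - X k s) \<le> ?C * exp (2 * L * s)" by (intro Suc.IH) auto
      then have "L * norm (X (Suc k) s - X k s) \<le> L * (?C * exp (2 * L * s))" using L by (intro mult_left_mono) auto
      then show "norm (F (X (Suc k) s) (u s) - F (X k s) (u s)) \<le> L * (?C * exp (2 * L * s))"
        using lip[OF u(2)[of s], of "X (Suc k) s" "X k s"] by linarith
    qed
    also have "\<dots> = ?C * exp (2 * L * t) / 2 - ?C * exp (2 * L * 0) / 2" using hi by (rule integral_unique)
    also have "\<dots> \<le> M * (1/2) ^ Suc k * exp (2 * L * t)" using M by simp
    finally show ?case by (simp add: e)
  qed
  have "convergent (\<lambda>k. X k t)" if t: "0 \<le> t" for t
  proof -
    have "summable (\<lambda>k. M * (1/2) ^ k * exp (2 * L * t))"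
      by (intro summable_mult summable_mult2 summable_geometric) auto
    then have "summable (\<lambda>k. X (Suc k) t - X k t)"
      by (rule summable_comparison_test'[of _ 0]) (use diff[OF t] in auto)
    then have "convergent (\<lambda>k. \<Sum>j<k. X (Suc j) t - X j t)" by (simp add: summable_iff_convergent)
    then have "convergent (\<lambda>k. X k t - X 0 t)" by (simp only: sum_lessThan_telescope[of "\<lambda>j. X j t"])
    then have "convergent (\<lambda>k. (X k t - X 0 t) + X 0 t)" by (intro convergent_add convergent_const)
    then show ?thesis by simp
  qed
  then have lim: "(\<lambda>k. X k t) \<longlonglongrightarrow> lim (\<lambda>k. X k t)" if "0 \<le> t" for t
    using that by (simp add: convergent_LIMSEQ_iff)
  define x where "x t = lim (\<lambda>k. X k t)" for t
  have xm: "x \<in> borel_measurable ?L"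
    by (rule borel_measurable_LIMSEQ_metric[of X]) (use Xm lim in \<open>auto simp: x_def\<close>)
  have xeq: "x t = x0 + integral {0..t} (\<lambda>s. F (x s) (u s))" if t: "0 \<le> t" for t
  proof (rule LIMSEQ_unique)
    show "(\<lambda>k. X (Suc k) t) \<longlonglongrightarrow> x t" unfolding x_def using lim[OF t] by (rule LIMSEQ_Suc)
    have "(\<lambda>k. integral {0..t} (\<lambda>s. F (X k s) (u s))) \<longlonglongrightarrow> integral {0..t} (\<lambda>s. F (x s) (u s))"
    proof (rule dominated_convergence(2)[of _ _ "\<lambda>_. M"])
      show "(\<lambda>s. F (X k s) (u s)) integrable_on {0..t}" for k by (intro Fi' Xm order_refl)
      show "norm (F (X k s) (u s)) \<le> M" for k s by (rule bound[OF u(2)])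
      show "(\<lambda>k. F (X k s) (u s)) \<longlonglongrightarrow> F (x s) (u s)" if "s \<in> {0..t}" for s
      proof -
        have "(\<lambda>k. (X k s, u s)) \<longlonglongrightarrow> (x s, u s)" unfolding x_def using lim[of s] that by (intro tendsto_intros) auto
        from continuous_on_tendsto_compose[OF Fc this] show ?thesis by simp
      qed
    qed auto
    then show "(\<lambda>k. X (Suc k) t) \<longlonglongrightarrow> x0 + integral {0..t} (\<lambda>s. F (x s) (u s))"
      unfolding XS by (intro tendsto_intros)
  qed
  have "is_solution F x0 u {0..} x"
    unfolding is_solution_def
  proof (intro conjI ballI)
    show "continuous_on {0..} x" by (rule continuous_on_eq[OF cont[OF xm]]) (use xeq in auto)
    show "x 0 = x0" using xeq[of 0] by simp
    fix t :: real assume t: "t \<in> {0..}"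
    show "(\<lambda>s. F (x s) (u s)) absolutely_integrable_on {0..t}" by (rule Fi[OF xm order_refl])
    show "x t = x0 + integral {0..t} (\<lambda>s. F (x s) (u s))" using xeq t by simp
  qed
  then show ?thesis by blast
qed

text \<open>The estimate is established first, for every solution on a finite interval whether or
  not it extends; existence for all times is then deduced from it.\<close>

theorem ISS_lyapunov_imp_ISS:
  fixes F :: "'a::euclidean_space \<Rightarrow> 'b::euclidean_space \<Rightarrow> 'a"
  assumes Fc: "continuous_on UNIV (\<lambda>(x, u). F x u)"
    and Flip: "\<And>r x. \<exists>\<delta>>0. \<exists>L. \<forall>v. norm v \<le> r \<longrightarrow> L-lipschitz_on (cball x \<delta>) (\<lambda>y. F y v)"
    and lyap: "ISS_lyapunov F V"
  shows "ISS F"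
proof -
  from lyap obtain \<psi>1 \<psi>2 \<gamma> \<alpha> where V: "continuous_on UNIV V" "loc_lipschitz_on (UNIV - {0}) V"
    and \<psi>: "classKinf \<psi>1" "classKinf \<psi>2" and sw: "\<And>x. \<psi>1 (norm x) \<le> V x" "\<And>x. V x \<le> \<psi>2 (norm x)"
    and \<gamma>: "classK \<gamma>" and \<alpha>: "posdef \<alpha>"
    and dec: "\<And>x u D. (V has_derivative D) (at x) \<Longrightarrow> \<gamma> (norm u) \<le> V x \<Longrightarrow> D (F x u) \<le> - \<alpha> (norm x)"
    unfolding ISS_lyapunov_def proper_posdef_def by auto
  note \<psi>K = classKinfD[OF \<psi>(1)] classKinfD[OF \<psi>(2)]
  have Vnn: "0 \<le> V y" for y using sw(1)[of y] classK_nonneg[OF \<psi>K(1), of "norm y"] by simp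
  have V0: "V 0 = 0" using sw[of 0] by (simp add: classK_0[OF \<psi>K(1)] classK_0[OF \<psi>K(2)])
  \<comment> \<open>For \<open>V y\<close> in a compact interval of positive values,
    \<open>norm y\<close> lies in a compact interval away from \<open>0\<close>, where \<alpha> has
    a positive minimum. This is the local uniformity that \<open>posdef_below\<close> asks
    for.\<close>
  have "\<exists>a. posdef a \<and> (\<forall>r>0. \<forall>y. V y = r \<longrightarrow> a r \<le> \<alpha> (norm y)) \<and> (\<forall>r\<ge>0. a r \<le> r)"
  proof (rule posdef_below[of "\<lambda>r c. \<forall>y. V y = r \<longrightarrow> c \<le> \<alpha> (norm y)"])
    fix p q :: real assume pq: "0 < p" "p \<le> q"
    define c d where "c = sinv \<psi>2 p" and "d = sinv \<psi>1 q"
    have c0: "0 < c" unfolding c_def using classK_pos[OF classKinfD[OF classKinf_sinv[OF \<psi>(2)]] pq(1)] .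
    have in_cd: "norm y \<in> {c..d}" if "V y \<in> {p..q}" for y
    proof -
      have "p \<le> \<psi>2 (norm y)" "\<psi>1 (norm y) \<le> q" using sw[of y] that by auto
      then have "c \<le> norm y" using sinv_le_iff[OF \<psi>(2), of p "norm y"] pq by (simp add: c_def)
      moreover have "\<psi>1 (norm y) \<le> \<psi>1 d" using \<open>\<psi>1 (norm y) \<le> q\<close> pq by (simp add: d_def apply_sinv[OF \<psi>(1)])
      then have "norm y \<le> d" using classK_le_iff[OF \<psi>K(1), of "norm y" d] sinv_nonneg[OF \<psi>(1), of q] pq by (simp add: d_def)
      ultimately show ?thesis by simp
    qed
    show "\<exists>m>0. \<forall>r\<in>{p..q}. \<forall>y. V y = r \<longrightarrow> m \<le> \<alpha> (norm y)"
    proof (cases "c \<le> d")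
      case True
      have "continuous_on {c..d} \<alpha>" using \<alpha> c0 unfolding posdef_def by (auto intro: continuous_on_subset)
      then obtain m where m: "m \<in> {c..d}" "\<And>r. r \<in> {c..d} \<Longrightarrow> \<alpha> m \<le> \<alpha> r"
        using continuous_attains_inf[of "{c..d}" \<alpha>] True by auto
      have "0 \<le> m" "m \<noteq> 0" using m(1) c0 by auto
      then have "0 < \<alpha> m" using \<alpha> unfolding posdef_def by (metis less_eq_real_def)
      then show ?thesis using m(2) in_cd by (intro exI[of _ "\<alpha> m"]) auto
    next
      case False
      then have "V y \<notin> {p..q}" for y using in_cd[of y] by auto
      then show ?thesis by (intro exI[of _ 1]) auto
    qed
  next
    fix a assume "posdef a" "\<And>r. 0 < r \<Longrightarrow> \<forall>y. V y = r \<longrightarrow> a r \<le> \<alpha> (norm y)" "\<And>r. 0 \<le> r \<Longrightarrow> a r \<le> r"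
    then show "\<exists>a. posdef a \<and> (\<forall>r>0. \<forall>y. V y = r \<longrightarrow> a r \<le> \<alpha> (norm y)) \<and> (\<forall>r\<ge>0. a r \<le> r)" by blast
  qed auto
  then obtain a where a: "posdef a" "\<And>y. 0 < V y \<Longrightarrow> a (V y) \<le> \<alpha> (norm y)" "\<And>r. 0 \<le> r \<Longrightarrow> a r \<le> r" by blast
  obtain E where E: "\<And>r. 0 < r \<Longrightarrow> (E has_real_derivative inverse (a r)) (at r)"
    and hE: "classKinf (\<lambda>r. if 0 < r then exp (E r) else 0)"
    using ex_exponential_gauge[OF a(1) a(3)] by blast
  define h where "h = (\<lambda>r. if 0 < r then exp (E r) else 0)"
  have hinf: "classKinf h" using hE by (simp add: h_def)
  interpret lyapunov_data F V \<gamma> \<alpha> a E h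
    by unfold_locales (use Fc V V0 Vnn \<gamma> \<alpha> dec a E hinf in \<open>auto simp: h_def\<close>)
  define \<beta> where "\<beta> s t = sinv \<psi>1 (sinv h (exp (- t) * h (\<psi>2 s)))" for s t
  define g where "g r = sinv \<psi>1 (\<gamma> r)" for r
  note i1 = classKinfD[OF classKinf_sinv[OF \<psi>(1)]] and ih = classKinfD[OF classKinf_sinv[OF hinf]]
    and hK = classKinfD[OF hinf]
  have \<beta>: "classKL \<beta>"
    using classKL_exp_decay[OF classKinf_compose[OF classKinf_sinv[OF \<psi>(1)] classKinf_sinv[OF hinf]]
        classKinf_compose[OF hinf \<psi>(2)]] by (simp add: \<beta>_def[abs_def])
  have g: "classK g" unfolding g_def using i1 \<gamma> by (rule classK_compose)
  have est: "norm (x t) \<le> \<beta> (norm x0) t + g (linf_norm u)"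
    if u: "admissible_input u" and sol: "is_solution F x0 u {0..T} x" and t: "t \<in> {0..T}" for x0 u x T t
  proof -
    let ?U = "linf_norm u"
    let ?A = "sinv h (exp (- t) * h (V x0))"
    have U: "0 \<le> ?U" using ae_bound_linf_norm(1)[OF u] .
    have hv: "0 \<le> exp (- t) * h (V x0)" using classK_nonneg[OF hK Vnn] by simp
    have A0: "0 \<le> ?A" using classK_nonneg[OF ih hv] .
    have B0: "0 \<le> \<gamma> ?U" using classK_nonneg[OF \<gamma> U] .
    have "\<psi>1 (norm (x t)) \<le> V (x t)" by (rule sw(1))
    also have "V (x t) \<le> max ?A (\<gamma> ?U)"
      by (rule solution_estimate[OF sol ae_bound_linf_norm(2)[OF u] _ U t]) auto
    finally have "sinv \<psi>1 (\<psi>1 (norm (x t))) \<le> sinv \<psi>1 (max ?A (\<gamma> ?U))"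
      by (intro classK_mono[OF i1] classK_nonneg[OF \<psi>K(1)]) auto
    then have "norm (x t) \<le> sinv \<psi>1 (max ?A (\<gamma> ?U))" by (simp add: sinv_apply[OF \<psi>K(1)])
    also have "\<dots> \<le> sinv \<psi>1 ?A + sinv \<psi>1 (\<gamma> ?U)"
      using classK_nonneg[OF i1 A0] classK_nonneg[OF i1 B0] by (auto simp: max_def)
    also have "sinv \<psi>1 ?A \<le> \<beta> (norm x0) t"
    proof -
      have "h (V x0) \<le> h (\<psi>2 (norm x0))" by (rule classK_mono[OF hK Vnn sw(2)])
      then have "exp (- t) * h (V x0) \<le> exp (- t) * h (\<psi>2 (norm x0))" by simp
      then have "?A \<le> sinv h (exp (- t) * h (\<psi>2 (norm x0)))" by (rule classK_mono[OF ih hv])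
      then show ?thesis unfolding \<beta>_def by (rule classK_mono[OF i1 A0])
    qed
    finally show ?thesis by (simp add: g_def)
  qed
  have ex: "\<exists>x. is_solution F x0 u {0..} x" if u: "admissible_input u" for x0 u
  proof -
    let ?U = "linf_norm u"
    define N where "N = {t \<in> {0..}. \<not> norm (u t) \<le> ?U}"
    have U: "0 \<le> ?U" and N: "negligible N" using ae_bound_linf_norm[OF u] by (auto simp: N_def)
    \<comment> \<open>The input is set to zero at negative times and, in \<open>v\<close>, on the
      null set where it exceeds its essential bound, so that it becomes bounded everywhere.\<close>
    define w where "w t = indicator {0..} t *\<^sub>R u t" for t :: real
    have wm: "w \<in> borel_measurable lebesgue"
      using u by (simp add: admissible_input_def set_borel_measurable_def w_def[abs_def])
    define v where "v t = (if norm (w t) \<le> ?U then w t else 0)" for t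
    have vm: "v \<in> borel_measurable lebesgue" unfolding v_def using wm by measurable
    have vU: "norm (v t) \<le> ?U" for t using U by (simp add: v_def)
    have vu: "v t = u t" if "0 \<le> t" "t \<notin> N" for t using that by (auto simp: v_def w_def N_def)
    \<comment> \<open>Chosen strictly above the initial norm and above the estimate at time
      \<open>0\<close>, which dominates it at all later times.\<close>
    define R where "R = \<beta> (norm x0) 0 + g ?U + norm x0 + 1"
    have b0: "0 \<le> \<beta> (norm x0) 0" and g0: "0 \<le> g ?U"
      using \<beta> classK_nonneg[of "\<lambda>s. \<beta> s 0" "norm x0"] classK_nonneg[OF g U] by (auto simp: classKL_def)
    have R: "0 < R" "norm x0 < R" "\<beta> (norm x0) 0 + g ?U < R"
      using b0 g0 norm_ge_zero[of x0] by (auto simp: R_def simp del: norm_ge_zero)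
    let ?c = "closest_point (cball (0::'a) R)"
    have ne: "cball (0::'a) R \<noteq> {}" using R by simp
    have cin: "?c y \<in> cball 0 R" for y using closest_point_in_set[OF closed_cball ne] .
    have cl: "norm (?c y - ?c z) \<le> norm (y - z)" for y z
      using closest_point_lipschitz[OF convex_cball closed_cball ne, of y z] by (simp add: dist_norm)
    have cself: "?c y = y" if "norm y \<le> R" for y using that by (intro closest_point_self) auto
    have cc: "continuous_on S ?c" for S using continuous_on_closest_point[OF convex_cball closed_cball ne] .
    have ll: "local_lipschitz (cball 0 ?U) (cball 0 R) (\<lambda>v y. F y v)"
    proof (rule local_lipschitzI)
      fix v y
      obtain \<delta> L where \<delta>: "\<delta> > 0" "\<forall>v. norm v \<le> ?U \<longrightarrow> L-lipschitz_on (cball y \<delta>) (\<lambda>y. F y v)" using Flip by blast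
      show "\<exists>d>0. \<exists>L. \<forall>t\<in>cball v d \<inter> cball 0 ?U. L-lipschitz_on (cball y d \<inter> cball 0 R) (\<lambda>y. F y t)"
        using \<delta> by (intro exI[of _ \<delta>] conjI exI[of _ L]) (auto intro: lipschitz_on_subset)
    qed
    have Fv: "continuous_on S (\<lambda>v. F y v)" for S y
    proof -
      have "continuous_on S (\<lambda>v. (\<lambda>(x, u). F x u) (y, v))"
        by (rule continuous_on_compose2[OF Fc]) (auto intro!: continuous_intros)
      then show ?thesis by simp
    qed
    obtain L where L: "\<And>v. v \<in> cball 0 ?U \<Longrightarrow> L-lipschitz_on (cball 0 R) (\<lambda>y. F y v)"
      using local_lipschitz_compact_implies_lipschitz[OF ll compact_cball compact_cball Fv] by blast
    have "bounded ((\<lambda>(x, u). F x u) ` (cball 0 R \<times> cball 0 ?U))"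
      by (intro compact_imp_bounded compact_continuous_image compact_Times continuous_on_subset[OF Fc] compact_cball) auto
    then obtain M where M: "\<forall>y\<in>(\<lambda>(x, u). F x u) ` (cball 0 R \<times> cball 0 ?U). norm y \<le> M" unfolding bounded_iff by blast
    have "\<exists>x. is_solution (\<lambda>y v. F (?c y) v) x0 v {0..} x"
    proof (rule lipschitz_solution_exists[where U="?U" and L="max L 1" and M=M])
      have "continuous_on UNIV (\<lambda>p. (\<lambda>(x, u). F x u) (?c (fst p), snd p :: 'b))"
        by (rule continuous_on_compose2[OF Fc]) (auto intro!: continuous_intros continuous_on_compose2[OF cc[of UNIV]])
      then show "continuous_on UNIV (\<lambda>(y, v). F (?c y) v)" by (simp add: case_prod_beta')
      show "norm (F (?c y) q - F (?c z) q) \<le> max L 1 * norm (y - z)" if q: "norm q \<le> ?U" for q y z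
      proof -
        have "norm (F (?c y) q - F (?c z) q) \<le> L * norm (?c y - ?c z)"
          using lipschitz_onD[OF L cin cin, of q y z] q by (simp add: dist_norm)
        also have "\<dots> \<le> max L 1 * norm (y - z)" using cl[of y z] by (intro mult_mono) auto
        finally show ?thesis .
      qed
      show "norm (F (?c y) q) \<le> M" if "norm q \<le> ?U" for q y
      proof -
        have "(?c y, q) \<in> cball 0 R \<times> cball 0 ?U" using cin that by auto
        from imageI[OF this, of "\<lambda>(x, u). F x u"] M show ?thesis by auto
      qed
    qed (use vm vU in auto)
    then obtain x where x: "is_solution (\<lambda>y v. F (?c y) v) x0 v {0..} x" by blast
    have xc: "continuous_on {0..} x" and x_0: "x 0 = x0" using x by (auto simp: is_solution_def)
    have small: "norm (x t) < R" if t: "0 \<le> t" for t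
    proof (rule ccontr)
      assume nt: "\<not> norm (x t) < R"
      \<comment> \<open>Its minimum is the first time the norm reaches \<open>R\<close>. Until then
        the truncation is inactive, so the curve solves the original system and obeys the estimate,
        which contradicts reaching \<open>R\<close>; the instant \<open>s\<close> itself is put into
        the null set.\<close>
      define S where "S = {s \<in> {0..t}. R \<le> norm (x s)}"
      have nc: "continuous_on {0..t} (\<lambda>s. norm (x s))" by (intro continuous_on_norm continuous_on_subset[OF xc]) auto
      have "S = {0..t} \<inter> (\<lambda>s. norm (x s)) -` {R..}" by (auto simp: S_def)
      then have "closed S" using continuous_closed_preimage[OF nc, of "{R..}"] by simp
      moreover have "bounded S" by (rule bounded_subset[of "{0..t}"]) (auto simp: S_def)
      ultimately have "compact S" by (simp add: compact_eq_bounded_closed)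
      moreover have "S \<noteq> {}" using nt t by (auto simp: S_def)
      ultimately obtain s where s: "s \<in> S" "\<forall>\<tau>\<in>S. s \<le> \<tau>" using compact_attains_inf[of S] by blast
      have sR: "0 \<le> s" "s \<le> t" "R \<le> norm (x s)" using s(1) by (auto simp: S_def)
      have before: "norm (x \<tau>) < R" if "0 \<le> \<tau>" "\<tau> < s" for \<tau>
      proof (rule ccontr)
        assume "\<not> norm (x \<tau>) < R"
        then have "\<tau> \<in> S" using that sR by (auto simp: S_def)
        then show False using s(2) that by auto
      qed
      have sols: "is_solution F x0 u {0..s} x"
      proof (rule is_solution_cong_ae[OF x, of "insert s N"])
        show "negligible (insert s N)" using N by simp
        show "F (x \<tau>) (u \<tau>) = F (?c (x \<tau>)) (v \<tau>)" if "q \<in> {0..s}" "\<tau> \<in> {0..q}" "\<tau> \<notin> insert s N" for \<tau> q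
          using that before[of \<tau>] vu[of \<tau>] cself[of "x \<tau>"] by auto
      qed auto
      have "norm (x s) \<le> \<beta> (norm x0) s + g ?U" by (rule est[OF u sols]) (use sR in auto)
      also have "\<beta> (norm x0) s \<le> \<beta> (norm x0) 0" using \<beta> sR(1) norm_ge_zero[of x0] unfolding classKL_def by blast
      finally show False using R(3) sR(3) by linarith
    qed
    have "is_solution F x0 u {0..} x"
    proof (rule is_solution_cong_ae[OF x N order_refl])
      show "F (x s) (u s) = F (?c (x s)) (v s)" if "s \<in> {0..t}" "s \<notin> N" for s t
        using that small[of s] vu[of s] cself[of "x s"] by auto
    qed
    then show ?thesis by blast
  qed
  show ?thesis unfolding ISS_def using \<beta> g ex est by (intro exI[of _ \<beta>] exI[of _ g]) blast
qed

section \<open>The composite Lyapunov function\<close>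

lemma inner_proj:
  assumes "A \<subseteq> Basis" "b \<in> Basis" shows "proj A x \<bullet> b = (if b \<in> A then x \<bullet> b else 0)"
proof -
  have fin: "finite A" using assms(1) finite_subset finite_Basis by blast
  have "proj A x \<bullet> b = (\<Sum>c\<in>A. (x \<bullet> c) * (c \<bullet> b))" by (simp add: proj_def inner_sum_left)
  also have "\<dots> = (\<Sum>c\<in>A. if c = b then x \<bullet> c else 0)"
    using assms by (intro sum.cong) (auto simp: inner_Basis)
  finally show ?thesis using fin by (simp add: sum.delta')
qed

lemma linear_proj: "linear (proj A)"
  by (rule linearI) (auto simp: proj_def inner_add_left scaleR_left_distrib sum.distrib scaleR_sum_right)

lemma norm_proj_le: "A \<subseteq> Basis \<Longrightarrow> norm (proj A x) \<le> norm x"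
  by (rule norm_le_componentwise) (auto simp: inner_proj)

lemma dist_proj_le: "A \<subseteq> Basis \<Longrightarrow> dist (proj A x) (proj A y) \<le> dist x y"
  using norm_proj_le[of A "x - y"] by (simp add: dist_norm linear_diff[OF linear_proj])

lemma proj_in_span: "proj A x \<in> span A"
  unfolding proj_def by (intro span_sum span_scale span_base) auto

lemma proj_span_disjoint:
  fixes y :: "'a::euclidean_space"
  assumes "A \<subseteq> Basis" "A' \<subseteq> Basis" "A \<inter> A' = {}" "y \<in> span A'" shows "proj A y = 0"
proof (rule linear_eq_on_span[OF linear_proj linear_zero _ assms(4)])
  fix c assume c: "c \<in> A'"
  then have cB: "c \<in> Basis" using assms(2) by auto
  show "proj A c = 0"
  proof (rule euclidean_eqI)
    fix b :: 'a assume "b \<in> Basis"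
    then show "proj A c \<bullet> b = 0 \<bullet> b" using inner_proj[OF assms(1), of b c] c cB assms(3) by (auto simp: inner_Basis)
  qed
qed

lemma proj_span_id:
  fixes y :: "'a::euclidean_space"
  assumes "A \<subseteq> Basis" "y \<in> span A" shows "proj A y = y"
proof (rule linear_eq_on_span[OF linear_proj linear_id _ assms(2), unfolded id_def])
  fix c assume c: "c \<in> A"
  then have cB: "c \<in> Basis" using assms(1) by auto
  show "proj A c = c"
  proof (rule euclidean_eqI)
    fix b :: 'a assume "b \<in> Basis"
    then show "proj A c \<bullet> b = c \<bullet> b" using inner_proj[OF assms(1), of b c] c cB by (auto simp: inner_Basis)
  qed
qed

lemma continuous_on_proj: "continuous_on S (proj A)"
  using linear_proj linear_continuous_on linear_linear by blast

lemma sum_proj: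
  assumes "block_partition n B" shows "(\<Sum>i<n. proj (B i) x) = x"
proof -
  have "(\<Sum>i<n. proj (B i) x) = (\<Sum>b\<in>(\<Union>i<n. B i). (x \<bullet> b) *\<^sub>R b)"
    unfolding proj_def using assms
    by (intro sum.UNION_disjoint[symmetric]) (auto simp: block_partition_def intro: finite_subset[OF _ finite_Basis])
  also have "\<dots> = x" using assms by (simp add: block_partition_def euclidean_representation)
  finally show ?thesis .
qed

text \<open>On the subspace, \<open>v\<close> is the lifted function composed with the translation
  by \<open>z - proj A z\<close>, a vector that \<open>proj A\<close> annihilates. This connects
  differentiability on the whole space with the decay hypothesis, which is stated within
  \<open>span\<close>.\<close>

lemma has_derivative_within_span:
  fixes v :: "'a::euclidean_space \<Rightarrow> real"
  assumes A: "A \<subseteq> Basis" and D: "((\<lambda>x. v (proj A x)) has_derivative D) (at z)"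
  shows "(v has_derivative D) (at (proj A z) within span A)"
proof -
  let ?T = "\<lambda>y. y + (z - proj A z)"
  have "((\<lambda>y. v (proj A (?T y))) has_derivative D) (at (proj A z) within span A)"
    by (rule has_derivative_compose[of ?T "\<lambda>y. y", simplified])
      (use D in \<open>auto intro!: derivative_eq_intros\<close>)
  then show ?thesis
  proof (rule has_derivative_transform[rotated 2])
    show "proj A z \<in> span A" by (rule proj_in_span)
    show "v y = v (proj A (?T y))" if "y \<in> span A" for y
      using that A by (simp add: linear_add[OF linear_proj] linear_diff[OF linear_proj] proj_span_id proj_in_span)
  qed
qed

lemma finite_lipschitz_nbhd:
  assumes "finite A" "\<And>i. i \<in> A \<Longrightarrow> \<exists>r>0. \<exists>L. L-lipschitz_on (cball x r) (g i)"
  shows "\<exists>r>0. \<exists>L. \<forall>i\<in>A. L-lipschitz_on (cball x r) (g i)"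
  using assms
proof (induction A rule: finite_induct)
  case empty then show ?case by (intro exI[of _ 1]) auto
next
  case (insert i A)
  then obtain r L where 1: "r > 0" "\<forall>i\<in>A. L-lipschitz_on (cball x r) (g i)" by auto
  obtain r' L' where 2: "r' > 0" "L'-lipschitz_on (cball x r') (g i)" using insert.prems by blast
  have "(max L L')-lipschitz_on (cball x (min r r')) (g j)" if "j \<in> insert i A" for j
  proof (cases "j = i")
    case True
    then show ?thesis using 2(2) by (auto intro: lipschitz_on_mono[of L' "cball x r'"])
  next
    case False
    then have "L-lipschitz_on (cball x r) (g j)" using that 1(2) by auto
    then show ?thesis by (rule lipschitz_on_mono) auto
  qed
  then show ?case using 1(1) 2(1) by (intro exI[of _ "min r r'"]) auto
qed

section \<open>The whole system and the lifted subsystem functions\<close>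

locale interconnection =
  fixes n :: nat and Isum :: "nat set"
    and B :: "nat \<Rightarrow> 'a::euclidean_space set" and C :: "nat \<Rightarrow> 'b::euclidean_space set"
    and f :: "nat \<Rightarrow> 'a \<Rightarrow> 'b \<Rightarrow> 'a" and V :: "nat \<Rightarrow> 'a \<Rightarrow> real"
    and \<gamma> :: "nat \<Rightarrow> nat \<Rightarrow> real \<Rightarrow> real" and \<gamma>u \<alpha>i :: "nat \<Rightarrow> real \<Rightarrow> real"
  assumes Bpart: "block_partition n B" and Cpart: "block_partition n C"
    and f_range: "\<forall>i<n. \<forall>x. \<forall>v\<in>span (C i). f i x v \<in> span (B i)"
    and f_cont: "\<forall>i<n. continuous_on (UNIV \<times> span (C i)) (\<lambda>(x, v). f i x v)"
    and f_lip: "\<forall>i<n. \<forall>r. \<forall>x. \<exists>\<delta>>0. \<exists>L. \<forall>v\<in>span (C i). norm v \<le> r \<longrightarrow>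
                   L-lipschitz_on (cball x \<delta>) (\<lambda>y. f i y v)"
    and lyap: "\<forall>i<n. sub_ISS_lyapunov n Isum B C f V \<gamma> \<gamma>u \<alpha>i i"
begin

lemma n_pos: "0 < n"
proof -
  have "(\<Union>i<n. B i) \<noteq> {}" using Bpart nonempty_Basis by (simp add: block_partition_def)
  then show ?thesis by (cases n) auto
qed

sublocale gain_operator n Isum \<gamma>
  by unfold_locales (use n_pos lyap in \<open>auto simp: sub_ISS_lyapunov_def\<close>)

lemma Bi: "i < n \<Longrightarrow> B i \<subseteq> Basis" and Ci: "i < n \<Longrightarrow> C i \<subseteq> Basis"
  using Bpart Cpart by (auto simp: block_partition_def)

lemma f_in_span: "i < n \<Longrightarrow> f i x (proj (C i) u) \<in> span (B i)"
  using f_range[rule_format, OF _ proj_in_span] .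

definition F :: "'a \<Rightarrow> 'b \<Rightarrow> 'a" where
  "F x u = (\<Sum>i<n. f i x (proj (C i) u))"

text \<open>Lifting \<open>V i\<close> to the full space lets the almost everywhere arguments run
  over the Euclidean type itself instead of a subspace of it.\<close>

definition W :: "nat \<Rightarrow> 'a \<Rightarrow> real" where
  "W i x = V i (proj (B i) x)"

lemma proj_F: "i < n \<Longrightarrow> proj (B i) (F x u) = f i x (proj (C i) u)"
proof -
  assume i: "i < n"
  have "proj (B i) (F x u) = (\<Sum>j<n. proj (B i) (f j x (proj (C j) u)))"
    unfolding F_def by (rule linear_sum[OF linear_proj])
  also have "\<dots> = (\<Sum>j<n. if j = i then f i x (proj (C i) u) else 0)"
  proof (rule sum.cong)
    fix j assume "j \<in> {..<n}"
    then have j: "j < n" "f j x (proj (C j) u) \<in> span (B j)" using f_in_span by auto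
    show "proj (B i) (f j x (proj (C j) u)) = (if j = i then f i x (proj (C i) u) else 0)"
    proof (cases "j = i")
      case True then show ?thesis using proj_span_id[OF Bi] j by simp
    next
      case False
      then have "B i \<inter> B j = {}" using Bpart i j(1) unfolding block_partition_def by auto
      then show ?thesis using proj_span_disjoint[OF Bi[OF i] Bi[OF j(1)] _ j(2)] False by simp
    qed
  qed simp
  finally show ?thesis using i by simp
qed

lemma f_comp_cont: "i < n \<Longrightarrow> continuous_on UNIV (\<lambda>(x, u). f i x (proj (C i) u))"
proof -
  assume i: "i < n"
  have "continuous_on UNIV (\<lambda>p::'a \<times> 'b. (\<lambda>(x, v). f i x v) (fst p, proj (C i) (snd p)))"
    by (rule continuous_on_compose2[OF f_cont[rule_format, OF i]])
      (auto intro!: continuous_intros continuous_on_compose2[OF continuous_on_proj[of UNIV]] simp: proj_in_span)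
  then show ?thesis by (simp add: case_prod_beta')
qed

lemma F_cont: "continuous_on UNIV (\<lambda>(x, u). F x u)"
proof -
  have "continuous_on UNIV (\<lambda>p. \<Sum>i<n. (\<lambda>(x, u). f i x (proj (C i) u)) p)"
    using f_comp_cont by (intro continuous_on_sum) auto
  then show ?thesis by (simp add: F_def case_prod_beta')
qed

lemma F_lip: "\<exists>\<delta>>0. \<exists>L. \<forall>v. norm v \<le> r \<longrightarrow> L-lipschitz_on (cball x \<delta>) (\<lambda>y. F y v)"
proof -
  have "\<exists>\<delta>>0. \<exists>L. \<forall>v. norm v \<le> r \<longrightarrow> L-lipschitz_on (cball x \<delta>) (\<lambda>y. \<Sum>i<m. f i y (proj (C i) v))" if "m \<le> n" for m
    using that
  proof (induction m)
    case 0 show ?case by (intro exI[of _ 1] conjI exI[of _ 0]) (auto simp: lipschitz_on_def)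
  next
    case (Suc m)
    then obtain \<delta> L where 1: "\<delta> > 0"
      "\<forall>v. norm v \<le> r \<longrightarrow> L-lipschitz_on (cball x \<delta>) (\<lambda>y. \<Sum>i<m. f i y (proj (C i) v))" by auto
    have m: "m < n" using Suc.prems by simp
    obtain \<delta>' L' where 2: "\<delta>' > 0"
      "\<forall>v\<in>span (C m). norm v \<le> r \<longrightarrow> L'-lipschitz_on (cball x \<delta>') (\<lambda>y. f m y v)" using f_lip m by blast
    have "(L + L')-lipschitz_on (cball x (min \<delta> \<delta>')) (\<lambda>y. \<Sum>i<Suc m. f i y (proj (C i) v))" if v: "norm v \<le> r" for v
    proof -
      have "norm (proj (C m) v) \<le> r" using norm_proj_le[OF Ci[OF m], of v] v by simp
      then have "L'-lipschitz_on (cball x \<delta>') (\<lambda>y. f m y (proj (C m) v))" using 2(2) proj_in_span by blast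
      then have "L'-lipschitz_on (cball x (min \<delta> \<delta>')) (\<lambda>y. f m y (proj (C m) v))" by (rule lipschitz_on_subset) auto
      moreover have "L-lipschitz_on (cball x (min \<delta> \<delta>')) (\<lambda>y. \<Sum>i<m. f i y (proj (C i) v))"
        by (rule lipschitz_on_subset[of _ "cball x \<delta>"]) (use 1(2) v in auto)
      ultimately show ?thesis by (simp add: lipschitz_on_add)
    qed
    then show ?case using 1(1) 2(1) by (intro exI[of _ "min \<delta> \<delta>'"]) auto
  qed
  from this[of n] show ?thesis by (simp add: F_def)
qed

lemma W_cont: "i < n \<Longrightarrow> continuous_on S (W i)"
proof -
  assume i: "i < n"
  have c: "continuous_on (span (B i)) (V i)" using lyap i by (simp add: sub_ISS_lyapunov_def)
  show ?thesis unfolding W_def by (rule continuous_on_compose2[OF c continuous_on_proj]) (auto simp: proj_in_span)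
qed

definition bounds :: "nat \<Rightarrow> (real \<Rightarrow> real) \<times> (real \<Rightarrow> real)" where
  "bounds i = (SOME p. classKinf (fst p) \<and> classKinf (snd p) \<and>
     (\<forall>x\<in>span (B i). fst p (norm x) \<le> V i x \<and> V i x \<le> snd p (norm x)))"

definition "\<psi>1 i = fst (bounds i)"
definition "\<psi>2 i = snd (bounds i)"

lemma bounds:
  assumes "i < n"
  shows "classKinf (\<psi>1 i)" "classKinf (\<psi>2 i)" "\<psi>1 i (norm (proj (B i) x)) \<le> W i x" "W i x \<le> \<psi>2 i (norm (proj (B i) x))"
proof -
  have "\<exists>p. classKinf (fst p) \<and> classKinf (snd p) \<and> (\<forall>x\<in>span (B i). fst p (norm x) \<le> V i x \<and> V i x \<le> snd p (norm x))"
    using lyap assms unfolding sub_ISS_lyapunov_def proper_posdef_def by auto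
  from someI_ex[OF this] show "classKinf (\<psi>1 i)" "classKinf (\<psi>2 i)" "\<psi>1 i (norm (proj (B i) x)) \<le> W i x"
    "W i x \<le> \<psi>2 i (norm (proj (B i) x))"
    unfolding \<psi>1_def \<psi>2_def bounds_def[symmetric] W_def using proj_in_span by auto
qed

lemma W_nonneg: "i < n \<Longrightarrow> 0 \<le> W i x"
  using bounds(3)[of i x] classK_nonneg[OF classKinfD[OF bounds(1)], of i "norm (proj (B i) x)"] by simp

lemma W_lipschitz:
  assumes i: "i < n" and x: "0 < W i x"
  shows "\<exists>r>0. \<exists>L. L-lipschitz_on (cball x r) (W i)"
proof -
  let ?p = "proj (B i) x"
  have "?p \<noteq> 0" using x bounds(4)[OF i, of x] classK_0[OF classKinfD[OF bounds(2)[OF i]]] by auto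
  then obtain r L where r: "r > 0" "L-lipschitz_on (cball ?p r \<inter> (span (B i) - {0})) (V i)"
    using lyap i proj_in_span[of "B i" x] unfolding sub_ISS_lyapunov_def loc_lipschitz_on_def by blast
  define \<delta> where "\<delta> = min r (norm ?p / 2)"
  have \<delta>: "\<delta> > 0" "\<delta> \<le> r" "\<delta> < norm ?p" using r \<open>?p \<noteq> 0\<close> by (auto simp: \<delta>_def min_def)
  have in': "proj (B i) y \<in> cball ?p r \<inter> (span (B i) - {0})" if "y \<in> cball x \<delta>" for y
  proof -
    have "dist ?p (proj (B i) y) \<le> \<delta>" using dist_proj_le[OF Bi[OF i], of x y] that by simp
    then show ?thesis using \<delta> proj_in_span by (auto simp: dist_norm)
  qed
  have "L-lipschitz_on (cball x \<delta>) (W i)"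
  proof (rule lipschitz_onI)
    fix y z assume "y \<in> cball x \<delta>" "z \<in> cball x \<delta>"
    then have "dist (W i y) (W i z) \<le> L * dist (proj (B i) y) (proj (B i) z)"
      unfolding W_def by (intro lipschitz_onD[OF r(2)] in')
    also have "\<dots> \<le> L * dist y z"
      by (intro mult_left_mono dist_proj_le Bi i lipschitz_on_nonneg[OF r(2)])
    finally show "dist (W i y) (W i z) \<le> L * dist y z" .
  qed (rule lipschitz_on_nonneg[OF r(2)])
  then show ?thesis using \<delta>(1) by blast
qed

text \<open>The strict gain inequality is an open condition by continuity of \<open>G\<close>, so
  \<open>W i\<close> decreases along the field on a neighbourhood of \<open>x\<close>. The increment
  is taken on the segment ending at \<open>x\<close>; replacing \<open>F x u\<close> by its block
  \<open>i\<close> does not change \<open>W i\<close>.\<close>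

lemma W_backward:
  assumes i: "i < n" and x: "0 < W i x" and \<epsilon>: "0 < \<epsilon>"
    and strict: "Gambar n Isum \<gamma> \<gamma>u (\<lambda>j. W j x) (norm u) i < W i x"
  shows "\<exists>\<delta>>0. \<forall>h. 0 \<le> h \<longrightarrow> h < \<delta> \<longrightarrow>
    W i x + h * (\<alpha>i i (norm (proj (B i) x)) - \<epsilon>) \<le> W i (x - h *\<^sub>R F x u)"
proof -
  let ?\<Phi> = "\<lambda>z. f i z (proj (C i) u)"
  let ?\<beta> = "\<lambda>z. \<alpha>i i (norm (proj (B i) z))"
  have sub: "posdef (\<alpha>i i)" "\<And>x u D. (V i has_derivative D) (at (proj (B i) x) within span (B i)) \<Longrightarrow>
        Gambar n Isum \<gamma> \<gamma>u (\<lambda>j. W j x) (norm u) i \<le> W i x \<Longrightarrow>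
        D (f i x (proj (C i) u)) \<le> - \<alpha>i i (norm (proj (B i) x))"
    using lyap i unfolding sub_ISS_lyapunov_def W_def by blast+
  have GG: "Gambar n Isum \<gamma> \<gamma>u s c i = G s (\<gamma>u i c) i" for s c by (simp add: Gambar_def)
  have Wt: "((\<lambda>z. W j z) \<longlongrightarrow> W j x) (nhds x)" if "j < n" for j
    using W_cont[OF that, of UNIV] by (simp add: continuous_on_eq_continuous_at isCont_def tendsto_at_iff_tendsto_nhds)
  have "((\<lambda>z. G (\<lambda>j. W j z) (\<gamma>u i (norm u)) i) \<longlongrightarrow> G (\<lambda>j. W j x) (\<gamma>u i (norm u)) i) (nhds x)"
    using i Wt W_nonneg by (intro G_tendsto) auto
  then have "((\<lambda>z. W i z - G (\<lambda>j. W j z) (\<gamma>u i (norm u)) i) \<longlongrightarrow> W i x - G (\<lambda>j. W j x) (\<gamma>u i (norm u)) i) (nhds x)"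
    by (intro tendsto_diff Wt i)
  then have "eventually (\<lambda>z. 0 < W i z - G (\<lambda>j. W j z) (\<gamma>u i (norm u)) i) (nhds x)"
    using strict by (intro order_tendstoD) (auto simp: GG)
  then obtain r1 where r1: "r1 > 0" "\<And>z. dist z x < r1 \<Longrightarrow> Gambar n Isum \<gamma> \<gamma>u (\<lambda>j. W j z) (norm u) i \<le> W i z"
    unfolding eventually_nhds_metric by (auto simp: GG intro: less_imp_le)
  obtain r2 K where r2: "r2 > 0" "K-lipschitz_on (cball x r2) (W i)" using W_lipschitz[OF i x] by blast
  define r where "r = min r1 r2"
  have r: "0 < r" "r \<le> r1" "r \<le> r2" using r1(1) r2(1) by (auto simp: r_def)
  have lip: "K-lipschitz_on (cball x r) (W i)" using r(3) by (intro lipschitz_on_subset[OF r2(2)]) auto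
  have "continuous_on UNIV (\<lambda>z. (\<lambda>(x, u). f i x (proj (C i) u)) (z, u))"
    by (rule continuous_on_compose2[OF f_comp_cont[OF i]]) (auto intro!: continuous_intros)
  then have c1: "isCont ?\<Phi> x" by (simp add: continuous_on_eq_continuous_at)
  have ca: "continuous_on {0..} (\<alpha>i i)" using sub(1) by (simp add: posdef_def)
  have "continuous_on UNIV ?\<beta>"
    by (rule continuous_on_compose2[OF ca continuous_on_norm[OF continuous_on_proj]]) auto
  then have c2: "isCont ?\<beta> x" by (simp add: continuous_on_eq_continuous_at)
  have dd: "D (?\<Phi> z) \<le> - ?\<beta> z" if z: "z \<in> ball x r" and D: "(W i has_derivative D) (at z)" for z D
  proof (rule sub(2))
    show "(V i has_derivative D) (at (proj (B i) z) within span (B i))"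
      using D unfolding W_def by (rule has_derivative_within_span[OF Bi[OF i]])
    show "Gambar n Isum \<gamma> \<gamma>u (\<lambda>j. W j z) (norm u) i \<le> W i z" using z r by (intro r1(2)) (auto simp: dist_commute)
  qed
  have "\<exists>\<delta>>0. \<forall>z h. 0 \<le> h \<longrightarrow> z \<in> ball x \<delta> \<longrightarrow> z + h *\<^sub>R ?\<Phi> x \<in> ball x \<delta> \<longrightarrow>
      W i (z + h *\<^sub>R ?\<Phi> x) - W i z \<le> h * (- ?\<beta> x + \<epsilon>)"
    by (rule increment_along_field[where \<Phi>="?\<Phi>" and \<beta>="?\<beta>", OF lip r(1) c1 c2 _ \<epsilon>]) (rule dd)
  then obtain d where d: "d > 0" "\<forall>z h. 0 \<le> h \<longrightarrow> z \<in> ball x d \<longrightarrow> z + h *\<^sub>R ?\<Phi> x \<in> ball x d \<longrightarrow>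
      W i (z + h *\<^sub>R ?\<Phi> x) - W i z \<le> h * (- ?\<beta> x + \<epsilon>)" by blast
  define \<eta> where "\<eta> = d / (norm (?\<Phi> x) + 1)"
  have n0: "0 < norm (?\<Phi> x) + 1" using norm_ge_zero[of "?\<Phi> x"] by linarith
  have \<eta>: "0 < \<eta>" "\<eta> * (norm (?\<Phi> x) + 1) = d" using d(1) n0 by (auto simp: \<eta>_def)
  have "W i x + h * (?\<beta> x - \<epsilon>) \<le> W i (x - h *\<^sub>R F x u)" if h: "0 \<le> h" "h < \<eta>" for h
  proof -
    have "h * norm (?\<Phi> x) \<le> h * (norm (?\<Phi> x) + 1)" using h by (intro mult_left_mono) auto
    also have "\<dots> < d" using mult_strict_right_mono[OF h(2) n0] \<eta>(2) by simp
    finally have "x - h *\<^sub>R ?\<Phi> x \<in> ball x d" using h by (simp add: dist_norm)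
    then have "W i (x - h *\<^sub>R ?\<Phi> x + h *\<^sub>R ?\<Phi> x) - W i (x - h *\<^sub>R ?\<Phi> x) \<le> h * (- ?\<beta> x + \<epsilon>)"
      using d h(1) by (intro d(2)[rule_format]) auto
    moreover have "W i (x - h *\<^sub>R F x u) = W i (x - h *\<^sub>R ?\<Phi> x)"
    proof -
      have "proj (B i) (?\<Phi> x) = ?\<Phi> x" by (rule proj_span_id[OF Bi[OF i] f_in_span[OF i]])
      then show ?thesis unfolding W_def by (simp add: linear_diff[OF linear_proj] linear_scale[OF linear_proj] proj_F[OF i])
    qed
    ultimately show ?thesis by (simp add: algebra_simps)
  qed
  then show ?thesis using \<eta>(1) by blast
qed

end

text \<open>The path enters through bounds on its increments, because the values taken by a
  subsystem function may be corners of the path.\<close>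

locale interconnection_path = interconnection +
  fixes \<sigma> :: "nat \<Rightarrow> real \<Rightarrow> real" and \<phi> :: "real \<Rightarrow> real"
  assumes \<sigma>: "i < n \<Longrightarrow> classKinf (\<sigma> i)" and \<sigma>_bilip: "i < n \<Longrightarrow> loc_bilip (\<sigma> i)"
    and \<phi>: "classKinf \<phi>"
    and path: "0 < r \<Longrightarrow> i < n \<Longrightarrow> Gambar n Isum \<gamma> \<gamma>u (\<lambda>j. \<sigma> j r) (\<phi> r) i < \<sigma> i r"
begin

definition Y :: "nat \<Rightarrow> 'a \<Rightarrow> real" where
  "Y i x = sinv (\<sigma> i) (W i x)"

definition Vmax :: "'a \<Rightarrow> real" where
  "Vmax x = Max ((\<lambda>i. Y i x) ` {..<n})"

lemma sinv_\<sigma>: "i < n \<Longrightarrow> classKinf (sinv (\<sigma> i))" "i < n \<Longrightarrow> classK (sinv (\<sigma> i))"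
  using classKinf_sinv[OF \<sigma>] classKinfD by auto

lemma Y_cont: "i < n \<Longrightarrow> isCont (Y i) x"
proof -
  assume i: "i < n"
  have "continuous_on UNIV (Y i)"
    unfolding Y_def by (rule continuous_on_compose2[OF classK_cont[OF sinv_\<sigma>(2)[OF i]] W_cont[OF i]]) (auto simp: W_nonneg[OF i])
  then show ?thesis by (simp add: continuous_on_eq_continuous_at)
qed

lemma Y_le: "i < n \<Longrightarrow> Y i x \<le> Vmax x"
  unfolding Vmax_def by (rule Max_ge) auto

lemma active: "\<exists>i<n. Y i x = Vmax x"
proof -
  have "Vmax x \<in> (\<lambda>i. Y i x) ` {..<n}" unfolding Vmax_def using n_pos by (intro Max_in) auto
  then show ?thesis by auto
qed

lemma Vmax_cont: "isCont Vmax x"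
  unfolding isCont_def Vmax_def
  using n_pos Y_cont by (intro tendsto_Max_image) (auto simp: isCont_def)

lemma Y_nonneg: "i < n \<Longrightarrow> 0 \<le> Y i x"
  unfolding Y_def using classK_nonneg[OF sinv_\<sigma>(2) W_nonneg] by blast

lemma Vmax_nonneg: "0 \<le> Vmax x"
  using Y_nonneg[OF n_pos, of x] Y_le[OF n_pos, of x] by simp

lemma W_le: "i < n \<Longrightarrow> W i x \<le> \<sigma> i (Vmax x)"
  using Y_le[of i x] sinv_le_iff[OF \<sigma> W_nonneg Vmax_nonneg, of i i x x] by (simp add: Y_def)

lemma W_active: "i < n \<Longrightarrow> Y i x = Vmax x \<Longrightarrow> W i x = \<sigma> i (Vmax x)"
  using apply_sinv[OF \<sigma> W_nonneg, of i i x] by (simp add: Y_def)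

definition \<Psi>2 :: "real \<Rightarrow> real" where
  "\<Psi>2 r = (\<Sum>i<n. sinv (\<sigma> i) (\<psi>2 i r))"

text \<open>Each summand bounds the norm of one block in terms of \<open>r = Vmax x\<close>, so
  \<open>norm x \<le> \<eta> (Vmax x)\<close> and the inverse of \<eta> is the lower comparison
  function of \<open>Vmax\<close>.\<close>

definition \<eta> :: "real \<Rightarrow> real" where
  "\<eta> r = (\<Sum>i<n. sinv (\<psi>1 i) (\<sigma> i r))"

lemma \<Psi>2: "classKinf \<Psi>2"
  unfolding \<Psi>2_def using n_pos
  by (intro classKinf_sum) (auto intro: classKinf_compose[OF sinv_\<sigma>(1) bounds(2)])

lemma \<eta>: "classKinf \<eta>"
  unfolding \<eta>_def using n_pos
  by (intro classKinf_sum) (auto intro: classKinf_compose[OF classKinf_sinv[OF bounds(1)] \<sigma>])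

lemma Vmax_upper: "Vmax x \<le> \<Psi>2 (norm x)"
proof -
  obtain i where i: "i < n" "Y i x = Vmax x" using active by blast
  have "\<psi>2 i (norm (proj (B i) x)) \<le> \<psi>2 i (norm x)"
    by (rule classK_mono[OF classKinfD[OF bounds(2)[OF i(1)]] norm_ge_zero norm_proj_le[OF Bi[OF i(1)]]])
  then have "W i x \<le> \<psi>2 i (norm x)" using bounds(4)[OF i(1), of x] by simp
  then have "Y i x \<le> sinv (\<sigma> i) (\<psi>2 i (norm x))"
    unfolding Y_def by (rule classK_mono[OF sinv_\<sigma>(2)[OF i(1)] W_nonneg[OF i(1)]])
  also have "\<dots> \<le> \<Psi>2 (norm x)"
    unfolding \<Psi>2_def
  proof (rule member_le_sum)
    show "0 \<le> sinv (\<sigma> j) (\<psi>2 j (norm x))" if "j \<in> {..<n} - {i}" for j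
      using that by (intro classK_nonneg[OF sinv_\<sigma>(2)] classK_nonneg[OF classKinfD[OF bounds(2)]]) auto
  qed (use i in auto)
  finally show ?thesis using i(2) by simp
qed

lemma Vmax_lower: "sinv \<eta> (norm x) \<le> Vmax x"
proof -
  have "norm x = norm (\<Sum>i<n. proj (B i) x)" by (simp add: sum_proj[OF Bpart])
  also have "\<dots> \<le> (\<Sum>i<n. norm (proj (B i) x))" by (rule norm_sum)
  also have "\<dots> \<le> \<eta> (Vmax x)"
    unfolding \<eta>_def
  proof (rule sum_mono)
    fix i assume "i \<in> {..<n}"
    then have i: "i < n" by simp
    note K1 = classKinfD[OF classKinf_sinv[OF bounds(1)[OF i]]]
    have "\<psi>1 i (norm (proj (B i) x)) \<le> \<sigma> i (Vmax x)" using bounds(3)[OF i, of x] W_le[OF i, of x] by simp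
    then have "sinv (\<psi>1 i) (\<psi>1 i (norm (proj (B i) x))) \<le> sinv (\<psi>1 i) (\<sigma> i (Vmax x))"
      by (rule classK_mono[OF K1 classK_nonneg[OF classKinfD[OF bounds(1)[OF i]] norm_ge_zero]])
    then show "norm (proj (B i) x) \<le> sinv (\<psi>1 i) (\<sigma> i (Vmax x))"
      by (simp add: sinv_apply[OF classKinfD[OF bounds(1)[OF i]]])
  qed
  finally show ?thesis using sinv_le_iff[OF \<eta> norm_ge_zero Vmax_nonneg] by blast
qed

lemma Vmax_pos: "x \<noteq> 0 \<Longrightarrow> 0 < Vmax x"
  using Vmax_lower[of x] classK_pos[OF classKinfD[OF classKinf_sinv[OF \<eta>]], of "norm x"] by simp

lemma Vmax_0: "Vmax 0 = 0"
  using Vmax_upper[of 0] Vmax_nonneg[of 0] classK_0[OF classKinfD[OF \<Psi>2]] by simp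

text \<open>\<open>sinv (\<sigma> i)\<close> may fail to be Lipschitz at \<open>0\<close>, and
  \<open>V i\<close> at the origin. Where \<open>Y i\<close> is below \<open>c\<close> the
  truncation is constant; elsewhere \<open>W i\<close> is positive and both maps of the composition
  are locally Lipschitz.\<close>

lemma Y_truncated_lipschitz:
  assumes i: "i < n" and c: "0 < c"
  shows "\<exists>r>0. \<exists>L. L-lipschitz_on (cball x r) (\<lambda>y. max (Y i y) c)"
proof (cases "Y i x < c")
  case True
  then have "eventually (\<lambda>y. Y i y < c) (nhds x)"
    using Y_cont[OF i, of x] by (intro order_tendstoD) (auto simp: isCont_def tendsto_at_iff_tendsto_nhds)
  then obtain r where r: "r > 0" "\<And>y. dist y x < r \<Longrightarrow> Y i y < c" unfolding eventually_nhds_metric by blast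
  have "0-lipschitz_on (cball x (r/2)) (\<lambda>y. max (Y i y) c)"
  proof (rule lipschitz_onI)
    fix y z assume "y \<in> cball x (r/2)" "z \<in> cball x (r/2)"
    then have "Y i y < c" "Y i z < c" using r(1) by (auto intro!: r(2) simp: dist_commute)
    then show "dist (max (Y i y) c) (max (Y i z) c) \<le> 0 * dist y z" by simp
  qed simp
  then show ?thesis using r(1) by (intro exI[of _ "r/2"]) auto
next
  case False
  have W0: "0 < W i x"
  proof (rule ccontr)
    assume "\<not> 0 < W i x"
    then have "W i x = 0" using W_nonneg[OF i, of x] by simp
    then show False using False c classK_0[OF sinv_\<sigma>(2)[OF i]] by (simp add: Y_def)
  qed
  obtain r1 K where r1: "r1 > 0" "K-lipschitz_on (cball x r1) (W i)" using W_lipschitz[OF i W0] by blast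
  obtain r2 M where r2: "r2 > 0" "M-lipschitz_on (cball (W i x) r2 \<inter> {0<..}) (sinv (\<sigma> i))"
    using loc_bilip_imp_loc_lipschitz_on[OF loc_bilip_sinv[OF \<sigma>[OF i] \<sigma>_bilip[OF i]]] W0
    unfolding loc_lipschitz_on_def by (metis greaterThan_iff)
  have "isCont (W i) x" using W_cont[OF i, of UNIV] by (simp add: continuous_on_eq_continuous_at)
  moreover have "0 < min r2 (W i x)" using r2(1) W0 by simp
  ultimately obtain r3 where r3: "r3 > 0" "\<forall>y. dist y x < r3 \<longrightarrow> dist (W i y) (W i x) < min r2 (W i x)"
    unfolding continuous_at_eps_delta by blast
  define r where "r = min r1 (r3/2)"
  have r: "0 < r" "r \<le> r1" "r < r3" using r1(1) r3(1) by (auto simp: r_def)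
  have in': "W i y \<in> cball (W i x) r2 \<inter> {0<..}" "y \<in> cball x r1" if "y \<in> cball x r" for y
  proof -
    have "dist y x < r3" using that r by (simp add: dist_commute)
    then have "dist (W i y) (W i x) < r2" "dist (W i y) (W i x) < W i x" using r3(2) by auto
    then show "W i y \<in> cball (W i x) r2 \<inter> {0<..}" by (auto simp: dist_real_def abs_less_iff abs_minus_commute)
    show "y \<in> cball x r1" using that r by auto
  qed
  have "(M * K)-lipschitz_on (cball x r) (\<lambda>y. max (Y i y) c)"
  proof (rule lipschitz_onI)
    fix y z assume yz: "y \<in> cball x r" "z \<in> cball x r"
    have "dist (max (Y i y) c) (max (Y i z) c) \<le> dist (Y i y) (Y i z)" unfolding dist_real_def by linarith
    also have "\<dots> \<le> M * dist (W i y) (W i z)" unfolding Y_def using yz in' by (intro lipschitz_onD[OF r2(2)]) auto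
    also have "\<dots> \<le> M * (K * dist y z)"
      using yz in' lipschitz_on_nonneg[OF r2(2)] by (intro mult_left_mono lipschitz_onD[OF r1(2)]) auto
    finally show "dist (max (Y i y) c) (max (Y i z) c) \<le> M * K * dist y z" by simp
  qed (use lipschitz_on_nonneg[OF r1(2)] lipschitz_on_nonneg[OF r2(2)] in simp)
  then show ?thesis using r(1) by blast
qed

text \<open>Near \<open>x \<noteq> 0\<close> the components with \<open>Y i < Vmax x / 2\<close> are inactive, so truncating all of them at
  that level does not change the maximum, and removes the points where \<open>V i\<close> is not Lipschitz.\<close>
lemma Vmax_loc_lipschitz: "loc_lipschitz_on (UNIV - {0}) Vmax"
  unfolding loc_lipschitz_on_def
proof
  fix x :: 'a assume "x \<in> UNIV - {0}"
  then have v: "0 < Vmax x" using Vmax_pos by simp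
  define c where "c = Vmax x / 2"
  have c: "0 < c" "c < Vmax x" using v by (auto simp: c_def)
  have "\<exists>r>0. \<exists>L. \<forall>i\<in>{..<n}. L-lipschitz_on (cball x r) (\<lambda>y. max (Y i y) c)"
    by (rule finite_lipschitz_nbhd) (use Y_truncated_lipschitz c in auto)
  then obtain r L where r: "r > 0" "\<And>i. i < n \<Longrightarrow> L-lipschitz_on (cball x r) (\<lambda>y. max (Y i y) c)" by auto
  have "eventually (\<lambda>y. c < Vmax y) (nhds x)"
    using Vmax_cont[of x] c by (intro order_tendstoD) (auto simp: isCont_def tendsto_at_iff_tendsto_nhds)
  then obtain r' where r': "r' > 0" "\<And>y. dist y x < r' \<Longrightarrow> c < Vmax y" unfolding eventually_nhds_metric by blast
  define \<delta> where "\<delta> = min r (r'/2)"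
  have \<delta>: "0 < \<delta>" "\<delta> \<le> r" "\<delta> < r'" using r(1) r'(1) by (auto simp: \<delta>_def)
  have le: "Vmax y \<le> Vmax z + L * dist y z" if yz: "y \<in> cball x \<delta>" "z \<in> cball x \<delta>" for y z
  proof -
    obtain i where i: "i < n" "Y i y = Vmax y" using active by blast
    have cy: "c < Vmax y" "c < Vmax z" using yz \<delta> by (auto intro!: r'(2) simp: dist_commute)
    have "dist (max (Y i y) c) (max (Y i z) c) \<le> L * dist y z"
      using yz \<delta> by (intro lipschitz_onD[OF r(2)[OF i(1)]]) auto
    then have "max (Y i y) c \<le> max (Y i z) c + L * dist y z" unfolding dist_real_def by linarith
    moreover have "max (Y i z) c \<le> Vmax z" using Y_le[OF i(1), of z] cy by simp
    ultimately show ?thesis using i(2) cy by simp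
  qed
  have "L-lipschitz_on (cball x \<delta> \<inter> (UNIV - {0})) Vmax"
  proof (rule lipschitz_onI)
    fix y z assume "y \<in> cball x \<delta> \<inter> (UNIV - {0})" "z \<in> cball x \<delta> \<inter> (UNIV - {0})"
    then have "Vmax y \<le> Vmax z + L * dist y z" "Vmax z \<le> Vmax y + L * dist y z"
      using le[of y z] le[of z y] by (auto simp: dist_commute)
    then show "dist (Vmax y) (Vmax z) \<le> L * dist y z" by (simp add: dist_real_def abs_le_iff)
  qed (rule lipschitz_on_nonneg[OF r(2)[OF n_pos]])
  then show "\<exists>r>0. \<exists>L. L-lipschitz_on (cball x r \<inter> (UNIV - {0})) Vmax" using \<delta>(1) by blast
qed

text \<open>At a point of differentiability of the maximum an active \<open>Y i\<close> need not be differentiable. It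
  does touch the maximum from below, so its increase along \<open>- F x u\<close> bounds \<open>D (- F x u)\<close>.\<close>
lemma active_decrease:
  assumes i: "i < n" and pq: "0 < p" "p \<le> q"
  shows "\<exists>c>0. \<forall>x u D. norm x \<in> {p..q} \<longrightarrow> Y i x = Vmax x \<longrightarrow> norm u \<le> \<phi> (Vmax x) \<longrightarrow>
    (Vmax has_derivative D) (at x) \<longrightarrow> D (F x u) \<le> - c"
proof -
  have sub: "classK (\<gamma>u i)" "posdef (\<alpha>i i)" using lyap i by (auto simp: sub_ISS_lyapunov_def)
  note \<sigma>K = classKinfD[OF \<sigma>[OF i]] and \<psi>1K = classKinfD[OF bounds(1)[OF i]] and \<psi>2K = classKinfD[OF bounds(2)[OF i]]
  define p' q' where "p' = sinv \<eta> p" and "q' = \<Psi>2 q"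
  have p'0: "0 < p'" unfolding p'_def by (rule classK_pos[OF classKinfD[OF classKinf_sinv[OF \<eta>]] pq(1)])
  have Vb: "p' \<le> Vmax x" "Vmax x \<le> q'" if "norm x \<in> {p..q}" for x
  proof -
    have "p' \<le> sinv \<eta> (norm x)" unfolding p'_def using that pq
      by (intro classK_mono[OF classKinfD[OF classKinf_sinv[OF \<eta>]]]) auto
    then show "p' \<le> Vmax x" using Vmax_lower[of x] by simp
    have "\<Psi>2 (norm x) \<le> q'" unfolding q'_def using that by (intro classK_mono[OF classKinfD[OF \<Psi>2]]) auto
    then show "Vmax x \<le> q'" using Vmax_upper[of x] by simp
  qed
  show ?thesis
  proof (cases "p' \<le> q'")
    case False
    then have "norm x \<notin> {p..q}" for x :: 'a using Vb[of x] by auto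
    then show ?thesis by (intro exI[of _ 1]) auto
  next
    case True
    define a b where "a = \<sigma> i p'" and "b = \<sigma> i q'"
    have a0: "0 < a" unfolding a_def by (rule classK_pos[OF \<sigma>K p'0])
    have ab: "a \<le> b" unfolding a_def b_def using p'0 by (intro classK_mono[OF \<sigma>K _ True]) auto
    \<comment> \<open>The range is extended to \<open>b + 1\<close> to make room for the backward
      step, which is kept so short that the value used, \<open>W i x + h * (\<mu> / 2)\<close>, is
      raised by at most \<open>1\<close>.\<close>
    have "\<exists>m M. 0 < m \<and> 0 < M \<and> (\<forall>x y. a \<le> x \<longrightarrow> x \<le> y \<longrightarrow> y \<le> b + 1 \<longrightarrow>
        m * (y - x) \<le> sinv (\<sigma> i) y - sinv (\<sigma> i) x \<and> sinv (\<sigma> i) y - sinv (\<sigma> i) x \<le> M * (y - x))"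
      using loc_bilip_sinv[OF \<sigma>[OF i] \<sigma>_bilip[OF i], unfolded loc_bilip_def, rule_format, of a "b + 1"] a0 ab by simp
    then obtain m where m: "0 < m" "\<And>w w'. a \<le> w \<Longrightarrow> w \<le> w' \<Longrightarrow> w' \<le> b + 1 \<Longrightarrow> m * (w' - w) \<le> sinv (\<sigma> i) w' - sinv (\<sigma> i) w"
      by blast
    define c d where "c = sinv (\<psi>2 i) a" and "d = sinv (\<psi>1 i) b"
    have c0: "0 < c" unfolding c_def by (rule classK_pos[OF classKinfD[OF classKinf_sinv[OF bounds(2)[OF i]]] a0])
    have in_cd: "norm (proj (B i) x) \<in> {c..d}" if "W i x \<in> {a..b}" for x
    proof -
      let ?y = "norm (proj (B i) x)"
      have "a \<le> \<psi>2 i ?y" "\<psi>1 i ?y \<le> b" using bounds(3,4)[OF i, of x] that by auto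
      then have "c \<le> ?y" using sinv_le_iff[OF bounds(2)[OF i], of a ?y] a0 by (simp add: c_def)
      moreover have "\<psi>1 i ?y \<le> \<psi>1 i d" using \<open>\<psi>1 i ?y \<le> b\<close> a0 ab by (simp add: d_def apply_sinv[OF bounds(1)[OF i]])
      then have "?y \<le> d" using classK_le_iff[OF \<psi>1K, of ?y d] sinv_nonneg[OF bounds(1)[OF i], of b] a0 ab by (simp add: d_def)
      ultimately show ?thesis by simp
    qed
    have "\<exists>\<mu>>0. \<forall>s\<in>{c..d}. \<mu> \<le> \<alpha>i i s"
    proof (cases "c \<le> d")
      case True
      have "continuous_on {c..d} (\<alpha>i i)" using sub(2) c0 unfolding posdef_def by (auto intro: continuous_on_subset)
      then obtain s where s: "s \<in> {c..d}" "\<forall>r\<in>{c..d}. \<alpha>i i s \<le> \<alpha>i i r"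
        using continuous_attains_inf[of "{c..d}" "\<alpha>i i"] True by auto
      have "0 \<le> s" "s \<noteq> 0" using s(1) c0 by auto
      then have "0 < \<alpha>i i s" using sub(2) unfolding posdef_def by (metis less_eq_real_def)
      then show ?thesis using s(2) by blast
    qed (auto intro: exI[of _ 1])
    then obtain \<mu> where \<mu>: "0 < \<mu>" "\<And>s. s \<in> {c..d} \<Longrightarrow> \<mu> \<le> \<alpha>i i s" by blast
    have "D (F x u) \<le> - (m * (\<mu> / 2))"
      if x: "norm x \<in> {p..q}" and act: "Y i x = Vmax x" and u: "norm u \<le> \<phi> (Vmax x)"
        and D: "(Vmax has_derivative D) (at x)" for x u D
    proof -
      let ?v = "Vmax x"
      have v: "p' \<le> ?v" "?v \<le> q'" "0 < ?v" using Vb[OF x] p'0 by auto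
      have Wx: "W i x = \<sigma> i ?v" by (rule W_active[OF i act])
      have Wab: "W i x \<in> {a..b}" unfolding Wx a_def b_def
        using v p'0 by (auto intro!: classK_mono[OF \<sigma>K])
      have W0: "0 < W i x" using Wab a0 by simp
      \<comment> \<open>No component lies above the path at parameter \<open>?v\<close>, and
        component \<open>i\<close> lies on it, so monotonicity carries the strict path inequality
        over to the actual state and input.\<close>
      have "Gambar n Isum \<gamma> \<gamma>u (\<lambda>j. W j x) (norm u) i \<le> Gambar n Isum \<gamma> \<gamma>u (\<lambda>j. \<sigma> j ?v) (\<phi> ?v) i"
        by (rule Gambar_mono[OF i]) (use W_nonneg W_le classK_mono[OF sub(1) norm_ge_zero u] in auto)
      also have "\<dots> < W i x" unfolding Wx by (rule path[OF v(3) i])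
      finally have strict: "Gambar n Isum \<gamma> \<gamma>u (\<lambda>j. W j x) (norm u) i < W i x" .
      obtain \<delta> where \<delta>: "\<delta> > 0" "\<forall>h. 0 \<le> h \<longrightarrow> h < \<delta> \<longrightarrow>
          W i x + h * (\<alpha>i i (norm (proj (B i) x)) - \<mu> / 2) \<le> W i (x - h *\<^sub>R F x u)"
        using W_backward[OF i W0 half_gt_zero[OF \<mu>(1)] strict] by blast
      have \<alpha>\<mu>: "\<mu> / 2 \<le> \<alpha>i i (norm (proj (B i) x)) - \<mu> / 2" using \<mu>(2)[OF in_cd[OF Wab]] by simp
      have "((\<lambda>h. (Vmax (x + h *\<^sub>R (- F x u)) - Vmax x) / h) \<longlongrightarrow> D (- F x u)) (at_right 0)"
        using has_derivative_directional[OF D, of "- F x u"] by (rule tendsto_mono[rotated]) (simp add: at_le)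
      then have "m * (\<mu> / 2) \<le> D (- F x u)"
      proof (rule tendsto_lowerbound)
        show "eventually (\<lambda>h. m * (\<mu> / 2) \<le> (Vmax (x + h *\<^sub>R (- F x u)) - Vmax x) / h) (at_right 0)"
          unfolding eventually_at_right_field
        proof (intro exI[of _ "min \<delta> (2 / \<mu>)"] conjI allI impI)
          show "0 < min \<delta> (2 / \<mu>)" using \<delta>(1) \<mu>(1) by simp
          fix h assume h: "0 < h" "h < min \<delta> (2 / \<mu>)"
          have "h * (\<mu> / 2) \<le> h * (\<alpha>i i (norm (proj (B i) x)) - \<mu> / 2)" using \<alpha>\<mu> h by (intro mult_left_mono) auto
          moreover have "W i x + h * (\<alpha>i i (norm (proj (B i) x)) - \<mu> / 2) \<le> W i (x - h *\<^sub>R F x u)" using \<delta>(2) h by simp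
          ultimately have up: "W i x + h * (\<mu> / 2) \<le> W i (x - h *\<^sub>R F x u)" by linarith
          have "h < 2 / \<mu>" using h by simp
          then have h1: "h * (\<mu> / 2) \<le> 1" using \<mu>(1) by (simp add: field_simps)
          have hp: "0 \<le> h * (\<mu> / 2)" using h \<mu>(1) by simp
          have "m * (W i x + h * (\<mu> / 2) - W i x) \<le> sinv (\<sigma> i) (W i x + h * (\<mu> / 2)) - sinv (\<sigma> i) (W i x)"
            using Wab h1 hp by (intro m(2)) auto
          moreover have "sinv (\<sigma> i) (W i x + h * (\<mu> / 2)) \<le> Y i (x - h *\<^sub>R F x u)"
            unfolding Y_def using W0 hp by (intro classK_mono[OF sinv_\<sigma>(2)[OF i] _ up]) auto
          moreover have "Y i (x - h *\<^sub>R F x u) \<le> Vmax (x - h *\<^sub>R F x u)" by (rule Y_le[OF i])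
          moreover have "sinv (\<sigma> i) (W i x) = Vmax x" using act by (simp add: Y_def)
          ultimately have "m * (h * (\<mu> / 2)) \<le> Vmax (x - h *\<^sub>R F x u) - Vmax x" by simp
          then show "m * (\<mu> / 2) \<le> (Vmax (x + h *\<^sub>R (- F x u)) - Vmax x) / h" using h by (simp add: field_simps)
        qed
      qed simp
      then show ?thesis using linear_neg[OF has_derivative_linear[OF D], of "F x u"] by simp
    qed
    then show ?thesis using m(1) \<mu>(1) by (intro exI[of _ "m * (\<mu> / 2)"]) auto
  qed
qed

text \<open>\<open>active_decrease\<close> gives a constant for each active index on each annulus; a
  minimum over the indices and \<open>posdef_below\<close> merge them into one rate. The gain is
  \<open>sinv \<phi>\<close>, which turns the premise into
  \<open>norm u \<le> \<phi> (Vmax x)\<close>.\<close>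

lemma Vmax_ISS_lyapunov: "ISS_lyapunov F Vmax"
proof -
  define P where "P s c \<longleftrightarrow> (\<forall>x u D. norm x = s \<longrightarrow> norm u \<le> \<phi> (Vmax x) \<longrightarrow>
    (Vmax has_derivative D) (at x) \<longrightarrow> D (F x u) \<le> - c)" for s c
  have "\<exists>\<alpha>. posdef \<alpha> \<and> (\<forall>s>0. P s (\<alpha> s))"
  proof (rule posdef_below[of P])
    show "P s c'" if "P s c" "c' \<le> c" for s c c' using that unfolding P_def by force
    show "\<exists>c>0. \<forall>s\<in>{p..q}. P s c" if pq: "0 < p" "p \<le> q" for p q
    proof -
      have "\<exists>c. \<forall>i. i < n \<longrightarrow> 0 < c i \<and> (\<forall>x u D. norm x \<in> {p..q} \<longrightarrow> Y i x = Vmax x \<longrightarrow> norm u \<le> \<phi> (Vmax x) \<longrightarrow>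
          (Vmax has_derivative D) (at x) \<longrightarrow> D (F x u) \<le> - c i)"
        using active_decrease[OF _ pq] by (intro choice) blast
      then obtain c where c: "\<And>i. i < n \<Longrightarrow> 0 < c i" "\<And>i x u D. i < n \<Longrightarrow> norm x \<in> {p..q} \<Longrightarrow> Y i x = Vmax x \<Longrightarrow>
          norm u \<le> \<phi> (Vmax x) \<Longrightarrow> (Vmax has_derivative D) (at x) \<Longrightarrow> D (F x u) \<le> - c i" by blast
      define m where "m = Min (c ` {..<n})"
      have m: "0 < m" unfolding m_def using n_pos c(1) by (subst Min_gr_iff) auto
      have mi: "m \<le> c i" if "i < n" for i unfolding m_def using that by (intro Min_le) auto
      have "D (F x u) \<le> - m" if "norm x \<in> {p..q}" "norm u \<le> \<phi> (Vmax x)" "(Vmax has_derivative D) (at x)" for x u D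
      proof -
        obtain i where i: "i < n" "Y i x = Vmax x" using active by blast
        show ?thesis using c(2)[OF i(1) that(1) i(2) that(2,3)] mi[OF i(1)] by simp
      qed
      then show ?thesis using m unfolding P_def by (intro exI[of _ m]) auto
    qed
    show "\<exists>\<alpha>. posdef \<alpha> \<and> (\<forall>s>0. P s (\<alpha> s))" if "posdef \<alpha>" "\<And>s. 0 < s \<Longrightarrow> P s (\<alpha> s)" for \<alpha> using that by blast
  qed
  then obtain \<alpha> where \<alpha>: "posdef \<alpha>" "\<forall>s>0. P s (\<alpha> s)" by blast
  have dec: "D (F x u) \<le> - \<alpha> (norm x)" if D: "(Vmax has_derivative D) (at x)" and u: "sinv \<phi> (norm u) \<le> Vmax x" for x u D
  proof (cases "x = 0")
    case True
    \<comment> \<open>\<open>Vmax\<close> has its minimum at the origin, so a derivative there is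
      nonnegative in every direction, in particular along \<open>- F x u\<close>.\<close>
    have "((\<lambda>h. (Vmax (x + h *\<^sub>R (- F x u)) - Vmax x) / h) \<longlongrightarrow> D (- F x u)) (at_right 0)"
      using has_derivative_directional[OF D, of "- F x u"] by (rule tendsto_mono[rotated]) (simp add: at_le)
    then have "0 \<le> D (- F x u)"
    proof (rule tendsto_lowerbound)
      show "eventually (\<lambda>h. 0 \<le> (Vmax (x + h *\<^sub>R (- F x u)) - Vmax x) / h) (at_right 0)"
        unfolding eventually_at_right_field using Vmax_nonneg True Vmax_0 by (intro exI[of _ 1]) auto
    qed simp
    moreover have "\<alpha> 0 = 0" using \<alpha>(1) by (auto simp: posdef_def)
    ultimately show ?thesis using linear_neg[OF has_derivative_linear[OF D], of "F x u"] True by simp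
  next
    case False
    have "norm u \<le> \<phi> (Vmax x)" using sinv_le_iff[OF \<phi> norm_ge_zero Vmax_nonneg] u by blast
    then show ?thesis using \<alpha>(2) False D unfolding P_def by simp
  qed
  have "continuous_on UNIV Vmax" using Vmax_cont by (simp add: continuous_on_eq_continuous_at)
  moreover have "proper_posdef UNIV Vmax"
    unfolding proper_posdef_def using classKinf_sinv[OF \<eta>] \<Psi>2 Vmax_lower Vmax_upper by blast
  ultimately show ?thesis
    unfolding ISS_lyapunov_def using Vmax_loc_lipschitz classKinfD[OF classKinf_sinv[OF \<phi>]] \<alpha>(1) dec by blast
qed

end

section \<open>Assembly of the path, the input bound and the composite function\<close>

theorem theorem6:
  fixes n :: nat and Isum :: "nat set"
    and B :: "nat \<Rightarrow> 'a::euclidean_space set" and C :: "nat \<Rightarrow> 'b::euclidean_space set"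
    and f :: "nat \<Rightarrow> 'a \<Rightarrow> 'b \<Rightarrow> 'a"
    and V :: "nat \<Rightarrow> 'a \<Rightarrow> real"
    and \<gamma> :: "nat \<Rightarrow> nat \<Rightarrow> real \<Rightarrow> real" and \<gamma>u :: "nat \<Rightarrow> real \<Rightarrow> real"
    and \<alpha>i :: "nat \<Rightarrow> real \<Rightarrow> real"
  assumes Isum: "Isum \<subseteq> {..<n}"
    and Bpart: "block_partition n B" and Cpart: "block_partition n C"
    and f_range: "\<forall>i<n. \<forall>x. \<forall>v\<in>span (C i). f i x v \<in> span (B i)"
    and f_cont: "\<forall>i<n. continuous_on (UNIV \<times> span (C i)) (\<lambda>(x, v). f i x v)"
    and f_lip: "\<forall>i<n. \<forall>r. \<forall>x. \<exists>\<delta>>0. \<exists>L. \<forall>v\<in>span (C i). norm v \<le> r \<longrightarrow>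
                   L-lipschitz_on (cball x \<delta>) (\<lambda>y. f i y v)"
    and lyap: "\<forall>i<n. sub_ISS_lyapunov n Isum B C f V \<gamma> \<gamma>u \<alpha>i i"
    and small_gain: "\<exists>\<alpha>. classKinf \<alpha> \<and>
       (\<forall>s. (\<forall>i<n. 0 \<le> s i) \<and> (\<exists>i<n. s i \<noteq> 0) \<longrightarrow>
            (\<exists>i<n. Gam n Isum \<gamma> (Dalpha Isum \<alpha> s) i < s i))"
  shows "ISS (\<lambda>x u. \<Sum>i<n. f i x (proj (C i) u)) \<and>
    (\<exists>\<sigma> \<phi>. omega_path n Isum \<gamma> \<sigma> \<and> classKinf \<phi> \<and>
       (\<forall>r>0. \<forall>i<n. Gambar n Isum \<gamma> \<gamma>u (\<lambda>j. \<sigma> j r) (\<phi> r) i < \<sigma> i r) \<and>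
       ISS_lyapunov (\<lambda>x u. \<Sum>i<n. f i x (proj (C i) u))
         (\<lambda>x. Max ((\<lambda>i. sinv (\<sigma> i) (V i (proj (B i) x))) ` {..<n})))"
proof -
  interpret interconnection n Isum B C f V \<gamma> \<gamma>u \<alpha>i
    by unfold_locales (rule Bpart Cpart f_range f_cont f_lip lyap)+
  obtain \<alpha> where \<alpha>: "classKinf \<alpha>" "\<And>s. (\<forall>i<n. 0 \<le> s i) \<and> (\<exists>i<n. s i \<noteq> 0) \<Longrightarrow>
      \<exists>i<n. Gam n Isum \<gamma> (Dalpha Isum \<alpha> s) i < s i" using small_gain by blast
  interpret S: small_gain n Isum \<gamma> \<alpha>
    by unfold_locales (rule \<alpha>, assumption | rule \<alpha>(1))+
  have \<gamma>u: "classK (\<gamma>u i)" if "i < n" for i using lyap that by (simp add: sub_ISS_lyapunov_def)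
  obtain \<kappa> where \<kappa>: "classKinf \<kappa>"
    "\<And>s. s \<in> S.below (\<kappa> (\<Sum>i<n. s i)) \<Longrightarrow> (\<Sum>i<n. s i) = 0"
    using S.ex_margin by metis
  obtain z :: "int \<Rightarrow> nat \<Rightarrow> real" where z:
    "\<And>k i. i < n \<Longrightarrow> 0 < z k i" "\<And>k i. i < n \<Longrightarrow> z k i < z (k + 1) i"
    "\<And>k i. i < n \<Longrightarrow> G (z (k + 1)) (\<kappa> (\<Sum>j<n. z (k + 1) j)) i < z k i"
    "\<And>i. i < n \<Longrightarrow> filterlim (\<lambda>k. z (int k) i) at_top sequentially"
    "\<And>i. i < n \<Longrightarrow> (\<lambda>k. z (- int k) i) \<longlonglongrightarrow> 0"
    using S.ex_chain[OF \<kappa>] by metis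
  define \<sigma> where "\<sigma> i = dyadic_interp (\<lambda>k. z k i)" for i
  have \<sigma>: "classKinf (\<sigma> i)" if "i < n" for i
    unfolding \<sigma>_def using z(1,2,4,5)[OF that] by (rule classKinf_dyadic_interp)
  have \<sigma>_bilip: "loc_bilip (\<sigma> i)" if "i < n" for i
    unfolding \<sigma>_def using z(2)[OF that] by (rule loc_bilip_dyadic_interp)
  have \<sigma>_nonneg: "0 \<le> \<sigma> i r" if "i < n" "0 \<le> r" for i r using classK_nonneg[OF classKinfD[OF \<sigma>]] that by blast
  define \<xi> where "\<xi> r = \<kappa> (\<Sum>j<n. \<sigma> j r)" for r
  have \<xi>: "classKinf \<xi>"
    unfolding \<xi>_def by (rule classKinf_compose[OF \<kappa>(1) classKinf_sum]) (use \<sigma> n_pos in auto)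
  \<comment> \<open>Between two nodes the operator is at most its value at the upper node, which is
    below the lower node, which in turn is below the path. This is why the chain compares
    \<open>G\<close> at index \<open>k + 1\<close> with \<open>z k\<close>.\<close>
  have path: "G (\<lambda>j. \<sigma> j r) (\<xi> r) i < \<sigma> i r" if r: "0 < r" and i: "i < n" for r i
  proof -
    define k where "k = \<lfloor>log 2 r\<rfloor>"
    have between: "z k j \<le> \<sigma> j r" "\<sigma> j r \<le> z (k + 1) j" if "j < n" for j
      unfolding \<sigma>_def using dyadic_interp_between[of "\<lambda>k. z k j" r k] z(2)[OF that] r k_def by auto
    have nn: "0 \<le> \<sigma> j r" if "j < n" for j using \<sigma>_nonneg[OF that] r by simp
    have "\<xi> r \<le> \<kappa> (\<Sum>j<n. z (k + 1) j)"
      unfolding \<xi>_def by (rule classK_mono[OF classKinfD[OF \<kappa>(1)]]) (use nn between in \<open>auto intro!: sum_nonneg sum_mono\<close>)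
    then have "G (\<lambda>j. \<sigma> j r) (\<xi> r) i \<le> G (z (k + 1)) (\<kappa> (\<Sum>j<n. z (k + 1) j)) i"
      by (intro Gambar_mono i nn between)
    also have "\<dots> < z k i" by (rule z(3)[OF i])
    also have "z k i \<le> \<sigma> i r" by (rule between(1)[OF i])
    finally show ?thesis .
  qed
  \<comment> \<open>A common majorant of all input gains, which may individually be bounded; the
    summand \<open>r\<close> makes it unbounded and hence invertible. With its inverse, every
    \<open>\<gamma>u i (\<phi> r)\<close> fits under the reserve \<open>\<xi> r\<close>.\<close>
  define g where "g r = r + (\<Sum>i<n. \<gamma>u i r)" for r
  have g: "classKinf g"
    unfolding g_def by (rule classKinf_add[OF classKinf_id classK_sum]) (use \<gamma>u n_pos in auto)
  define \<phi> where "\<phi> r = sinv g (\<xi> r)" for r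
  have \<phi>: "classKinf \<phi>" unfolding \<phi>_def by (rule classKinf_compose[OF classKinf_sinv[OF g] \<xi>])
  have bar: "Gambar n Isum \<gamma> \<gamma>u (\<lambda>j. \<sigma> j r) (\<phi> r) i < \<sigma> i r" if r: "0 < r" and i: "i < n" for r i
  proof -
    have \<xi>0: "0 \<le> \<xi> r" using classK_nonneg[OF classKinfD[OF \<xi>]] r by simp
    have \<phi>0: "0 \<le> \<phi> r" using classK_nonneg[OF classKinfD[OF \<phi>]] r by simp
    have "\<gamma>u i (\<phi> r) \<le> (\<Sum>i<n. \<gamma>u i (\<phi> r))"
      by (rule member_le_sum) (use i classK_nonneg[OF \<gamma>u \<phi>0] in auto)
    also have "\<dots> \<le> g (\<phi> r)" using \<phi>0 by (simp add: g_def)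
    also have "\<dots> = \<xi> r" unfolding \<phi>_def by (rule apply_sinv[OF g \<xi>0])
    finally have "Gambar n Isum \<gamma> \<gamma>u (\<lambda>j. \<sigma> j r) (\<phi> r) i \<le> G (\<lambda>j. \<sigma> j r) (\<xi> r) i"
      by (intro Gambar_mono i) (use \<sigma>_nonneg r in auto)
    then show ?thesis using path[OF r i] by simp
  qed
  interpret P: interconnection_path n Isum B C f V \<gamma> \<gamma>u \<alpha>i \<sigma> \<phi>
    by unfold_locales (use \<sigma> \<sigma>_bilip \<phi> bar in auto)
  have "omega_path n Isum \<gamma> \<sigma>"
    unfolding omega_path_def
  proof (intro conjI allI impI)
    show "classKinf (\<sigma> i)" "loc_lipschitz_on {0<..} (sinv (\<sigma> i))" if "i < n" for i
      using \<sigma>[OF that] loc_bilip_imp_loc_lipschitz_on[OF loc_bilip_sinv[OF \<sigma>[OF that] \<sigma>_bilip[OF that]]] by auto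
    show "\<exists>c C. 0 < c \<and> c \<le> C \<and> (\<forall>i<n. \<forall>r\<in>P. \<forall>d. (sinv (\<sigma> i) has_real_derivative d) (at r) \<longrightarrow> c \<le> d \<and> d \<le> C)"
      if "compact P \<and> P \<subseteq> {0<..}" for P
    proof -
      have "\<exists>c C. 0 < c \<and> c \<le> C \<and> (\<forall>i\<in>{..<n}. \<forall>r\<in>P. \<forall>d. (sinv (\<sigma> i) has_real_derivative d) (at r) \<longrightarrow> c \<le> d \<and> d \<le> C)"
        by (rule loc_bilip_deriv_bounds) (use loc_bilip_sinv[OF \<sigma> \<sigma>_bilip] that in auto)
      then show ?thesis by (simp only: Ball_def lessThan_iff)
    qed
    show "Gam n Isum \<gamma> (\<lambda>j. \<sigma> j r) i < \<sigma> i r" if "0 < r" "i < n" for r i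
    proof -
      have nn: "0 \<le> \<sigma> j r" if "j < n" for j using \<sigma>_nonneg[OF that] \<open>0 < r\<close> by simp
      have "Gam n Isum \<gamma> (\<lambda>j. \<sigma> j r) i = G (\<lambda>j. \<sigma> j r) 0 i" by (rule Gam_eq_Gambar[OF \<open>i < n\<close>]) (use nn in auto)
      also have "\<dots> \<le> G (\<lambda>j. \<sigma> j r) (\<xi> r) i"
        using classK_nonneg[OF classKinfD[OF \<xi>], of r] \<open>0 < r\<close> by (intro Gambar_mono \<open>i < n\<close> nn) auto
      also have "\<dots> < \<sigma> i r" by (rule path[OF that])
      finally show ?thesis .
    qed
  qed
  moreover have "ISS F" by (rule ISS_lyapunov_imp_ISS[OF F_cont F_lip P.Vmax_ISS_lyapunov])
  moreover have "F = (\<lambda>x u. \<Sum>i<n. f i x (proj (C i) u))" by (intro ext) (rule F_def)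
  moreover have "P.Vmax = (\<lambda>x. Max ((\<lambda>i. sinv (\<sigma> i) (V i (proj (B i) x))) ` {..<n}))"
    by (intro ext) (simp add: P.Vmax_def P.Y_def W_def)
  ultimately show ?thesis using \<phi> bar P.Vmax_ISS_lyapunov by auto
qed

end
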